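(* Let $L_n$ be the total weight of the minimum spanning tree of $K_n$ under i.i.d. $\mathrm{Exp}(1)$ edge weights, let $\deg(x)$ be the degree of a fixed vertex $x$ in that tree, let $p_0=2/n$ be the probability that a fixed edge lies in the tree, let $p_1$ be the probability that two fixed distinct edges sharing a vertex both lie in the tree, and let $p_2$ be the probability that two fixed disjoint edges both lie in the tree. Let $c_1,c_2$ be the real constants determined by the expansion $$\mathbf{E}[L_n^{\mathrm{unif}}]=\zeta(3)+\frac{c_1}{n}+\frac{c_2+o(1)}{n^{4/3}}\qquad(n\to\infty),$$ where $L_n^{\mathrm{unif}}$ is the total weight of the minimum spanning tree of $K_n$ under i.i.d. $\mathrm{Uniform}[0,1]$ edge weights. Then, as $n\to\infty$, $$\mathbf{E}[L_n]=\zeta(3)+\frac{c_1+\zeta(3)}n+\frac{c_2+o(1)}{n^{4/3}},$$ $$\mathbf{E}[\deg(x)^2]=10-4\zeta(3)-\frac{10+4(c_1+\zeta(3))}{n}-\frac{4c_2+o(1)}{n^{4/3}},$$ $$\frac{p_1}{p_0^2}=2-\zeta(3)+\frac{4-c_1-4\zeta(3)}n-\frac{c_2+o(1)}{n^{4/3}},$$ $$\frac{p_2}{p_0^2}=1+\frac{4\zeta(3)-5}{n}+O(n^{-2}).$$ In particular $\mathbf{E}[\deg(x)^2]$ converges at order $n^{-1}$, while $p_1/p_0^2\to 2-\zeta(3)$ and $p_2/p_0^2\to1$.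
   Context: $\zeta$ is the Riemann zeta function. The existence of the constants $c_1=0.0384956\ldots$ and $c_2$ with the displayed expansion of $\mathbf{E}[L_n^{\mathrm{unif}}]$ is a known theorem of Cooper, Frieze, Ince, Janson and Spencer and is taken as given. By symmetry, $p_0,p_1,p_2$ and $\mathbf{E}[\deg(x)^2]$ do not depend on the choice of edges or vertex. *)

theory Defs
  imports "HOL-Probability.Probability"
begin

text \<open>Simple undirected graphs are given by a set of edges, each edge being a two-element set
  of vertices; the complete graph \<open>K\<^sub>n\<close> has vertices \<open>0, \<dots>, n - 1\<close>.\<close>

definition K_edges :: "nat \<Rightarrow> nat set set" where
  "K_edges n = {e. e \<subseteq> {..<n} \<and> card e = 2}"

definition connected_graph :: "'a set \<Rightarrow> 'a set set \<Rightarrow> bool" where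
  "connected_graph V T \<longleftrightarrow> (\<forall>u\<in>V. \<forall>v\<in>V. (u, v) \<in> {(a, b). {a, b} \<in> T}\<^sup>*)"

text \<open>A cycle is listed by its successive vertices, the last one being joined to the first.\<close>

definition graph_cycle :: "'a set set \<Rightarrow> 'a list \<Rightarrow> bool" where
  "graph_cycle T vs \<longleftrightarrow> 3 \<le> length vs \<and> distinct vs \<and>
     (\<forall>i<length vs. {vs ! i, vs ! (Suc i mod length vs)} \<in> T)"

definition spanning_tree :: "nat \<Rightarrow> nat set set \<Rightarrow> bool" where
  "spanning_tree n T \<longleftrightarrow>
     T \<subseteq> K_edges n \<and> connected_graph {..<n} T \<and> (\<nexists>vs. graph_cycle T vs)"

text \<open>Edge weights are functions \<open>w\<close> on edges.\<close>

definition tree_weight :: "(nat set \<Rightarrow> real) \<Rightarrow> nat set set \<Rightarrow> real" where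
  "tree_weight w T = (\<Sum>e\<in>T. w e)"

definition is_mst :: "nat \<Rightarrow> (nat set \<Rightarrow> real) \<Rightarrow> nat set set \<Rightarrow> bool" where
  "is_mst n w T \<longleftrightarrow> spanning_tree n T \<and>
     (\<forall>T'. spanning_tree n T' \<longrightarrow> tree_weight w T \<le> tree_weight w T')"

text \<open>Under a continuous weight distribution the minimum spanning tree is almost surely unique.
  On the null set where it is not, the choice below depends on \<open>w\<close> only through the set of
  all minimum spanning trees, so that \<open>mst n\<close> is a measurable function of the weights.\<close>

definition mst :: "nat \<Rightarrow> (nat set \<Rightarrow> real) \<Rightarrow> nat set set" where
  "mst n w = (SOME T. is_mst n w T)"

definition mst_weight :: "nat \<Rightarrow> (nat set \<Rightarrow> real) \<Rightarrow> real" where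
  "mst_weight n w = tree_weight w (mst n w)"

definition mst_degree :: "nat \<Rightarrow> nat \<Rightarrow> (nat set \<Rightarrow> real) \<Rightarrow> nat" where
  "mst_degree n x w = card {e \<in> mst n w. x \<in> e}"

definition exp_weights :: "nat \<Rightarrow> (nat set \<Rightarrow> real) measure" where
  "exp_weights n = PiM (K_edges n) (\<lambda>_. density lborel (\<lambda>t. ennreal (exponential_density 1 t)))"

definition unif_weights :: "nat \<Rightarrow> (nat set \<Rightarrow> real) measure" where
  "unif_weights n = PiM (K_edges n) (\<lambda>_. uniform_measure lborel {0..1})"

definition E_L :: "nat \<Rightarrow> real" where
  "E_L n = (\<integral>w. mst_weight n w \<partial>exp_weights n)"

definition E_L_unif :: "nat \<Rightarrow> real" where
  "E_L_unif n = (\<integral>w. mst_weight n w \<partial>unif_weights n)"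

definition E_deg_sq :: "nat \<Rightarrow> nat \<Rightarrow> real" where
  "E_deg_sq n x = (\<integral>w. (real (mst_degree n x w))\<^sup>2 \<partial>exp_weights n)"

definition prob_in_mst :: "nat \<Rightarrow> nat set set \<Rightarrow> real" where
  "prob_in_mst n S = measure (exp_weights n) {w \<in> space (exp_weights n). S \<subseteq> mst n w}"

text \<open>The Riemann zeta function on real arguments \<open>s > 1\<close>, where its Dirichlet series converges.\<close>

definition zeta :: "real \<Rightarrow> real" where
  "zeta s = (\<Sum>k. 1 / real (Suc k) powr s)"

end

theory Submission
  imports Defs "HOL-Real_Asymp.Real_Asymp"
begin

text \<open>
  Almost surely the minimum spanning tree consists of the edges whose endpoints are not connected
  by lighter edges. When an edge of weight \<open>s\<close> merges two components of the graph of lighter edges,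
  \<open>\<Sum>\<^sub>x deg(x)\<^sup>2\<close> grows by \<open>2\<close> plus twice the sum of the degrees of its endpoints. The lack of memory
  of \<open>Exp(1)\<close> turns the expected total of these increments into an integral over \<open>s\<close> of a sum over
  all separated pairs, and in a forest this sum depends only on the component sizes. Together with
  \<open>L\<^sub>n = \<integral> (\<kappa>\<^sub>s - 1) ds\<close>, where \<open>\<kappa>\<^sub>s\<close> is the number of components, this yields the exact identity
  \<open>E[deg(x)\<^sup>2] = 10 - 10/n - 4 E[L\<^sub>n]\<close>, and exchangeability expresses \<open>p\<^sub>0, p\<^sub>1, p\<^sub>2\<close> through \<open>E[L\<^sub>n]\<close>.

  For the transition from the weight \<open>U\<^sub>n\<close> of the tree under uniform edge weights to \<open>L\<^sub>n\<close>, let \<open>h(p)\<close> be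
  the expectation of \<open>\<kappa> - 1\<close> in the random graph \<open>G(n,p)\<close>, so that \<open>E[L\<^sub>n]\<close> and \<open>E[U\<^sub>n]\<close> are the
  integrals of \<open>h(p)/(1-p)\<close> and \<open>h(p)\<close> over \<open>[0,1]\<close>. Differentiating the expectation of the sum of
  \<open>1/|C|\<close> over the components \<open>C\<close>, and comparing the bridges, the edges of a spanning forest and all
  edges of \<open>G(n,p)\<close>, each weighted by the inverse size of its component, gives
  \<open>n (E[L\<^sub>n] - E[U\<^sub>n]) = E[U\<^sub>n] + O(log\<^sup>2 n / n)\<close>.
\<close>

section \<open>Components of graphs on an initial segment of the naturals\<close>

text \<open>The given expansion controls only the integral of h, up to o(n^(-4/3)), and says nothing
  about h at a single p. Yet E[L_n] - E[U_n] is the integral of p h(p)/(1-p), of size about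
  zeta(3)/n, and is needed with an error o(n^(-4/3)) as well. The way out is an exact identity: let
  f be the expected sum of 1/|C|, normalised to vanish for connected graphs. Integrating the
  derivative of p f(p) over [0,1] expresses the wanted integral by that of h. What is left over is
  at most of order 1 + np, and as h is bounded by about n exp(-np/2), only p up to a multiple of log
  n / n matter.

  For the degrees, the shape of the trees disappears because a vertex in a component of size k lies
  in n - k separated pairs and a tree of size k has k - 1 edges. From (k - 1)(n - k)/k = (n - k) -
  n/k + 1 only two quantities survive: the number of separated pairs, which integrates to the n - 1
  tree edges, and the number of components, which integrates to L_n.

  Ties between weights, and with them the choice made in \<open>mst\<close>, concern a null set
  only; the tree is identified for injective weights.\<close>

definition conn :: "'a set set \<Rightarrow> 'a rel" where
  "conn S = {(a, b). {a, b} \<in> S}\<^sup>*"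

definition comp_of :: "'a set set \<Rightarrow> 'a \<Rightarrow> 'a set" where
  "comp_of S v = conn S `` {v}"

definition comp_size :: "'a set set \<Rightarrow> 'a \<Rightarrow> nat" where
  "comp_size S v = card (comp_of S v)"

text \<open>Phrased for the edge as a set, so that no order of its endpoints has to be chosen; it
  depends on \<open>S\<close> only through \<open>conn S\<close>.\<close>

definition joined :: "'a set set \<Rightarrow> 'a set \<Rightarrow> bool" where
  "joined S e \<longleftrightarrow> e \<times> e \<subseteq> conn S"

lemma conn_refl [simp]: "(x, x) \<in> conn S"
  by (simp add: conn_def)

lemma conn_sym: "(x, y) \<in> conn S \<Longrightarrow> (y, x) \<in> conn S"
proof -
  have "sym {(a, b). {a, b} \<in> S}" by (auto simp: sym_def insert_commute)
  then show "(x, y) \<in> conn S \<Longrightarrow> (y, x) \<in> conn S"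
    unfolding conn_def by (meson sym_rtrancl symD)
qed

lemma conn_trans: "(x, y) \<in> conn S \<Longrightarrow> (y, z) \<in> conn S \<Longrightarrow> (x, z) \<in> conn S"
  by (auto simp: conn_def)

lemma conn_edge: "{x, y} \<in> S \<Longrightarrow> (x, y) \<in> conn S"
  by (auto simp: conn_def)

lemma conn_mono: "S \<subseteq> T \<Longrightarrow> conn S \<subseteq> conn T"
  unfolding conn_def by (rule rtrancl_mono) auto

lemma joined_mono: "S \<subseteq> T \<Longrightarrow> joined S e \<Longrightarrow> joined T e"
  using conn_mono[of S T] by (auto simp: joined_def)

lemma joined_pair [simp]: "joined S {x, y} \<longleftrightarrow> (x, y) \<in> conn S"
  unfolding joined_def using conn_sym[of x y S] conn_sym[of y x S] by auto

lemma conn_subset: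
  assumes "\<And>x y. {x, y} \<in> S \<Longrightarrow> (x, y) \<in> conn T"
  shows "conn S \<subseteq> conn T"
proof -
  have "{(a, b). {a, b} \<in> S} \<subseteq> conn T" using assms by auto
  then have "{(a, b). {a, b} \<in> S}\<^sup>* \<subseteq> (conn T)\<^sup>*" by (rule rtrancl_mono)
  then show ?thesis by (simp add: conn_def)
qed

text \<open>A walk never needs the new edge more than once, since it can be cut short between two
  passages. The two orientations of the edge give the last two alternatives.\<close>

lemma conn_insert:
  "(x, y) \<in> conn (insert {u, v} S) \<longleftrightarrow>
     (x, y) \<in> conn S \<or> (x, u) \<in> conn S \<and> (v, y) \<in> conn S \<or> (x, v) \<in> conn S \<and> (u, y) \<in> conn S"
proof -
  have "{(a, b). {a, b} \<in> insert {u, v} S} = insert (u, v) (insert (v, u) {(a, b). {a, b} \<in> S})"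
    by (auto simp: doubleton_eq_iff)
  then have "conn (insert {u, v} S) = (insert (u, v) (insert (v, u) {(a, b). {a, b} \<in> S}))\<^sup>*"
    by (simp add: conn_def)
  \<comment> \<open>\<open>rtrancl_insert\<close> treats the two orientations as separate arcs, so
    alternatives using both of them appear; symmetry and transitivity absorb these
    afterwards.\<close>
  then have "(x, y) \<in> conn (insert {u, v} S) \<longleftrightarrow>
     (x, y) \<in> conn S \<or> (x, u) \<in> conn S \<and> (v, y) \<in> conn S \<or> (x, v) \<in> conn S \<and> (u, y) \<in> conn S
     \<or> (x, u) \<in> conn S \<and> (v, v) \<in> conn S \<and> (u, y) \<in> conn S
     \<or> (x, v) \<in> conn S \<and> (u, u) \<in> conn S \<and> (v, y) \<in> conn S
     \<or> (x, v) \<in> conn S \<and> (u, u) \<in> conn S \<and> (v, v) \<in> conn S \<and> (u, y) \<in> conn S"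
    unfolding rtrancl_insert conn_def[symmetric]
    by (auto simp: conn_def)
  then show ?thesis
    by (metis conn_trans conn_sym)
qed

lemma conn_insert_joined:
  assumes "(u, v) \<in> conn S"
  shows "conn (insert {u, v} S) = conn S"
  unfolding set_eq_iff split_paired_All conn_insert
  using assms by (metis conn_trans conn_sym)

text \<open>Exchange property of graphs: if \<open>x\<close> and \<open>y\<close> are connected only
  through \<open>{u, v}\<close>, a path between them crosses that edge, and its two remaining pieces
  together with \<open>{x, y}\<close> lead from \<open>u\<close> to \<open>v\<close>.\<close>

lemma conn_exchange:
  assumes "(x, y) \<in> conn (insert {u, v} S)" "(x, y) \<notin> conn S"
  shows "(u, v) \<in> conn (insert {x, y} S)"
  using assms conn_sym[of x u S] conn_sym[of v y S] conn_sym[of x v S] conn_sym[of u y S]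
    by (auto simp: conn_insert)

lemma mem_comp_of: "w \<in> comp_of S v \<longleftrightarrow> (v, w) \<in> conn S"
  by (simp add: comp_of_def)

lemma comp_of_eq: "(v, w) \<in> conn S \<Longrightarrow> comp_of S v = comp_of S w"
  unfolding set_eq_iff mem_comp_of by (metis conn_sym conn_trans)

lemma comp_of_disjoint: "(v, w) \<notin> conn S \<Longrightarrow> comp_of S v \<inter> comp_of S w = {}"
  unfolding disjoint_iff mem_comp_of by (metis conn_sym conn_trans)

lemma K_edges_iff: "e \<in> K_edges n \<longleftrightarrow> (\<exists>x y. x < n \<and> y < n \<and> x \<noteq> y \<and> e = {x, y})"
  unfolding K_edges_def by (auto simp: card_2_iff)

lemma finite_K_edges [simp]: "finite (K_edges n)"
proof -
  have "K_edges n \<subseteq> Pow {..<n}" by (auto simp: K_edges_def)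
  then show ?thesis by (rule finite_subset) simp
qed

lemma finite_edges: "S \<subseteq> K_edges n \<Longrightarrow> finite S"
  by (rule finite_subset[OF _ finite_K_edges])

lemma pair_in_K_edges: "{x, y} \<in> K_edges n \<longleftrightarrow> x < n \<and> y < n \<and> x \<noteq> y"
  unfolding K_edges_iff by (auto simp: doubleton_eq_iff)

lemma edge_eqI: "e \<in> K_edges n \<Longrightarrow> x \<in> e \<Longrightarrow> y \<in> e \<Longrightarrow> x \<noteq> y \<Longrightarrow> e = {x, y}"
  unfolding K_edges_iff by auto

lemma edgeE:
  assumes "S \<subseteq> K_edges n" "e \<in> S"
  obtains x y where "x < n" "y < n" "x \<noteq> y" "e = {x, y}"
proof -
  have "e \<in> K_edges n" using assms by (rule subsetD)
  then show ?thesis using that by (auto simp: K_edges_iff)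
qed

lemma conn_less:
  assumes "S \<subseteq> K_edges n" "(v, w) \<in> conn S" "v < n"
  shows "w < n"
  using assms(2,3) unfolding conn_def
proof (induction rule: rtrancl_induct)
  case (step y z)
  then show ?case using assms(1) pair_in_K_edges[of y z n] by auto
qed

lemma comp_of_subset: "S \<subseteq> K_edges n \<Longrightarrow> v < n \<Longrightarrow> comp_of S v \<subseteq> {..<n}"
  using conn_less[of S n v] by (auto simp: mem_comp_of)

lemma finite_comp_of: "S \<subseteq> K_edges n \<Longrightarrow> v < n \<Longrightarrow> finite (comp_of S v)"
  by (rule finite_subset[OF comp_of_subset finite_lessThan])

lemma comp_size_pos: "S \<subseteq> K_edges n \<Longrightarrow> v < n \<Longrightarrow> comp_size S v \<ge> 1"
  using finite_comp_of[of S n v] card_gt_0_iff[of "comp_of S v"] conn_refl[of v S] mem_comp_of[of v S v]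
  unfolding comp_size_def by auto

lemma comp_size_le: "S \<subseteq> K_edges n \<Longrightarrow> v < n \<Longrightarrow> comp_size S v \<le> n"
  unfolding comp_size_def using card_mono[OF finite_lessThan comp_of_subset, of S n v] by simp

lemma comp_of_insert:
  assumes "(u, v) \<notin> conn S"
  shows "comp_of (insert {u, v} S) w =
    (if w \<in> comp_of S u \<union> comp_of S v then comp_of S u \<union> comp_of S v else comp_of S w)"
proof (rule set_eqI)
  fix y
  show "y \<in> comp_of (insert {u, v} S) w \<longleftrightarrow> y \<in>
    (if w \<in> comp_of S u \<union> comp_of S v then comp_of S u \<union> comp_of S v else comp_of S w)"
    unfolding mem_comp_of conn_insert
    by (simp add: mem_comp_of) (metis conn_sym conn_trans)
qed

lemma comp_size_insert:
  assumes "S \<subseteq> K_edges n" "u < n" "v < n" "(u, v) \<notin> conn S"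
  shows "comp_size (insert {u, v} S) w =
    (if w \<in> comp_of S u \<union> comp_of S v then comp_size S u + comp_size S v else comp_size S w)"
  using assms comp_of_disjoint[OF assms(4)] finite_comp_of[OF assms(1)]
  by (simp add: comp_size_def comp_of_insert card_Un_disjoint)

lemma comp_of_empty [simp]: "comp_of {} v = {v}"
  by (auto simp: mem_comp_of conn_def)

lemma comp_size_empty [simp]: "comp_size {} v = 1"
  by (simp add: comp_size_def)

lemma comp_size_cong: "conn S = conn T \<Longrightarrow> comp_size S v = comp_size T v"
  by (simp add: comp_size_def comp_of_def)

lemma comp_size_eq: "(v, w) \<in> conn S \<Longrightarrow> comp_size S v = comp_size S w"
  unfolding comp_size_def using comp_of_eq by metis

text \<open>Component statistics are summed over vertices, so a component of size \<open>k\<close>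
  enters with the factor \<open>k\<close> and no set of components has to be formed.\<close>

definition comp_sum :: "nat \<Rightarrow> nat set set \<Rightarrow> (real \<Rightarrow> real) \<Rightarrow> real" where
  "comp_sum n S \<psi> = (\<Sum>v<n. \<psi> (real (comp_size S v)))"

text \<open>Only the vertices of the two merged components change their component size:
  \<open>a\<close> of them carried \<open>\<psi> a\<close>, \<open>b\<close> of them
  \<open>\<psi> b\<close>, and all \<open>a + b\<close> then carry \<open>\<psi> (a + b)\<close>.
  The increments of all component statistics are read off from this.\<close>

lemma comp_sum_insert:
  assumes "S \<subseteq> K_edges n" "u < n" "v < n" "(u, v) \<notin> conn S"
  defines "a \<equiv> real (comp_size S u)" and "b \<equiv> real (comp_size S v)"
  shows "comp_sum n (insert {u, v} S) \<psi> =
    comp_sum n S \<psi> - a * \<psi> a - b * \<psi> b + (a + b) * \<psi> (a + b)"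
proof -
  define A B C where "A = comp_of S u" "B = comp_of S v" "C = {..<n} - (A \<union> B)"
  have AB: "A \<subseteq> {..<n}" "B \<subseteq> {..<n}" "A \<inter> B = {}" "finite A" "finite B"
    using comp_of_subset[OF assms(1)] comp_of_disjoint[OF assms(4)] finite_comp_of[OF assms(1)] assms(2,3)
    by (simp_all add: A_B_C_def)
  have split: "sum h {..<n} = sum h A + sum h B + sum h C" for h :: "nat \<Rightarrow> real"
  proof -
    have "{..<n} = (A \<union> B) \<union> C" using AB by (auto simp: A_B_C_def)
    then have "sum h {..<n} = sum h (A \<union> B) + sum h C"
      using AB by (simp add: A_B_C_def sum.union_disjoint[symmetric])
    then show ?thesis using AB by (simp add: sum.union_disjoint)
  qed
  have size: "real (comp_size (insert {u, v} S) w) = (if w \<in> A \<union> B then a + b else real (comp_size S w))" for w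
    using comp_size_insert[OF assms(1-4), of w] by (simp add: A_B_C_def a_def b_def)
  have cards: "real (card A) = a" "real (card B) = b"
    by (simp_all add: A_B_C_def a_def b_def comp_size_def)
  have "(\<Sum>w\<in>A. \<psi> (real (comp_size (insert {u, v} S) w))) = (\<Sum>w\<in>A. \<psi> (a + b))"
    by (rule sum.cong) (auto simp: size)
  moreover have "(\<Sum>w\<in>B. \<psi> (real (comp_size (insert {u, v} S) w))) = (\<Sum>w\<in>B. \<psi> (a + b))"
    by (rule sum.cong) (auto simp: size)
  moreover have "(\<Sum>w\<in>C. \<psi> (real (comp_size (insert {u, v} S) w))) = (\<Sum>w\<in>C. \<psi> (real (comp_size S w)))"
    by (rule sum.cong) (auto simp: size A_B_C_def)
  moreover have "(\<Sum>w\<in>A. \<psi> (real (comp_size S w))) = a * \<psi> a"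
                "(\<Sum>w\<in>B. \<psi> (real (comp_size S w))) = b * \<psi> b"
  proof -
    have "(\<Sum>w\<in>A. \<psi> (real (comp_size S w))) = (\<Sum>w\<in>A. \<psi> a)"
      by (rule sum.cong) (auto simp: A_B_C_def a_def mem_comp_of dest: comp_size_eq)
    then show "(\<Sum>w\<in>A. \<psi> (real (comp_size S w))) = a * \<psi> a"
      by (simp add: A_B_C_def a_def comp_size_def)
    have "(\<Sum>w\<in>B. \<psi> (real (comp_size S w))) = (\<Sum>w\<in>B. \<psi> b)"
      by (rule sum.cong) (auto simp: A_B_C_def b_def mem_comp_of dest: comp_size_eq)
    then show "(\<Sum>w\<in>B. \<psi> (real (comp_size S w))) = b * \<psi> b"
      by (simp add: A_B_C_def b_def comp_size_def)
  qed
  ultimately show ?thesis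
    unfolding comp_sum_def split by (simp add: algebra_simps cards)
qed

text \<open>The number of components minus one: a component of size \<open>k\<close> is counted \<open>1 / k\<close> for each of
  its vertices.\<close>

definition kap :: "nat \<Rightarrow> nat set set \<Rightarrow> real" where
  "kap n S = comp_sum n S (\<lambda>k. 1 / k) - 1"

lemma kap_cong: "conn S = conn T \<Longrightarrow> kap n S = kap n T"
  by (simp add: kap_def comp_sum_def comp_size_cong[of S T])

lemma kap_insert:
  assumes "S \<subseteq> K_edges n" "e \<in> K_edges n"
  shows "kap n (insert e S) = kap n S - (if joined S e then 0 else 1)"
proof -
  obtain u v where uv: "u < n" "v < n" "e = {u, v}" using assms(2) by (auto simp: K_edges_iff)
  show ?thesis
  proof (cases "(u, v) \<in> conn S")
    case True
    then show ?thesis using uv kap_cong[OF conn_insert_joined[OF True], of n] by simp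
  next
    case False
    then show ?thesis
      using uv comp_sum_insert[OF assms(1) uv(1,2) False, of "\<lambda>k. 1 / k"] comp_size_pos[OF assms(1) uv(1)]
       comp_size_pos[OF assms(1) uv(2)]
      by (simp add: kap_def field_simps)
  qed
qed

lemma kap_empty: "kap n {} = real n - 1"
  by (simp add: kap_def comp_sum_def)

lemma kap_nonneg:
  assumes "S \<subseteq> K_edges n" "n \<ge> 1"
  shows "kap n S \<ge> 0"
proof -
  have "(\<Sum>v<n. 1 / real n) \<le> comp_sum n S (\<lambda>k. 1 / k)"
    unfolding comp_sum_def
  proof (rule sum_mono)
    fix v assume "v \<in> {..<n}"
    then show "1 / real n \<le> 1 / real (comp_size S v)"
      using comp_size_pos[OF assms(1), of v] comp_size_le[OF assms(1), of v]
      by (intro divide_left_mono) auto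
  qed
  then show ?thesis using assms(2) by (simp add: kap_def)
qed

lemma comp_size_connected:
  assumes "S \<subseteq> K_edges n" "connected_graph {..<n} S" "v < n"
  shows "comp_size S v = n"
proof -
  have "comp_of S v = {..<n}"
    using assms(2,3) comp_of_subset[OF assms(1,3)] by (auto simp: mem_comp_of connected_graph_def conn_def)
  then show ?thesis by (simp add: comp_size_def)
qed

lemma kap_connected:
  assumes "S \<subseteq> K_edges n" "connected_graph {..<n} S" "n \<ge> 1"
  shows "kap n S = 0"
  using assms comp_size_connected[OF assms(1,2)] by (simp add: kap_def comp_sum_def)

text \<open>Each edge lowers \<open>kap\<close> by at most one, starting from \<open>n - 1\<close>.
  This serves as the lower bound on the number of edges of a connected graph.\<close>

lemma kap_card:
  assumes "S \<subseteq> K_edges n"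
  shows "real n - 1 \<le> kap n S + real (card S)"
proof -
  have "finite S" by (rule finite_edges[OF assms])
  then show ?thesis using assms
  proof (induction S)
    case empty
    then show ?case by (simp add: kap_empty)
  next
    case (insert e S)
    then show ?case by (auto simp: kap_insert split: if_splits)
  qed
qed

text \<open>This is how being a forest enters the counting arguments.\<close>

definition tight :: "nat \<Rightarrow> nat set set \<Rightarrow> bool" where
  "tight n F \<longleftrightarrow> (\<forall>v<n. card {e \<in> F. e \<subseteq> comp_of F v} + 1 = comp_size F v)"

lemma tight_empty: "tight n {}"
  by (simp add: tight_def)

lemma edge_in_comp:
  assumes "S \<subseteq> K_edges n" "e \<in> S" "x \<in> e"
  shows "e \<subseteq> comp_of S v \<longleftrightarrow> x \<in> comp_of S v"
proof -
  have "y \<in> comp_of S v" if "y \<in> e" "x \<in> comp_of S v" for y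
  proof (cases "x = y")
    case False
    then have "e = {x, y}" using assms that edge_eqI[of e n x y] by auto
    then have "(x, y) \<in> conn S" using assms by (auto intro: conn_edge)
    then show ?thesis using that conn_trans by (metis mem_comp_of)
  qed (use that in auto)
  then show ?thesis using assms by auto
qed

text \<open>If trees with \<open>a\<close> and \<open>b\<close> vertices are merged, the result has
  \<open>(a - 1) + (b - 1) + 1 = a + b - 1\<close> edges; the other components keep theirs.\<close>

lemma tight_insert:
  assumes "F \<subseteq> K_edges n" "e \<in> K_edges n" "\<not> joined F e" "tight n F"
  shows "tight n (insert e F)"
  unfolding tight_def
proof (intro allI impI)
  fix w assume w: "w < n"
  obtain u v where uv: "u < n" "v < n" "e = {u, v}" using assms(2) by (auto simp: K_edges_iff)
  have sep: "(u, v) \<notin> conn F" using assms(3) uv by simp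
  have fin: "finite F" by (rule finite_edges[OF assms(1)])
  let ?A = "comp_of F u" and ?B = "comp_of F v"
  have disj: "?A \<inter> ?B = {}" using comp_of_disjoint[OF sep] .
  have "e \<notin> F" using sep uv conn_edge[of u v F] by auto
  show "card {f \<in> insert e F. f \<subseteq> comp_of (insert e F) w} + 1 = comp_size (insert e F) w"
  proof (cases "w \<in> ?A \<union> ?B")
    case True
    have ne: "\<exists>x. x \<in> f" if "f \<in> F" for f by (rule edgeE[OF assms(1) that]) auto
    have "{f \<in> insert e F. f \<subseteq> ?A \<union> ?B} = insert e ({f \<in> F. f \<subseteq> ?A} \<union> {f \<in> F. f \<subseteq> ?B})"
    proof (intro set_eqI iffI)
      fix f assume f: "f \<in> {f \<in> insert e F. f \<subseteq> ?A \<union> ?B}"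
      show "f \<in> insert e ({f \<in> F. f \<subseteq> ?A} \<union> {f \<in> F. f \<subseteq> ?B})"
      proof (cases "f = e")
        case False
        then have fF: "f \<in> F" using f by simp
        then obtain x where "x \<in> f" using ne by auto
        then show ?thesis
          using f fF edge_in_comp[OF assms(1) fF, of x u] edge_in_comp[OF assms(1) fF, of x v] by auto
      qed simp
    next
      fix f assume "f \<in> insert e ({f \<in> F. f \<subseteq> ?A} \<union> {f \<in> F. f \<subseteq> ?B})"
      then show "f \<in> {f \<in> insert e F. f \<subseteq> ?A \<union> ?B}"
        using uv(3) conn_refl[of u F] conn_refl[of v F] by (auto simp: mem_comp_of)
    qed
    moreover have "{f \<in> F. f \<subseteq> ?A} \<inter> {f \<in> F. f \<subseteq> ?B} = {}"
    proof (rule ccontr)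
      assume "{f \<in> F. f \<subseteq> ?A} \<inter> {f \<in> F. f \<subseteq> ?B} \<noteq> {}"
      then obtain f where f: "f \<in> F" "f \<subseteq> ?A" "f \<subseteq> ?B" by auto
      obtain x where "x \<in> f" using ne f(1) by auto
      then have "x \<in> ?A \<inter> ?B" using f by auto
      then show False using disj by simp
    qed
    ultimately have "card {f \<in> insert e F. f \<subseteq> ?A \<union> ?B} = 1 + card {f \<in> F. f \<subseteq> ?A} + card {f \<in> F. f \<subseteq> ?B}"
      using fin \<open>e \<notin> F\<close> by (simp add: card_Un_disjoint)
    moreover have "card {f \<in> F. f \<subseteq> ?A} + 1 = comp_size F u" "card {f \<in> F. f \<subseteq> ?B} + 1 = comp_size F v"
      using assms(4) uv by (auto simp: tight_def)
    ultimately show ?thesis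
      using True uv comp_of_insert[OF sep] comp_size_insert[OF assms(1) uv(1,2) sep] by simp
  next
    case False
    have "\<not> e \<subseteq> comp_of F w"
      using False uv by (auto simp: mem_comp_of dest: conn_sym)
    then have "{f \<in> insert e F. f \<subseteq> comp_of F w} = {f \<in> F. f \<subseteq> comp_of F w}" by auto
    then show ?thesis
      using False uv comp_of_insert[OF sep] comp_size_insert[OF assms(1) uv(1,2) sep] assms(4) w
      by (simp add: tight_def)
  qed
qed

text \<open>The size of the component that contains \<open>e\<close> once \<open>e\<close> is added
  to \<open>S\<close>. If \<open>S\<close> already joins the endpoints, the union is a single
  component, so the same formula weighs present and absent edges.\<close>

definition merged_size :: "'a set set \<Rightarrow> 'a set \<Rightarrow> nat" where
  "merged_size S e = card (\<Union>x\<in>e. comp_of S x)"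

lemma merged_size_joined:
  assumes "joined S e" "x \<in> e"
  shows "merged_size S e = comp_size S x"
proof -
  have "(\<Union>y\<in>e. comp_of S y) = comp_of S x"
    using assms by (auto simp: joined_def dest: comp_of_eq)
  then show ?thesis by (simp add: merged_size_def comp_size_def)
qed

lemma joined_edge:
  assumes "S \<subseteq> K_edges n" "e \<in> S"
  shows "joined S e"
proof -
  obtain u v where "e = {u, v}" by (rule edgeE[OF assms])
  then show ?thesis using assms(2) by (simp add: conn_edge)
qed

text \<open>Double counting of pairs of a vertex and an edge in its component, with weight
  \<open>\<phi> k / k\<close> for a component of size \<open>k\<close>: in a forest the vertex meets
  \<open>k - 1\<close> such edges, and the edge meets \<open>k\<close> such vertices.\<close>

lemma tight_sum:
  assumes "F \<subseteq> K_edges n" "tight n F"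
  shows "(\<Sum>e\<in>F. \<phi> (real (merged_size F e))) = comp_sum n F (\<lambda>k. (k - 1) / k * \<phi> k)"
proof -
  have fin: "finite F" by (rule finite_edges[OF assms(1)])
  have "comp_sum n F (\<lambda>k. (k - 1) / k * \<phi> k) =
    (\<Sum>v<n. \<Sum>e\<in>{e \<in> F. e \<subseteq> comp_of F v}. \<phi> (real (comp_size F v)) / real (comp_size F v))"
    unfolding comp_sum_def
  proof (rule sum.cong)
    fix v assume "v \<in> {..<n}"
    then have "card {e \<in> F. e \<subseteq> comp_of F v} + 1 = comp_size F v"
      using assms(2) by (auto simp: tight_def)
    then have "real (comp_size F v) - 1 = real (card {e \<in> F. e \<subseteq> comp_of F v})" by linarith
    then show "(real (comp_size F v) - 1) / real (comp_size F v) * \<phi> (real (comp_size F v)) =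
      (\<Sum>e\<in>{e \<in> F. e \<subseteq> comp_of F v}. \<phi> (real (comp_size F v)) / real (comp_size F v))" by simp
  qed simp
  also have "\<dots> = (\<Sum>e\<in>F. \<Sum>v\<in>{v \<in> {..<n}. e \<subseteq> comp_of F v}. \<phi> (real (comp_size F v)) / real (comp_size F v))"
    using fin by (rule sum.swap_restrict[OF finite_lessThan])
  also have "\<dots> = (\<Sum>e\<in>F. \<phi> (real (merged_size F e)))"
  proof (rule sum.cong)
    fix e assume e: "e \<in> F"
    obtain x where x: "x \<in> e" "x < n" by (rule edgeE[OF assms(1) e]) auto
    have "{v \<in> {..<n}. e \<subseteq> comp_of F v} = comp_of F x"
      using edge_in_comp[OF assms(1) e x(1)] comp_of_subset[OF assms(1) x(2)]
      by (auto simp: mem_comp_of dest: conn_sym)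
    then have "(\<Sum>v\<in>{v \<in> {..<n}. e \<subseteq> comp_of F v}. \<phi> (real (comp_size F v)) / real (comp_size F v))
      = (\<Sum>v\<in>comp_of F x. \<phi> (real (comp_size F x)) / real (comp_size F x))"
      by (intro sum.cong) (auto simp: mem_comp_of dest: comp_size_eq)
    also have "\<dots> = \<phi> (real (comp_size F x))"
      using comp_size_pos[OF assms(1) x(2)] by (simp add: comp_size_def)
    finally show "(\<Sum>v\<in>{v \<in> {..<n}. e \<subseteq> comp_of F v}. \<phi> (real (comp_size F v)) / real (comp_size F v)) =
         \<phi> (real (merged_size F e))"
      using merged_size_joined[OF joined_edge[OF assms(1) e] x(1)] by simp
  qed simp
  finally show ?thesis by simp
qed

lemma tight_card:
  assumes "F \<subseteq> K_edges n" "tight n F"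
  shows "real (card F) = real n - 1 - kap n F"
proof -
  have "real (card F) = comp_sum n F (\<lambda>k. (k - 1) / k)"
    using tight_sum[OF assms, of "\<lambda>_. 1"] by simp
  also have "\<dots> = (\<Sum>v<n. 1 - 1 / real (comp_size F v))"
    unfolding comp_sum_def
  proof (rule sum.cong)
    fix v assume "v \<in> {..<n}"
    then have "comp_size F v \<ge> 1" using comp_size_pos[OF assms(1)] by simp
    then show "(real (comp_size F v) - 1) / real (comp_size F v) = 1 - 1 / real (comp_size F v)"
      by (simp add: field_simps)
  qed simp
  finally show ?thesis by (simp add: kap_def comp_sum_def sum_subtractf)
qed

section \<open>Kruskal's rule and spanning forests\<close>

definition kruskal :: "('a set \<Rightarrow> real) \<Rightarrow> 'a set set \<Rightarrow> 'a set set" where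
  "kruskal w G = {e \<in> G. \<not> joined {g \<in> G. w g < w e} e}"

lemma kruskal_subset: "kruskal w G \<subseteq> G"
  by (auto simp: kruskal_def)

text \<open>Induction in order of increasing weight. The heaviest edge \<open>e\<close> comes last,
  so it belongs to no set of lighter edges and changes no earlier decision. It is kept exactly if
  the earlier edges leave its endpoints apart, and then \<open>tight_insert\<close> applies.
  Injectivity makes all earlier edges strictly lighter, as the rule demands.\<close>

lemma kruskal_forest:
  assumes "G \<subseteq> K_edges n" "inj_on w G"
  shows "conn (kruskal w G) = conn G \<and> tight n (kruskal w G)"
proof -
  have "finite G" by (rule finite_edges[OF assms(1)])
  then show ?thesis using assms
  proof (induction G rule: finite_ranking_induct[where f = w])
    case empty
    then show ?case by (simp add: kruskal_def tight_empty)
  next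
    case (insert e G)
    show ?case
    proof (cases "e \<in> G")
      case True
      then show ?thesis using insert by (simp add: insert_absorb)
    next
      case False
      have less: "w g < w e" if "g \<in> G" for g
        using insert.hyps(2)[OF that] insert.prems(2) that False
        by (metis inj_onD insertI1 insertI2 nless_le)
      have IH: "conn (kruskal w G) = conn G" "tight n (kruskal w G)"
        using insert by auto
      have e: "e \<in> K_edges n" and G: "G \<subseteq> K_edges n" using insert.prems by auto
      have kG: "kruskal w G \<subseteq> K_edges n" using kruskal_subset G by blast
      have low: "{g \<in> insert e G. w g < w f} = {g \<in> G. w g < w f}" if "f \<in> G" for f
        using less[OF that] by auto
      have top: "{g \<in> insert e G. w g < w e} = G" using less by auto
      have kr: "kruskal w (insert e G) = (if joined G e then kruskal w G else insert e (kruskal w G))"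
        unfolding kruskal_def using low top False by (auto simp: Collect_disj_eq)
      obtain u v where uv: "e = {u, v}" using e by (auto simp: K_edges_iff)
      show ?thesis
      proof (cases "joined G e")
        case True
        then show ?thesis using IH kr uv by (simp add: conn_insert_joined)
      next
        case False
        have "\<not> joined (kruskal w G) e" using False IH by (simp add: joined_def)
        then have "tight n (insert e (kruskal w G))" using tight_insert[OF kG e] IH by simp
        moreover have "conn (insert e (kruskal w G)) = conn (insert e G)"
          using IH(1) conn_insert[of _ _ u v] uv by auto
        ultimately show ?thesis using kr False by simp
      qed
    qed
  qed
qed

lemma ex_inj_real:
  assumes "finite G"
  shows "\<exists>w :: 'a \<Rightarrow> real. inj_on w G"
proof -
  obtain f :: "'a \<Rightarrow> nat" where "inj_on f G" using assms finite_imp_inj_to_nat_seg by metis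
  then have "inj_on (\<lambda>x. real (f x)) G" by (auto simp: inj_on_def)
  then show ?thesis by blast
qed

text \<open>Kruskal's rule with arbitrary injective weights on \<open>S\<close> produces such a
  forest.\<close>

lemma ex_forest:
  assumes "S \<subseteq> K_edges n"
  shows "\<exists>F\<subseteq>S. conn F = conn S \<and> tight n F"
proof -
  have "finite S" by (rule finite_edges[OF assms])
  then obtain w :: "nat set \<Rightarrow> real" where "inj_on w S" using ex_inj_real by blast
  then show ?thesis using kruskal_forest[OF assms] kruskal_subset by metis
qed

section \<open>Cycles, bridges and the number of edges of spanning trees\<close>

lemma rtrancl_distinct_path:
  assumes "(x, y) \<in> r\<^sup>*"
  shows "\<exists>xs. xs \<noteq> [] \<and> hd xs = x \<and> last xs = y \<and> distinct xs \<and>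
           (\<forall>i. Suc i < length xs \<longrightarrow> (xs ! i, xs ! Suc i) \<in> r)"
  using assms
proof (induction rule: rtrancl_induct)
  case base
  show ?case by (rule exI[of _ "[x]"]) simp
next
  case (step y z)
  then obtain xs where xs: "xs \<noteq> []" "hd xs = x" "last xs = y" "distinct xs"
    "\<And>i. Suc i < length xs \<Longrightarrow> (xs ! i, xs ! Suc i) \<in> r" by blast
  show ?case
  proof (cases "z \<in> set xs")
    \<comment> \<open>The new vertex already lies on the path, which is then cut off at that
      vertex.\<close>
    case True
    then obtain k where k: "k < length xs" "xs ! k = z" by (auto simp: in_set_conv_nth)
    have last: "last (take (Suc k) xs) = z"
      using k by (simp add: take_Suc_conv_app_nth)
    show ?thesis
    proof (intro exI conjI allI impI)
      show "take (Suc k) xs \<noteq> []" "hd (take (Suc k) xs) = x" "distinct (take (Suc k) xs)"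
        using xs(1,2,4) by simp_all
      show "last (take (Suc k) xs) = z" by (rule last)
    qed (use xs(5) in simp)
  next
    case False
    show ?thesis
    proof (intro exI conjI allI impI)
      fix i assume i: "Suc i < length (xs @ [z])"
      show "((xs @ [z]) ! i, (xs @ [z]) ! Suc i) \<in> r"
      proof (cases "Suc i < length xs")
        case True
        then show ?thesis using xs(5)[of i] by (simp add: nth_append)
      next
        case False
        then have "i = length xs - 1" "Suc i = length xs" using i by auto
        then have "(xs @ [z]) ! i = y" "(xs @ [z]) ! Suc i = z"
          using xs(1,3) by (simp_all add: nth_append last_conv_nth)
        then show ?thesis using step(2) by simp
      qed
    qed (use xs False in simp_all)
  qed
qed

lemma cycle_if_not_bridge:
  assumes "{u, v} \<in> T" "u \<noteq> v" "(u, v) \<in> conn (T - {{u, v}})"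
  shows "\<exists>vs. graph_cycle T vs"
proof -
  obtain xs where xs: "xs \<noteq> []" "hd xs = u" "last xs = v" "distinct xs"
    "\<And>i. Suc i < length xs \<Longrightarrow> {xs ! i, xs ! Suc i} \<in> T - {{u, v}}"
    using rtrancl_distinct_path[OF assms(3)[unfolded conn_def]] by auto
  have h: "xs ! 0 = u" "xs ! (length xs - 1) = v" using xs by (simp_all add: hd_conv_nth last_conv_nth)
  \<comment> \<open>One vertex would give \<open>u = v\<close>, and a path with two vertices would
    be the deleted edge itself; so there are at least three, as \<open>graph_cycle\<close>
    requires.\<close>
  have "length xs \<noteq> 1" using h assms(2) by auto
  moreover have "length xs \<noteq> 2" using xs(5)[of 0] h by (auto simp: numeral_2_eq_2)
  moreover have "length xs \<noteq> 0" using xs by simp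
  ultimately have "length xs \<ge> 3" by linarith
  have "{xs ! i, xs ! (Suc i mod length xs)} \<in> T" if "i < length xs" for i
  proof (cases "Suc i < length xs")
    case True
    then show ?thesis using xs(5) by simp
  next
    case False
    then have "i = length xs - 1" using that by simp
    then have "Suc i = length xs" "xs ! i = v" using h that by auto
    then have "Suc i mod length xs = 0" "xs ! i = v" by auto
    then show ?thesis using h assms(1) by (simp add: insert_commute)
  qed
  then show ?thesis using \<open>length xs \<ge> 3\<close> xs(4) by (auto simp: graph_cycle_def)
qed

lemma not_bridge_if_cycle:
  assumes "graph_cycle T vs"
  shows "\<exists>u v. {u, v} \<in> T \<and> (u, v) \<in> conn (T - {{u, v}})"
proof -
  define l where "l = length vs"
  have vs: "3 \<le> l" "distinct vs" "\<And>i. i < l \<Longrightarrow> {vs ! i, vs ! (Suc i mod l)} \<in> T"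
    using assms by (auto simp: graph_cycle_def l_def)
  define T' where "T' = T - {{vs ! (l - 1), vs ! 0}}"
  have step: "(vs ! i, vs ! Suc i) \<in> conn T'" if "Suc i < l" for i
  proof -
    have "{vs ! i, vs ! Suc i} \<in> T" using vs(3)[of i] that by simp
    \<comment> \<open>As \<open>vs\<close> is distinct, a coincidence with the closing edge would
      force \<open>i = 0\<close> and \<open>Suc i = l - 1\<close>, that is, a cycle of length
      two.\<close>
    moreover have "{vs ! i, vs ! Suc i} \<noteq> {vs ! (l - 1), vs ! 0}"
    proof -
      have d: "vs ! i = vs ! j \<longleftrightarrow> i = j" if "i < l" "j < l" for i j
        using nth_eq_iff_index_eq[OF vs(2)] that unfolding l_def by blast
      have "vs ! i \<noteq> vs ! (l - 1)" using d[of i "l - 1"] that by auto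
      moreover have "vs ! Suc i \<noteq> vs ! (l - 1) \<or> vs ! i \<noteq> vs ! 0"
        using d[of "Suc i" "l - 1"] d[of i 0] that vs(1) by auto
      ultimately show ?thesis unfolding doubleton_eq_iff by blast
    qed
    ultimately show ?thesis unfolding T'_def by (intro conn_edge) simp
  qed
  have path: "i < l \<longrightarrow> (vs ! 0, vs ! i) \<in> conn T'" for i
  proof (induction i)
    case (Suc i)
    show ?case
    proof
      assume "Suc i < l"
      then show "(vs ! 0, vs ! Suc i) \<in> conn T'"
        using Suc step[of i] conn_trans[of "vs ! 0" "vs ! i" T' "vs ! Suc i"] by simp
    qed
  qed simp
  have "(vs ! (l - 1), vs ! 0) \<in> conn T'" using path[of "l - 1"] vs(1) by (intro conn_sym[of "vs ! 0"]) simp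
  moreover have "{vs ! (l - 1), vs ! 0} \<in> T" using vs(3)[of "l - 1"] vs(1) by simp
  ultimately show ?thesis unfolding T'_def by (intro exI conjI)
qed

lemma connected_graph_conn: "connected_graph V T \<longleftrightarrow> (\<forall>u\<in>V. \<forall>v\<in>V. (u, v) \<in> conn T)"
  by (simp add: connected_graph_def conn_def)

text \<open>A bridge of \<open>T\<close> is also a bridge of every smaller edge set containing it,
  so the edges can be added one by one, each merging two components.\<close>

lemma tight_if_bridges:
  assumes "T \<subseteq> K_edges n" "\<And>e. e \<in> T \<Longrightarrow> \<not> joined (T - {e}) e"
  shows "tight n T"
proof -
  have "finite T" by (rule finite_edges[OF assms(1)])
  then show ?thesis using assms
  proof (induction T)
    case empty
    then show ?case by (simp add: tight_empty)
  next
    case (insert e T)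
    have "\<not> joined (T - {f}) f" if "f \<in> T" for f
      using insert.prems(2)[of f] that joined_mono[of "T - {f}" "insert e T - {f}" f] by auto
    then have "tight n T" using insert by auto
    moreover have "\<not> joined T e" using insert.prems(2)[of e] insert.hyps by simp
    ultimately show ?case using insert tight_insert[of T n e] by auto
  qed
qed

text \<open>Without cycles every edge is a bridge, so the graph is \<open>tight\<close> and
  connectedness fixes the number of edges. Conversely, deleting an edge of a cycle would leave the
  graph connected with fewer than \<open>n - 1\<close> edges, against
  \<open>kap_card\<close>.\<close>

lemma spanning_tree_iff:
  assumes "n \<ge> 1"
  shows "spanning_tree n T \<longleftrightarrow> T \<subseteq> K_edges n \<and> connected_graph {..<n} T \<and> card T = n - 1"
proof (cases "T \<subseteq> K_edges n \<and> connected_graph {..<n} T")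
  case True
  then have T: "T \<subseteq> K_edges n" "connected_graph {..<n} T" by auto
  have finT: "finite T" using T by (auto intro: finite_edges)
  have "(\<nexists>vs. graph_cycle T vs) \<longleftrightarrow> card T = n - 1"
  proof
    assume nc: "\<nexists>vs. graph_cycle T vs"
    have "\<not> joined (T - {e}) e" if eT: "e \<in> T" for e
    proof -
      obtain u v where uv: "e = {u, v}" "u \<noteq> v" by (rule edgeE[OF T(1) eT])
      then show ?thesis using eT nc cycle_if_not_bridge[of u v T] by auto
    qed
    then have "tight n T" using tight_if_bridges T by blast
    then have "real (card T) = real n - 1" using tight_card T kap_connected assms by auto
    then show "card T = n - 1" using assms by linarith
  next
    assume c: "card T = n - 1"
    show "\<nexists>vs. graph_cycle T vs"
    proof
      assume "\<exists>vs. graph_cycle T vs"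
      then obtain u v where uv: "{u, v} \<in> T" "(u, v) \<in> conn (T - {{u, v}})"
        using not_bridge_if_cycle by blast
      let ?S = "T - {{u, v}}"
      have "conn T = conn ?S"
        using conn_insert_joined[OF uv(2)] uv(1) by (simp add: insert_absorb)
      then have "kap n ?S = 0" using kap_connected[OF T assms] kap_cong by metis
      moreover have "?S \<subseteq> K_edges n" using T by auto
      ultimately have "real n - 1 \<le> real (card ?S)" using kap_card[of ?S n] by simp
      moreover have "card ?S < card T" using uv finT by (meson card_Diff1_less)
      ultimately show False using c assms by linarith
    qed
  qed
  then show ?thesis using True by (simp add: spanning_tree_def)
qed (auto simp: spanning_tree_def)

lemma connected_K_edges: "connected_graph {..<n} (K_edges n)"
  unfolding connected_graph_conn
proof (intro ballI)
  fix u v assume "u \<in> {..<n}" "v \<in> {..<n}"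
  then show "(u, v) \<in> conn (K_edges n)"
    by (cases "u = v") (auto intro!: conn_edge simp: pair_in_K_edges)
qed

lemma forest_spanning_tree:
  assumes "n \<ge> 1" "F \<subseteq> K_edges n" "conn F = conn (K_edges n)" "tight n F"
  shows "spanning_tree n F"
proof -
  have c: "connected_graph {..<n} F"
    using connected_K_edges[of n] assms(3) by (simp add: connected_graph_conn)
  then have "real (card F) = real n - 1"
    using tight_card[OF assms(2,4)] kap_connected[OF assms(2) c assms(1)] by simp
  then show ?thesis using spanning_tree_iff[OF assms(1)] assms(1,2) c by auto
qed

section \<open>Minimum spanning trees by Kruskal's rule\<close>

lemma finite_spanning_trees: "finite {T. spanning_tree n T}"
  by (rule finite_subset[of _ "Pow (K_edges n)"]) (auto simp: spanning_tree_def)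

lemma is_mst_mst:
  assumes "n \<ge> 1"
  shows "is_mst n w (mst n w)"
proof -
  obtain F where "spanning_tree n F"
    using forest_spanning_tree[OF assms] ex_forest[of "K_edges n" n] by auto
  then have "{T. spanning_tree n T} \<noteq> {}" by auto
  then obtain T where "is_arg_min (tree_weight w) (\<lambda>T. T \<in> {T. spanning_tree n T}) T"
    using ex_is_arg_min_if_finite[OF finite_spanning_trees] by blast
  then have "is_mst n w T" by (auto simp: is_mst_def is_arg_min_linorder)
  then show ?thesis unfolding mst_def by (rule someI)
qed

lemma mst_subset: "n \<ge> 1 \<Longrightarrow> mst n w \<subseteq> K_edges n"
  and card_mst: "n \<ge> 1 \<Longrightarrow> card (mst n w) = n - 1"
  using is_mst_mst[of n w] spanning_tree_iff[of n] by (auto simp: is_mst_def)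

text \<open>A tree edge \<open>e\<close> whose endpoints are joined by lighter edges could be
  exchanged: deleting it splits the tree, some lighter edge crosses the split, and the swap lowers
  the weight. So the tree is contained in the Kruskal forest, and both have \<open>n - 1\<close>
  edges. The argument applies to whichever minimal tree \<open>mst\<close> selects.\<close>

lemma mst_eq_kruskal:
  assumes "n \<ge> 1" "inj_on w (K_edges n)"
  shows "mst n w = kruskal w (K_edges n)"
proof -
  define T where "T = mst n w"
  have T: "T \<subseteq> K_edges n" "connected_graph {..<n} T" "card T = n - 1"
    and min: "\<And>T'. spanning_tree n T' \<Longrightarrow> tree_weight w T \<le> tree_weight w T'"
    using is_mst_mst[OF assms(1), of w] spanning_tree_iff[OF assms(1)] by (auto simp: is_mst_def T_def)
  have finT: "finite T" using T by (auto intro: finite_edges)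
  have "T \<subseteq> kruskal w (K_edges n)"
  proof
    fix e assume e: "e \<in> T"
    then have eK: "e \<in> K_edges n" using T by auto
    then obtain u v where uv: "e = {u, v}" by (auto simp: K_edges_iff)
    let ?L = "{g \<in> K_edges n. w g < w e}"
    show "e \<in> kruskal w (K_edges n)"
    proof (rule ccontr)
      assume "e \<notin> kruskal w (K_edges n)"
      then have j: "(u, v) \<in> conn ?L" using eK uv by (simp add: kruskal_def)
      define Q where "Q = T - {e}"
      have iQ: "insert e Q = T" using e by (auto simp: Q_def)
      have nb: "(u, v) \<notin> conn Q"
      proof
        assume "(u, v) \<in> conn Q"
        then have "conn T = conn Q" using conn_insert_joined[of u v Q] iQ uv by simp
        then have "kap n Q = 0" using kap_connected[OF T(1,2) assms(1)] kap_cong by metis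
        moreover have "Q \<subseteq> K_edges n" using T by (auto simp: Q_def)
        ultimately have "real n - 1 \<le> real (card Q)" using kap_card[of Q n] by simp
        moreover have "card Q < card T" unfolding Q_def using e finT by (meson card_Diff1_less)
        ultimately show False using T(3) assms(1) by linarith
      qed
      \<comment> \<open>The crossing edge: if every lighter edge stayed within a component of
        \<open>Q\<close>, so would the path of lighter edges from \<open>u\<close> to
        \<open>v\<close>.\<close>
      then have "\<not> conn ?L \<subseteq> conn Q" using j by auto
      then obtain x y where xy: "{x, y} \<in> ?L" "(x, y) \<notin> conn Q" using conn_subset[of ?L Q] by auto
      have xyn: "x < n" "y < n" using xy by (auto simp: pair_in_K_edges)
      have fQ: "{x, y} \<notin> Q" using xy(2) conn_edge[of x y Q] by auto
      let ?T = "insert {x, y} Q"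
      have "(x, y) \<in> conn (insert {u, v} Q)"
        using T(2) xyn iQ uv by (auto simp: connected_graph_conn)
      then have uv': "(u, v) \<in> conn ?T" using xy(2) by (rule conn_exchange)
      have "conn T \<subseteq> conn ?T"
      proof (rule conn_subset)
        fix p q assume "{p, q} \<in> T"
        then consider "{p, q} = {u, v}" | "{p, q} \<in> ?T" using iQ uv by auto
        then show "(p, q) \<in> conn ?T"
        proof cases
          case 1
          then show ?thesis using uv' conn_sym[OF uv'] by (auto simp: doubleton_eq_iff)
        next
          case 2
          then show ?thesis by (rule conn_edge)
        qed
      qed
      then have "connected_graph {..<n} ?T" using T(2) by (auto simp: connected_graph_conn)
      moreover have "card ?T = n - 1"
        using T(3) fQ finT e card_Suc_Diff1[OF finT e] by (simp add: Q_def)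
      moreover have "?T \<subseteq> K_edges n" using xy T by (auto simp: Q_def)
      ultimately have "spanning_tree n ?T" using spanning_tree_iff[OF assms(1)] by blast
      then have "tree_weight w T \<le> tree_weight w ?T" by (rule min)
      moreover have "tree_weight w ?T = w {x, y} + tree_weight w Q"
        using fQ finT by (simp add: tree_weight_def Q_def)
      moreover have "tree_weight w T = w e + tree_weight w Q"
        using finT e by (simp add: tree_weight_def Q_def sum.remove)
      ultimately show False using xy by simp
    qed
  qed
  moreover have "card (kruskal w (K_edges n)) = n - 1"
    using forest_spanning_tree[OF assms(1), of "kruskal w (K_edges n)"] kruskal_subset[of w "K_edges n"]
      kruskal_forest[OF _ assms(2), of n] spanning_tree_iff[OF assms(1)] by auto
  moreover have "finite (kruskal w (K_edges n))"
    using kruskal_subset finite_K_edges finite_subset by metis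
  ultimately show ?thesis unfolding T_def[symmetric] using T(3) by (intro card_subset_eq) auto
qed

section \<open>Sums over edges joining distinct components\<close>

definition sep_edges :: "nat \<Rightarrow> nat set set \<Rightarrow> nat set set" where
  "sep_edges n S = {e \<in> K_edges n. \<not> joined S e}"

lemma finite_edge: "e \<in> K_edges n \<Longrightarrow> finite e"
  by (auto simp: K_edges_iff)

lemma card_edge: "e \<in> K_edges n \<Longrightarrow> card e = 2"
  by (simp add: K_edges_def)

lemma finite_sep_edges [simp]: "finite (sep_edges n S)"
  by (simp add: sep_edges_def)

lemma sum_over_endpoints:
  fixes h :: "nat \<Rightarrow> real"
  assumes "A \<subseteq> K_edges n"
  shows "(\<Sum>e\<in>A. \<Sum>x\<in>e. h x) = (\<Sum>x<n. h x * real (card {e \<in> A. x \<in> e}))"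
proof -
  have fin: "finite A" by (rule finite_edges[OF assms])
  have "(\<Sum>e\<in>A. \<Sum>x\<in>e. h x) = (\<Sum>e\<in>A. \<Sum>x\<in>{x \<in> {..<n}. x \<in> e}. h x)"
  proof (rule sum.cong)
    fix e assume "e \<in> A"
    then have "e \<subseteq> {..<n}" using assms by (auto simp: K_edges_def)
    then have "{x \<in> {..<n}. x \<in> e} = e" by auto
    then show "(\<Sum>x\<in>e. h x) = (\<Sum>x\<in>{x \<in> {..<n}. x \<in> e}. h x)" by simp
  qed simp
  also have "\<dots> = (\<Sum>x<n. \<Sum>e\<in>{e \<in> A. x \<in> e}. h x)"
    using fin by (rule sum.swap_restrict[OF _ finite_lessThan])
  finally show ?thesis by (simp add: mult.commute)
qed

lemma card_edges_at:
  assumes "x < n" "B \<subseteq> {..<n} - {x}"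
  shows "card ((\<lambda>y. {x, y}) ` B) = card B"
  by (rule card_image) (use assms in \<open>auto simp: inj_on_def doubleton_eq_iff\<close>)

lemma edges_at_eq:
  assumes "x < n"
  shows "{e \<in> K_edges n. x \<in> e \<and> P e} = (\<lambda>y. {x, y}) ` {y \<in> {..<n} - {x}. P {x, y}}"
proof (intro set_eqI iffI)
  fix e assume e: "e \<in> {e \<in> K_edges n. x \<in> e \<and> P e}"
  then obtain a b where ab: "a < n" "b < n" "a \<noteq> b" "e = {a, b}" by (auto simp: K_edges_iff)
  then have "x = a \<or> x = b" using e by auto
  then show "e \<in> (\<lambda>y. {x, y}) ` {y \<in> {..<n} - {x}. P {x, y}}"
    using ab e by (auto simp: insert_commute)
qed (use assms in \<open>auto simp: pair_in_K_edges\<close>)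

lemma card_edges_at_vertex:
  assumes "x < n"
  shows "card {e \<in> K_edges n. x \<in> e} = n - 1"
proof -
  have "{y \<in> {..<n} - {x}. True} = {..<n} - {x}" by auto
  then show ?thesis
    using edges_at_eq[OF assms, of "\<lambda>_. True"] card_edges_at[OF assms, of "{..<n} - {x}"] assms
    by (simp del: Diff_iff)
qed

lemma card_sep_edges_at:
  assumes "S \<subseteq> K_edges n" "x < n"
  shows "real (card {e \<in> sep_edges n S. x \<in> e}) = real n - real (comp_size S x)"
proof -
  have "{e \<in> sep_edges n S. x \<in> e} = {e \<in> K_edges n. x \<in> e \<and> \<not> joined S e}"
    by (auto simp: sep_edges_def)
  also have "\<dots> = (\<lambda>y. {x, y}) ` ({..<n} - comp_of S x)"
    unfolding edges_at_eq[OF assms(2)] by (rule arg_cong2[of _ _ _ _ "(`)"]) (auto simp: mem_comp_of)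
  finally have "card {e \<in> sep_edges n S. x \<in> e} = card ({..<n} - comp_of S x)"
    using card_edges_at[OF assms(2), of "{..<n} - comp_of S x"] conn_refl[of x S]
    by (metis Diff_mono insert_subset mem_comp_of empty_subsetI order_refl)
  also have "\<dots> = n - comp_size S x"
    using comp_of_subset[OF assms] finite_comp_of[OF assms] by (simp add: card_Diff_subset comp_size_def)
  finally show ?thesis using comp_size_le[OF assms] by simp
qed

lemma sum_sep_edges:
  fixes h :: "nat \<Rightarrow> real"
  assumes "S \<subseteq> K_edges n"
  shows "(\<Sum>e\<in>sep_edges n S. \<Sum>x\<in>e. h x) = (\<Sum>x<n. h x * (real n - real (comp_size S x)))"
  using sum_over_endpoints[of "sep_edges n S" n h] card_sep_edges_at[OF assms]
  by (simp add: sep_edges_def)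

lemma card_sep_edges:
  assumes "S \<subseteq> K_edges n"
  shows "2 * real (card (sep_edges n S)) = (\<Sum>x<n. real n - real (comp_size S x))"
proof -
  have "(\<Sum>x<n. real n - real (comp_size S x)) = (\<Sum>e\<in>sep_edges n S. \<Sum>x\<in>e. 1)"
    using sum_sep_edges[OF assms, of "\<lambda>_. 1"] by simp
  also have "\<dots> = (\<Sum>e\<in>sep_edges n S. 2)"
    by (rule sum.cong) (auto simp: sep_edges_def card_edge)
  finally show ?thesis by simp
qed

text \<open>A vertex in a component of size \<open>k\<close> lies in \<open>n - k\<close> separated
  pairs. Regrouping by the edges of \<open>F\<close> gives each of them the weight
  \<open>2 * (n - k)\<close>, which \<open>tight_sum\<close> turns into a sum over component sizes;
  the individual degrees have disappeared.\<close>

lemma forest_degree_sum: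
  assumes "F \<subseteq> K_edges n" "tight n F"
  shows "(\<Sum>e\<in>sep_edges n F. \<Sum>x\<in>e. real (card {f \<in> F. x \<in> f})) + 2 * real n * kap n F =
    4 * real (card (sep_edges n F))"
proof -
  have pos: "comp_size F v \<ge> 1" if "v < n" for v using comp_size_pos[OF assms(1) that] .
  have "(\<Sum>e\<in>sep_edges n F. \<Sum>x\<in>e. real (card {f \<in> F. x \<in> f})) =
    (\<Sum>x<n. (real n - real (comp_size F x)) * real (card {f \<in> F. x \<in> f}))"
    using sum_sep_edges[OF assms(1)] by (simp add: mult.commute)
  also have "\<dots> = (\<Sum>e\<in>F. \<Sum>x\<in>e. real n - real (comp_size F x))"
    by (rule sum_over_endpoints[OF assms(1), symmetric])
  also have "\<dots> = (\<Sum>e\<in>F. 2 * (real n - real (merged_size F e)))"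
  proof (rule sum.cong)
    fix e assume e: "e \<in> F"
    then have "e \<in> K_edges n" using assms(1) by blast
    then show "(\<Sum>x\<in>e. real n - real (comp_size F x)) = 2 * (real n - real (merged_size F e))"
      using card_edge[of e n] by (simp flip: merged_size_joined[OF joined_edge[OF assms(1) e]])
  qed simp
  also have "\<dots> = comp_sum n F (\<lambda>k. (k - 1) / k * (2 * (real n - k)))"
    by (rule tight_sum[OF assms])
  \<comment> \<open>From \<open>(k - 1) * (n - k) / k = (n - k) - n / k + 1\<close>: the first term
    counts separated pairs, the second yields \<open>kap\<close>.\<close>
  also have "\<dots> = (\<Sum>x<n. 2 * (real n - real (comp_size F x)) - 2 * real n * (1 / real (comp_size F x)) + 2)"
    unfolding comp_sum_def
  proof (rule sum.cong)
    fix x assume "x \<in> {..<n}"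
    then show "(real (comp_size F x) - 1) / real (comp_size F x) * (2 * (real n - real (comp_size F x))) =
         2 * (real n - real (comp_size F x)) - 2 * real n * (1 / real (comp_size F x)) + 2"
      using pos[of x] by (simp add: field_simps)
  qed simp
  also have "\<dots> = 2 * (\<Sum>x<n. real n - real (comp_size F x)) - 2 * real n * (kap n F + 1) + 2 * real n"
    by (simp add: sum.distrib sum_subtractf sum_distrib_left kap_def comp_sum_def)
  finally show ?thesis using card_sep_edges[OF assms(1)] by (simp add: algebra_simps)
qed

section \<open>Increments of component statistics and weights of edges\<close>

definition sq_sum :: "nat \<Rightarrow> nat set set \<Rightarrow> real" where
  "sq_sum n S = comp_sum n S (\<lambda>k. 1 / k\<^sup>2) - 1 / real n"

text \<open>An edge counted here becomes a bridge when added, with the inverse of its component size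
  as weight. The sum is thus both the positive part of the increments of \<open>sq_sum\<close> and,
  through \<open>bern_force\<close>, a measure of the weight of the bridges.\<close>

definition merge_sum :: "nat \<Rightarrow> nat set set \<Rightarrow> real" where
  "merge_sum n S = (\<Sum>e\<in>sep_edges n S. 1 / real (merged_size S e))"

lemma merged_size_sep:
  assumes "S \<subseteq> K_edges n" "u < n" "v < n" "(u, v) \<notin> conn S"
  shows "merged_size S {u, v} = comp_size S u + comp_size S v"
  using assms comp_of_disjoint[OF assms(4)] finite_comp_of[OF assms(1)]
  by (simp add: merged_size_def comp_size_def card_Un_disjoint)

lemma merged_size_insert:
  assumes "S \<subseteq> K_edges n" "e \<in> K_edges n"
  shows "merged_size (insert e S) e = merged_size S e"
proof -
  obtain u v where uv: "u < n" "v < n" "e = {u, v}" using assms(2) by (auto simp: K_edges_iff)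
  show ?thesis
  proof (cases "(u, v) \<in> conn S")
    case True
    then show ?thesis using uv conn_insert_joined[OF True] by (simp add: merged_size_def comp_of_def)
  next
    case False
    then show ?thesis
      using uv comp_of_insert[OF False] by (simp add: merged_size_def mem_comp_of)
  qed
qed

lemma merged_size_cong: "conn S = conn T \<Longrightarrow> merged_size S e = merged_size T e"
  by (simp add: merged_size_def comp_of_def)

lemma sep_edges_disjoint: "S \<subseteq> K_edges n \<Longrightarrow> sep_edges n S \<subseteq> K_edges n - S"
  using joined_edge[of S n] by (auto simp: sep_edges_def)

lemma sum_sep_restrict:
  fixes g :: "nat set \<Rightarrow> real"
  assumes "S \<subseteq> K_edges n" "\<And>e. e \<in> K_edges n \<Longrightarrow> joined S e \<Longrightarrow> g e = 0"
  shows "(\<Sum>e\<in>K_edges n - S. g e) = (\<Sum>e\<in>sep_edges n S. g e)"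
  by (rule sum.mono_neutral_right) (use sep_edges_disjoint[OF assms(1)] assms(2) in \<open>auto simp: sep_edges_def\<close>)

lemma kap_drift:
  assumes "S \<subseteq> K_edges n"
  shows "(\<Sum>e\<in>K_edges n - S. kap n (insert e S) - kap n S) = - real (card (sep_edges n S))"
proof -
  have "(\<Sum>e\<in>K_edges n - S. kap n (insert e S) - kap n S) =
    (\<Sum>e\<in>sep_edges n S. kap n (insert e S) - kap n S)"
    by (rule sum_sep_restrict[OF assms]) (simp add: kap_insert[OF assms])
  also have "\<dots> = (\<Sum>e\<in>sep_edges n S. - 1)"
    by (rule sum.cong) (auto simp: sep_edges_def kap_insert[OF assms])
  finally show ?thesis by simp
qed

text \<open>A vertex in a component of size \<open>k\<close> lies in \<open>n - k\<close> separated
  pairs, each counted \<open>1 / k\<close>, which makes \<open>n / k - 1\<close>.\<close>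

lemma sum_sep_inverse:
  assumes "S \<subseteq> K_edges n"
  shows "(\<Sum>e\<in>sep_edges n S. \<Sum>x\<in>e. 1 / real (comp_size S x)) = real n * kap n S"
proof -
  have "(\<Sum>e\<in>sep_edges n S. \<Sum>x\<in>e. 1 / real (comp_size S x)) =
    (\<Sum>x<n. 1 / real (comp_size S x) * (real n - real (comp_size S x)))"
    by (rule sum_sep_edges[OF assms])
  also have "\<dots> = (\<Sum>x<n. real n * (1 / real (comp_size S x)) - 1)"
  proof (rule sum.cong)
    fix x assume "x \<in> {..<n}"
    then show "1 / real (comp_size S x) * (real n - real (comp_size S x)) = real n * (1 / real (comp_size S x)) - 1"
      using comp_size_pos[OF assms, of x] by (simp add: field_simps)
  qed simp
  also have "\<dots> = real n * kap n S"
    by (simp add: sum_subtractf sum_distrib_left kap_def comp_sum_def right_diff_distrib)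
  finally show ?thesis .
qed

text \<open>\<open>sq_sum\<close> is the sum of \<open>1 / |C|\<close> over the components
  \<open>C\<close>, less its value for a connected graph. Merging sizes \<open>a\<close> and
  \<open>b\<close> changes it by \<open>1 / (a + b) - 1 / a - 1 / b\<close>; the negative parts add
  up to \<open>n * kap\<close> by \<open>sum_sep_inverse\<close>.\<close>

lemma sq_sum_drift:
  assumes "S \<subseteq> K_edges n"
  shows "(\<Sum>e\<in>K_edges n - S. sq_sum n (insert e S) - sq_sum n S) = merge_sum n S - real n * kap n S"
proof -
  have "sq_sum n (insert e S) - sq_sum n S =
      (if joined S e then 0 else 1 / real (merged_size S e) - (\<Sum>x\<in>e. 1 / real (comp_size S x)))"
    if e: "e \<in> K_edges n" for e
  proof -
    obtain u v where uv: "u < n" "v < n" "u \<noteq> v" "e = {u, v}" using e by (auto simp: K_edges_iff)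
    show ?thesis
    proof (cases "(u, v) \<in> conn S")
      case True
      then show ?thesis
        using uv comp_size_cong[OF conn_insert_joined[OF True]] by (simp add: sq_sum_def comp_sum_def)
    next
      case False
      have "comp_size S u \<ge> 1" "comp_size S v \<ge> 1" using comp_size_pos[OF assms] uv by auto
      then show ?thesis
        using False uv comp_sum_insert[OF assms uv(1,2) False, of "\<lambda>k. 1 / k\<^sup>2"] merged_size_sep[OF assms uv(1,2) False]
        by (simp add: sq_sum_def power2_eq_square)
    qed
  qed
  note step = this
  have "(\<Sum>e\<in>K_edges n - S. sq_sum n (insert e S) - sq_sum n S) =
    (\<Sum>e\<in>sep_edges n S. sq_sum n (insert e S) - sq_sum n S)"
    by (rule sum_sep_restrict[OF assms]) (simp add: step)
  also have "\<dots> = (\<Sum>e\<in>sep_edges n S. 1 / real (merged_size S e) - (\<Sum>x\<in>e. 1 / real (comp_size S x)))"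
    by (rule sum.cong) (auto simp: sep_edges_def step)
  finally show ?thesis using sum_sep_inverse[OF assms] by (simp add: merge_sum_def sum_subtractf)
qed

text \<open>The factor \<open>1 / k\<close> in \<open>sum_sep_inverse\<close> is replaced by
  \<open>1\<close>. This bound is the source of the decay of \<open>kap\<close> at a rate of about
  \<open>n / 2\<close>.\<close>

lemma card_sep_edges_ge:
  assumes "S \<subseteq> K_edges n"
  shows "real n / 2 * kap n S \<le> real (card (sep_edges n S))"
proof -
  have "(\<Sum>x<n. 1 / real (comp_size S x) * (real n - real (comp_size S x))) \<le> (\<Sum>x<n. real n - real (comp_size S x))"
  proof (rule sum_mono)
    fix x assume "x \<in> {..<n}"
    then have "1 \<le> comp_size S x" "comp_size S x \<le> n"
      using comp_size_pos[OF assms] comp_size_le[OF assms] by auto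
    then show "1 / real (comp_size S x) * (real n - real (comp_size S x)) \<le> real n - real (comp_size S x)"
      by (intro mult_left_le_one_le) auto
  qed
  then show ?thesis
    using card_sep_edges[OF assms] sum_sep_inverse[OF assms] sum_sep_edges[OF assms, of "\<lambda>x. 1 / real (comp_size S x)"]
    by simp
qed

lemma merge_sum_nonneg: "merge_sum n S \<ge> 0"
  by (simp add: merge_sum_def sum_nonneg)

text \<open>\<open>1 / (a + b)\<close> is at most the mean of \<open>1 / a\<close> and
  \<open>1 / b\<close>, and these are summed by \<open>sum_sep_inverse\<close>.\<close>

lemma merge_sum_le:
  assumes "S \<subseteq> K_edges n"
  shows "merge_sum n S \<le> real n / 2 * kap n S"
proof -
  have "merge_sum n S \<le> (\<Sum>e\<in>sep_edges n S. (\<Sum>x\<in>e. 1 / real (comp_size S x)) / 2)"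
    unfolding merge_sum_def
  proof (rule sum_mono)
    fix e assume e: "e \<in> sep_edges n S"
    then obtain u v where uv: "u < n" "v < n" "u \<noteq> v" "e = {u, v}" "(u, v) \<notin> conn S"
      by (auto simp: sep_edges_def K_edges_iff)
    define a b where "a = real (comp_size S u)" "b = real (comp_size S v)"
    have ab: "a \<ge> 1" "b \<ge> 1" using comp_size_pos[OF assms] uv by (auto simp: a_b_def)
    then have "1 / (a + b) \<le> 1 / a" "1 / (a + b) \<le> 1 / b" by (auto intro!: divide_left_mono)
    then show "1 / real (merged_size S e) \<le> (\<Sum>x\<in>e. 1 / real (comp_size S x)) / 2"
      using merged_size_sep[OF assms uv(1,2,5)] uv by (simp add: a_b_def)
  qed
  also have "\<dots> = real n / 2 * kap n S"
    using sum_sep_inverse[OF assms] by (simp add: sum_divide_distrib[symmetric])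
  finally show ?thesis .
qed

text \<open>Vertex by vertex, with \<open>p = 1 / k\<close> and \<open>q = 1 / n\<close>: the
  difference of the squares is \<open>(p + q) * (p - q)\<close>, where
  \<open>0 \<le> q \<le> p \<le> 1\<close>.\<close>

lemma sq_sum_bounds:
  assumes "S \<subseteq> K_edges n" "n \<ge> 1"
  shows "0 \<le> sq_sum n S" "sq_sum n S \<le> 2 * kap n S"
proof -
  have *: "sq_sum n S = (\<Sum>x<n. 1 / (real (comp_size S x))\<^sup>2 - 1 / (real n)\<^sup>2)"
    using assms(2) by (simp add: sq_sum_def comp_sum_def sum_subtractf power2_eq_square)
  have **: "2 * kap n S = (\<Sum>x<n. 2 * (1 / real (comp_size S x) - 1 / real n))"
    using assms(2) by (simp add: kap_def comp_sum_def sum_subtractf sum_distrib_left right_diff_distrib)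
  have b: "0 \<le> 1 / (real (comp_size S x))\<^sup>2 - 1 / (real n)\<^sup>2 \<and>
     1 / (real (comp_size S x))\<^sup>2 - 1 / (real n)\<^sup>2 \<le> 2 * (1 / real (comp_size S x) - 1 / real n)"
    if "x < n" for x
  proof -
    define p q where "p = 1 / real (comp_size S x)" "q = 1 / real n"
    have "1 \<le> comp_size S x" "comp_size S x \<le> n"
      using comp_size_pos[OF assms(1) that] comp_size_le[OF assms(1) that] by auto
    then have pq: "0 \<le> q" "q \<le> p" "p \<le> 1" by (auto simp: p_q_def intro!: divide_left_mono)
    have "p\<^sup>2 - q\<^sup>2 = (p + q) * (p - q)" by (simp add: power2_eq_square algebra_simps)
    moreover have "0 \<le> (p + q) * (p - q)" using pq by simp
    moreover have "(p + q) * (p - q) \<le> 2 * (p - q)" using pq by (intro mult_right_mono) auto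
    ultimately show ?thesis by (simp add: p_q_def power_divide)
  qed
  show "0 \<le> sq_sum n S" unfolding * by (rule sum_nonneg) (use b in auto)
  show "sq_sum n S \<le> 2 * kap n S" unfolding * ** by (rule sum_mono) (use b in auto)
qed

text \<open>A tree with \<open>k\<close> vertices has \<open>k - 1\<close> edges of weight
  \<open>1 / k\<close>, in total \<open>1 - 1 / k\<close>. What remains is the number of components
  less the sum of their inverse sizes.\<close>

lemma forest_weight:
  assumes "F \<subseteq> K_edges n" "tight n F"
  shows "(\<Sum>e\<in>F. 1 / real (merged_size F e)) = kap n F - sq_sum n F + 1 - 1 / real n"
proof -
  have "(\<Sum>e\<in>F. 1 / real (merged_size F e)) = comp_sum n F (\<lambda>k. (k - 1) / k * (1 / k))"
    by (rule tight_sum[OF assms])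
  also have "\<dots> = (\<Sum>v<n. 1 / real (comp_size F v) - 1 / (real (comp_size F v))\<^sup>2)"
    unfolding comp_sum_def
  proof (rule sum.cong)
    fix v assume "v \<in> {..<n}"
    then have "comp_size F v \<ge> 1" using comp_size_pos[OF assms(1)] by simp
    then show "(real (comp_size F v) - 1) / real (comp_size F v) * (1 / real (comp_size F v)) =
        1 / real (comp_size F v) - 1 / (real (comp_size F v))\<^sup>2"
      by (simp add: field_simps power2_eq_square)
  qed simp
  finally show ?thesis by (simp add: kap_def sq_sum_def comp_sum_def sum_subtractf)
qed

text \<open>A spanning forest \<open>F\<close> of \<open>S\<close> contains every bridge of
  \<open>S\<close> and is contained in \<open>S\<close>; the weight of an edge depends only on the
  components, which \<open>F\<close> and \<open>S\<close> share.\<close>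

lemma edge_weight_bounds:
  assumes "S \<subseteq> K_edges n"
  shows "kap n S - sq_sum n S + 1 - 1 / real n \<le> (\<Sum>e\<in>S. 1 / real (merged_size S e))"
    and "(\<Sum>e\<in>{e \<in> S. \<not> joined (S - {e}) e}. 1 / real (merged_size S e)) \<le> kap n S - sq_sum n S + 1 - 1 / real n"
proof -
  obtain F where F: "F \<subseteq> S" "conn F = conn S" "tight n F" using ex_forest[OF assms] by blast
  have FK: "F \<subseteq> K_edges n" and fin: "finite S" using F(1) assms finite_subset[OF assms] by auto
  have eq: "(\<Sum>e\<in>F. 1 / real (merged_size S e)) = kap n S - sq_sum n S + 1 - 1 / real n"
    using forest_weight[OF FK F(3)] merged_size_cong[OF F(2)] kap_cong[OF F(2)] comp_size_cong[OF F(2)]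
    by (simp add: sq_sum_def comp_sum_def)
  show "kap n S - sq_sum n S + 1 - 1 / real n \<le> (\<Sum>e\<in>S. 1 / real (merged_size S e))"
    unfolding eq[symmetric] by (rule sum_mono2[OF fin F(1)]) simp
  have "{e \<in> S. \<not> joined (S - {e}) e} \<subseteq> F"
  proof
    fix e assume e: "e \<in> {e \<in> S. \<not> joined (S - {e}) e}"
    show "e \<in> F"
    proof (rule ccontr)
      assume "e \<notin> F"
      then have "F \<subseteq> S - {e}" using F(1) by auto
      moreover have "joined F e" using e joined_edge[OF assms, of e] F(2) by (simp add: joined_def)
      ultimately show False using e joined_mono by blast
    qed
  qed
  then show "(\<Sum>e\<in>{e \<in> S. \<not> joined (S - {e}) e}. 1 / real (merged_size S e)) \<le> kap n S - sq_sum n S + 1 - 1 / real n"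
    unfolding eq[symmetric] using finite_subset[OF F(1) fin] by (intro sum_mono2) auto
qed

text \<open>If the weight of an edge is split evenly between its endpoints, a vertex in a component
  of size \<open>k\<close> receives \<open>1 / (2 * k)\<close> from at most \<open>k\<close>
  edges.\<close>

lemma joined_weight_le:
  assumes "S \<subseteq> K_edges n"
  shows "(\<Sum>e\<in>{e \<in> K_edges n - S. joined S e}. 1 / real (merged_size S e)) \<le> real n / 2"
proof -
  let ?J = "{e \<in> K_edges n. joined S e}"
  have "(\<Sum>e\<in>{e \<in> K_edges n - S. joined S e}. 1 / real (merged_size S e)) \<le>
    (\<Sum>e\<in>?J. 1 / real (merged_size S e))"
    by (rule sum_mono2) auto
  also have "\<dots> = (\<Sum>e\<in>?J. \<Sum>x\<in>e. 1 / 2 / real (comp_size S x))"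
  proof (rule sum.cong)
    fix e assume e: "e \<in> ?J"
    have "(\<Sum>x\<in>e. 1 / 2 / real (comp_size S x)) = (\<Sum>x\<in>e. 1 / 2 / real (merged_size S e))"
      by (rule sum.cong) (use e in \<open>auto simp: merged_size_joined\<close>)
    then show "1 / real (merged_size S e) = (\<Sum>x\<in>e. 1 / 2 / real (comp_size S x))"
      using e card_edge[of e n] by simp
  qed simp
  also have "\<dots> = (\<Sum>x<n. 1 / 2 / real (comp_size S x) * real (card {e \<in> ?J. x \<in> e}))"
    by (rule sum_over_endpoints) auto
  also have "\<dots> \<le> (\<Sum>x<n. 1 / 2)"
  proof (rule sum_mono)
    fix x assume "x \<in> {..<n}"
    then have x: "x < n" by simp
    have "{e \<in> ?J. x \<in> e} = {e \<in> K_edges n. x \<in> e \<and> joined S e}" by auto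
    also have "\<dots> = (\<lambda>y. {x, y}) ` {y \<in> {..<n} - {x}. joined S {x, y}}" by (rule edges_at_eq[OF x])
    finally have "card {e \<in> ?J. x \<in> e} \<le> card {y \<in> {..<n} - {x}. joined S {x, y}}"
      by (simp add: card_image_le)
    also have "\<dots> \<le> card (comp_of S x)"
      by (rule card_mono[OF finite_comp_of[OF assms x]]) (auto simp: mem_comp_of)
    finally have "card {e \<in> ?J. x \<in> e} \<le> comp_size S x" by (simp add: comp_size_def)
    then show "1 / 2 / real (comp_size S x) * real (card {e \<in> ?J. x \<in> e}) \<le> 1 / 2"
      using comp_size_pos[OF assms x] by (simp add: field_simps)
  qed
  finally show ?thesis by simp
qed

lemma kap_K_edges: "n \<ge> 1 \<Longrightarrow> kap n (K_edges n) = 0"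
  using kap_connected[OF subset_refl connected_K_edges] .

lemma sq_sum_K_edges: "n \<ge> 1 \<Longrightarrow> sq_sum n (K_edges n) = 0"
  using sq_sum_bounds[of "K_edges n" n] kap_K_edges by simp

section \<open>Random subsets\<close>

text \<open>The expectation of \<open>g S\<close> for a random \<open>S \<subseteq> E\<close> containing each element independently with
  probability \<open>p\<close>.\<close>

definition bern :: "'e set \<Rightarrow> ('e set \<Rightarrow> real) \<Rightarrow> real \<Rightarrow> real" where
  "bern E g p = (\<Sum>S\<in>Pow E. g S * (p ^ card S * (1 - p) ^ (card E - card S)))"

definition bern_deriv :: "'e set \<Rightarrow> ('e set \<Rightarrow> real) \<Rightarrow> real \<Rightarrow> real" where
  "bern_deriv E g p = (\<Sum>S\<in>Pow E. g S * (real (card S) * p ^ (card S - 1) * (1 - p) ^ (card E - card S)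
      - real (card E - card S) * p ^ card S * (1 - p) ^ (card E - card S - 1)))"

text \<open>The polynomial \<open>bern E g p / (1 - p)\<close>, provided that \<open>g E = 0\<close>.\<close>

definition bern_quot :: "'e set \<Rightarrow> ('e set \<Rightarrow> real) \<Rightarrow> real \<Rightarrow> real" where
  "bern_quot E g p = (\<Sum>S\<in>Pow E - {E}. g S * (p ^ card S * (1 - p) ^ (card E - card S - 1)))"

lemma monomial_deriv:
  "((\<lambda>p :: real. p ^ a * (1 - p) ^ b) has_real_derivative
     (real a * p ^ (a - 1) * (1 - p) ^ b - real b * p ^ a * (1 - p) ^ (b - 1))) (at p)"
  by (auto intro!: derivative_eq_intros simp: algebra_simps)

lemma bern_has_deriv: "(bern E g has_real_derivative bern_deriv E g p) (at p)"
  unfolding bern_def[abs_def] bern_deriv_def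
  by (intro DERIV_sum DERIV_cmult monomial_deriv)

lemma bern_quot_differentiable: "\<exists>D. (bern_quot E g has_real_derivative D) (at p)"
  unfolding bern_quot_def[abs_def]
  by (intro exI) (rule DERIV_sum, rule DERIV_cmult, rule monomial_deriv)

lemma bern_continuous: "continuous_on A (bern E g)"
  by (rule DERIV_continuous_on) (rule has_field_derivative_at_within, rule bern_has_deriv)

lemma bern_quot_continuous: "continuous_on A (bern_quot E g)"
  unfolding bern_quot_def[abs_def] by (intro continuous_intros)

text \<open>Deleting and inserting the element \<open>e\<close> matches the pairs with
  \<open>e\<close> in \<open>S\<close> and the pairs with \<open>e\<close> outside
  \<open>S\<close>.\<close>

lemma sum_flip_edge:
  assumes "finite E"
  shows "(\<Sum>S\<in>Pow E. \<Sum>e\<in>S. G S e) = (\<Sum>S\<in>Pow E. \<Sum>e\<in>E - S. G (insert e S) e :: real)"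
proof -
  have fin: "finite S" if "S \<in> Pow E" for S using that assms finite_subset by auto
  have "(\<Sum>S\<in>Pow E. \<Sum>e\<in>S. G S e) = (\<Sum>(S, e)\<in>Sigma (Pow E) (\<lambda>S. S). G S e)"
    using assms fin by (intro sum.Sigma) auto
  also have "\<dots> = (\<Sum>(S, e)\<in>Sigma (Pow E) (\<lambda>S. E - S). G (insert e S) e)"
    by (rule sum.reindex_bij_witness[where i = "\<lambda>(S, e). (insert e S, e)" and j = "\<lambda>(S, e). (S - {e}, e)"])
      (auto simp: insert_absorb)
  also have "\<dots> = (\<Sum>S\<in>Pow E. \<Sum>e\<in>E - S. G (insert e S) e)"
    using assms fin by (intro sum.Sigma[symmetric]) auto
  finally show ?thesis .
qed

lemma card_insert_edge:
  assumes "finite E" "S \<in> Pow E" "e \<in> E - S"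
  shows "card (insert e S) = Suc (card S)" "card E - card S = Suc (card E - Suc (card S))"
proof -
  have fin: "finite S" using assms finite_subset by auto
  then show c: "card (insert e S) = Suc (card S)" using assms by simp
  have "card (insert e S) \<le> card E" using assms by (intro card_mono) auto
  then show "card E - card S = Suc (card E - Suc (card S))" using c by simp
qed

text \<open>Inserting an absent element multiplies the probability of a set by
  \<open>p / (1 - p)\<close>; the denominator is cleared, so \<open>p = 1\<close> needs no
  exception.\<close>

lemma bern_force:
  assumes "finite E"
  shows "(1 - p) * bern E (\<lambda>S. \<Sum>e\<in>S. \<phi> S e) p = p * bern E (\<lambda>S. \<Sum>e\<in>E - S. \<phi> (insert e S) e) p"
proof -
  have "(1 - p) * bern E (\<lambda>S. \<Sum>e\<in>S. \<phi> S e) p =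
    (\<Sum>S\<in>Pow E. \<Sum>e\<in>S. \<phi> S e * (p ^ card S * (1 - p) ^ (card E - card S)) * (1 - p))"
    by (simp add: bern_def sum_distrib_left sum_distrib_right mult_ac)
  also have "\<dots> = (\<Sum>S\<in>Pow E. \<Sum>e\<in>E - S. \<phi> (insert e S) e *
      (p ^ card (insert e S) * (1 - p) ^ (card E - card (insert e S))) * (1 - p))"
    by (rule sum_flip_edge[OF assms])
  also have "\<dots> = (\<Sum>S\<in>Pow E. \<Sum>e\<in>E - S. \<phi> (insert e S) e *
      (p ^ card S * (1 - p) ^ (card E - card S)) * p)"
    by (intro sum.cong refl) (simp add: card_insert_edge(1)[OF assms] card_insert_edge(2)[OF assms])
  also have "\<dots> = p * bern E (\<lambda>S. \<Sum>e\<in>E - S. \<phi> (insert e S) e) p"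
    by (simp add: bern_def sum_distrib_left sum_distrib_right mult_ac)
  finally show ?thesis .
qed

text \<open>Russo's formula. The increment caused by \<open>e\<close> does not depend on the
  presence of \<open>e\<close>, so it may be averaged over the sets without \<open>e\<close>, at the
  price of the factor \<open>1 - p\<close>.\<close>

lemma bern_deriv_eq:
  assumes "finite E"
  shows "(1 - p) * bern_deriv E g p = bern E (\<lambda>S. \<Sum>e\<in>E - S. g (insert e S) - g S) p"
proof -
  have cS: "card (E - S) = card E - card S" if "S \<in> Pow E" for S
    using that assms finite_subset by (intro card_Diff_subset) auto
  have "(1 - p) * bern_deriv E g p =
     (\<Sum>S\<in>Pow E. \<Sum>e\<in>S. g S * (p ^ (card S - 1) * (1 - p) ^ (card E - card S) * (1 - p)))
     - (\<Sum>S\<in>Pow E. \<Sum>e\<in>E - S. g S * (p ^ card S * (1 - p) ^ (card E - card S - 1) * (1 - p)))"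
    unfolding bern_deriv_def sum_distrib_left sum_subtractf[symmetric]
    by (intro sum.cong refl) (simp add: cS algebra_simps)
  also have "(\<Sum>S\<in>Pow E. \<Sum>e\<in>S. g S * (p ^ (card S - 1) * (1 - p) ^ (card E - card S) * (1 - p)))
     = (\<Sum>S\<in>Pow E. \<Sum>e\<in>E - S. g (insert e S) *
        (p ^ (card (insert e S) - 1) * (1 - p) ^ (card E - card (insert e S)) * (1 - p)))"
    by (rule sum_flip_edge[OF assms])
  also have "\<dots> = (\<Sum>S\<in>Pow E. \<Sum>e\<in>E - S. g (insert e S) * (p ^ card S * (1 - p) ^ (card E - card S)))"
    by (intro sum.cong refl) (simp add: card_insert_edge(1)[OF assms] card_insert_edge(2)[OF assms])
  also have "(\<Sum>S\<in>Pow E. \<Sum>e\<in>E - S. g S * (p ^ card S * (1 - p) ^ (card E - card S - 1) * (1 - p))) =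
     (\<Sum>S\<in>Pow E. \<Sum>e\<in>E - S. g S * (p ^ card S * (1 - p) ^ (card E - card S)))"
    by (intro sum.cong refl) (simp add: card_insert_edge(2)[OF assms])
  finally show ?thesis
    unfolding bern_def by (simp only: sum_subtractf sum_distrib_right left_diff_distrib)
qed

text \<open>Every monomial with \<open>S\<close> different from \<open>E\<close> contains a factor
  \<open>1 - p\<close>, and the one for \<open>E\<close> has coefficient
  \<open>g E = 0\<close>.\<close>

lemma bern_quot_mult:
  assumes "finite E" "g E = 0"
  shows "(1 - p) * bern_quot E g p = bern E g p"
proof -
  have "bern E g p = (\<Sum>S\<in>Pow E - {E}. g S * (p ^ card S * (1 - p) ^ (card E - card S)))"
    unfolding bern_def using assms by (intro sum.mono_neutral_right) auto
  also have "\<dots> = (1 - p) * bern_quot E g p"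
    unfolding bern_quot_def sum_distrib_left
  proof (rule sum.cong)
    fix S assume "S \<in> Pow E - {E}"
    then have "card S < card E" using psubset_card_mono[OF assms(1), of S] by blast
    then have "card E - card S = Suc (card E - card S - 1)" by simp
    then have "(1 - p) ^ (card E - card S) = (1 - p) * (1 - p) ^ (card E - card S - 1)"
      by (simp only: power_Suc[symmetric])
    then show "g S * (p ^ card S * (1 - p) ^ (card E - card S)) =
         (1 - p) * (g S * (p ^ card S * (1 - p) ^ (card E - card S - 1)))" by simp
  qed simp
  finally show ?thesis by simp
qed

lemma bern_mono:
  assumes "0 \<le> p" "p \<le> 1" "\<And>S. S \<subseteq> E \<Longrightarrow> g S \<le> g' S"
  shows "bern E g p \<le> bern E g' p"
  unfolding bern_def using assms by (intro sum_mono mult_right_mono) auto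

lemma bern_quot_mono:
  assumes "0 \<le> p" "p \<le> 1" "\<And>S. S \<subseteq> E \<Longrightarrow> g S \<le> g' S"
  shows "bern_quot E g p \<le> bern_quot E g' p"
  unfolding bern_quot_def using assms by (intro sum_mono mult_right_mono) auto

lemma bern_add: "bern E (\<lambda>S. g S + g' S) p = bern E g p + bern E g' p"
  by (simp add: bern_def sum.distrib distrib_right)

lemma bern_diff: "bern E (\<lambda>S. g S - g' S) p = bern E g p - bern E g' p"
  by (simp add: bern_def sum_subtractf left_diff_distrib)

lemma bern_cmult: "bern E (\<lambda>S. c * g S) p = c * bern E g p"
  and bern_quot_cmult: "bern_quot E (\<lambda>S. c * g S) p = c * bern_quot E g p"
  by (simp_all add: bern_def bern_quot_def sum_distrib_left mult.assoc)

lemma bern_quot_nonneg: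
  assumes "0 \<le> p" "p \<le> 1" "\<And>S. S \<subseteq> E \<Longrightarrow> 0 \<le> g S"
  shows "0 \<le> bern_quot E g p"
  unfolding bern_quot_def using assms by (intro sum_nonneg mult_nonneg_nonneg) auto

lemma bern_const:
  assumes "finite E"
  shows "bern E (\<lambda>S. c) p = c"
proof -
  have "(\<Prod>e\<in>E. p + (1 - p)) = (\<Sum>S\<in>Pow E. (\<Prod>e\<in>S. p) * (\<Prod>e\<in>E - S. 1 - p))"
    by (rule prod_add[OF assms])
  also have "\<dots> = (\<Sum>S\<in>Pow E. p ^ card S * (1 - p) ^ (card E - card S))"
    using finite_subset[OF _ assms] by (intro sum.cong refl) (simp add: card_Diff_subset)
  finally show ?thesis by (simp add: bern_def sum_distrib_left[symmetric])
qed

lemma bern_one: "finite E \<Longrightarrow> bern E g 1 = g E"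
proof -
  assume fin: "finite E"
  have "bern E g 1 = (\<Sum>S\<in>{E}. g S * (1 ^ card S * (1 - 1) ^ (card E - card S)))"
    unfolding bern_def
  proof (rule sum.mono_neutral_right)
    show "\<forall>S\<in>Pow E - {E}. g S * (1 ^ card S * (1 - 1) ^ (card E - card S)) = 0"
    proof
      fix S assume "S \<in> Pow E - {E}"
      then have "card S < card E" using psubset_card_mono[OF fin, of S] by blast
      then show "g S * (1 ^ card S * (1 - 1) ^ (card E - card S)) = 0" by (simp add: power_0_left)
    qed
  qed (use fin in auto)
  then show ?thesis by simp
qed

lemma bern_quot_zero:
  assumes "finite E" "E \<noteq> {}"
  shows "bern_quot E g 0 = g {}"
proof -
  have "bern_quot E g 0 = (\<Sum>S\<in>{{}}. g S * (0 ^ card S * (1 - 0) ^ (card E - card S - 1)))"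
    unfolding bern_quot_def
  proof (rule sum.mono_neutral_right)
    show "\<forall>S\<in>Pow E - {E} - {{}}. g S * (0 ^ card S * (1 - 0) ^ (card E - card S - 1)) = 0"
    proof
      fix S assume "S \<in> Pow E - {E} - {{}}"
      then have "card S \<noteq> 0" using finite_subset[OF _ assms(1), of S] by auto
      then show "g S * (0 ^ card S * (1 - 0) ^ (card E - card S - 1)) = 0" by (simp add: power_0_left)
    qed
  qed (use assms in auto)
  then show ?thesis by simp
qed

section \<open>Exponential decay of the expected excess of components\<close>

lemma bern_kap_deriv_le:
  assumes "0 \<le> p" "p < 1" "n \<ge> 1"
  shows "bern_deriv (K_edges n) (kap n) p \<le> - (real n / 2) * bern_quot (K_edges n) (kap n) p"
proof -
  let ?E = "K_edges n"
  have "(1 - p) * bern_deriv ?E (kap n) p = bern ?E (\<lambda>S. \<Sum>e\<in>?E - S. kap n (insert e S) - kap n S) p"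
    by (rule bern_deriv_eq) simp
  also have "\<dots> \<le> bern ?E (\<lambda>S. - (real n / 2) * kap n S) p"
    using assms(1,2) card_sep_edges_ge by (intro bern_mono) (auto simp: kap_drift)
  also have "\<dots> = - (real n / 2) * ((1 - p) * bern_quot ?E (kap n) p)"
    using bern_quot_mult[of ?E "kap n" p] kap_K_edges[OF assms(3)] by (simp only: bern_cmult) simp
  finally have "(1 - p) * bern_deriv ?E (kap n) p \<le> (1 - p) * (- (real n / 2) * bern_quot ?E (kap n) p)"
    by (simp only: mult.left_commute)
  then show ?thesis using assms(2) by (subst (asm) mult_le_cancel_left_pos) auto
qed

text \<open>With \<open>h = (1 - p) * g\<close>, the bound on \<open>h'\<close> becomes
  \<open>(1 - p) * g' \<le> - (n / 2 - 1) * g\<close>; the \<open>1\<close> missing from the rate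
  comes from differentiating \<open>1 - p\<close>. Hence \<open>g * exp (c * p)\<close> does not
  increase, and it starts from \<open>g 0 = n - 1\<close>.\<close>

lemma bern_quot_kap_decay:
  assumes "0 \<le> p" "p \<le> 1" "n \<ge> 2"
  shows "bern_quot (K_edges n) (kap n) p \<le> real n * exp (- (real n / 2 - 1) * p)"
proof -
  define g where "g = bern_quot (K_edges n) (kap n)"
  define c where "c = real n / 2 - 1"
  have c: "c \<ge> 0" using assms(3) by (simp add: c_def)
  have h: "bern (K_edges n) (kap n) x = (1 - x) * g x" for x
    using bern_quot_mult[of "K_edges n" "kap n" x] kap_K_edges[of n] assms(3) by (simp add: g_def)
  have gnn: "0 \<le> g x" if "0 \<le> x" "x \<le> 1" for x
    unfolding g_def using that kap_nonneg[of _ n] assms(3) by (intro bern_quot_nonneg) auto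
  have "g p * exp (c * p) \<le> g 0 * exp (c * 0)"
  proof (rule DERIV_nonpos_imp_decreasing_open[OF assms(1)])
    show "continuous_on {0..p} (\<lambda>p. g p * exp (c * p))"
      unfolding g_def by (intro continuous_intros bern_quot_continuous)
    fix x assume x: "0 < x" "x < p"
    obtain D where D: "(g has_real_derivative D) (at x)"
      using bern_quot_differentiable unfolding g_def by blast
    have "((\<lambda>x. (1 - x) * g x) has_real_derivative (1 - x) * D - g x) (at x)"
      by (auto intro!: derivative_eq_intros D)
    then have "(bern (K_edges n) (kap n) has_real_derivative (1 - x) * D - g x) (at x)"
      by (simp add: h[abs_def])
    then have "(1 - x) * D - g x = bern_deriv (K_edges n) (kap n) x"
      using bern_has_deriv DERIV_unique by blast
    also have "\<dots> \<le> - (real n / 2) * g x"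
      unfolding g_def using x assms by (intro bern_kap_deriv_le) auto
    finally have "(1 - x) * D \<le> - c * g x" by (simp add: c_def algebra_simps)
    \<comment> \<open>Weakening the bound by the factor \<open>1 - x\<close> is possible because
      \<open>c * g x\<close> is nonnegative; it allows \<open>1 - x\<close> to be cancelled.\<close>
    also have "\<dots> \<le> (1 - x) * (- c * g x)"
    proof -
      have "0 \<le> x * (c * g x)" using x c gnn[of x] assms(2) by simp
      then show ?thesis by (simp add: algebra_simps)
    qed
    finally have "D \<le> - c * g x"
      using x assms(2) by (subst (asm) mult_le_cancel_left_pos) auto
    then have "(D + c * g x) * exp (c * x) \<le> 0" by (simp add: mult_nonpos_nonneg)
    moreover have "((\<lambda>p. g p * exp (c * p)) has_real_derivative (D + c * g x) * exp (c * x)) (at x)"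
      by (auto intro!: derivative_eq_intros D simp: algebra_simps)
    ultimately show "\<exists>y. ((\<lambda>p. g p * exp (c * p)) has_real_derivative y) (at x) \<and> y \<le> 0" by blast
  qed
  moreover have "{0, 1} \<in> K_edges n" using assms(3) by (simp add: pair_in_K_edges)
  then have "g 0 = real n - 1"
    using bern_quot_zero[of "K_edges n" "kap n"] by (auto simp: g_def kap_empty)
  ultimately have "g p * exp (c * p) \<le> real n" by simp
  then have "g p \<le> real n * exp (- c * p)" by (simp add: exp_minus field_simps)
  then show ?thesis unfolding g_def c_def .
qed

text \<open>Up to the constant \<open>1 - 1 / n\<close>, the expected weight of the bridges minus that of the edges of a
  spanning forest.\<close>

definition defect :: "nat \<Rightarrow> real \<Rightarrow> real" where
  "defect n p = p * bern_quot (K_edges n) (merge_sum n) p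
     - bern (K_edges n) (kap n) p + bern (K_edges n) (sq_sum n) p"

lemma merge_sum_K_edges: "n \<ge> 1 \<Longrightarrow> merge_sum n (K_edges n) = 0"
  using merge_sum_le[of "K_edges n" n] merge_sum_nonneg[of n "K_edges n"] kap_K_edges[of n] by simp

lemma bern_forest_weight:
  "bern (K_edges n) (\<lambda>S. kap n S - sq_sum n S + 1 - 1 / real n) p =
     bern (K_edges n) (kap n) p - bern (K_edges n) (sq_sum n) p + 1 - 1 / real n"
  by (simp add: bern_add bern_diff bern_const)

text \<open>\<open>bern_force\<close> with an edge weighed only if it is a bridge: an absent edge
  becomes a bridge exactly if it joins distinct components, which produces \<open>merge_sum\<close>.
  Bridges weigh at most as much as a spanning forest.\<close>

lemma merge_upper:
  assumes "0 \<le> p" "p \<le> 1"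
  shows "p * bern (K_edges n) (merge_sum n) p \<le>
    (1 - p) * bern (K_edges n) (\<lambda>S. kap n S - sq_sum n S + 1 - 1 / real n) p"
proof -
  let ?E = "K_edges n"
  let ?\<phi> = "\<lambda>S e. if joined (S - {e}) e then 0 else 1 / real (merged_size S e)"
  have eq: "(\<Sum>e\<in>?E - S. ?\<phi> (insert e S) e) = merge_sum n S" if S: "S \<subseteq> ?E" for S
  proof -
    have "(\<Sum>e\<in>?E - S. ?\<phi> (insert e S) e) = (\<Sum>e\<in>?E - S. if joined S e then 0 else 1 / real (merged_size S e))"
      using S by (intro sum.cong refl) (simp add: merged_size_insert)
    also have "\<dots> = (\<Sum>e\<in>sep_edges n S. if joined S e then 0 else 1 / real (merged_size S e))"
      by (rule sum_sep_restrict[OF S]) simp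
    also have "\<dots> = merge_sum n S"
      unfolding merge_sum_def by (rule sum.cong) (auto simp: sep_edges_def)
    finally show ?thesis .
  qed
  have le: "(\<Sum>e\<in>S. ?\<phi> S e) \<le> kap n S - sq_sum n S + 1 - 1 / real n" if S: "S \<subseteq> ?E" for S
  proof -
    have "(\<Sum>e\<in>S. ?\<phi> S e) = (\<Sum>e\<in>{e \<in> S. \<not> joined (S - {e}) e}. 1 / real (merged_size S e))"
      using finite_subset[OF S] by (subst sum.inter_filter) (auto intro!: sum.cong)
    then show ?thesis using edge_weight_bounds(2)[OF S] by simp
  qed
  have "p * bern ?E (merge_sum n) p = p * bern ?E (\<lambda>S. \<Sum>e\<in>?E - S. ?\<phi> (insert e S) e) p"
    unfolding bern_def using eq by (intro arg_cong2[of _ _ _ _ "(*)"] sum.cong refl) auto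
  also have "\<dots> = (1 - p) * bern ?E (\<lambda>S. \<Sum>e\<in>S. ?\<phi> S e) p"
    by (rule bern_force[symmetric]) simp
  also have "\<dots> \<le> (1 - p) * bern ?E (\<lambda>S. kap n S - sq_sum n S + 1 - 1 / real n) p"
    using assms le by (intro mult_left_mono bern_mono) auto
  finally show ?thesis .
qed

text \<open>\<open>bern_force\<close> with all edges weighed, which together weigh at least as much
  as a spanning forest. Absent edges inside a component now contribute too, at most
  \<open>n / 2\<close> in total.\<close>

lemma merge_lower:
  assumes "0 \<le> p" "p \<le> 1"
  shows "(1 - p) * bern (K_edges n) (\<lambda>S. kap n S - sq_sum n S + 1 - 1 / real n) p \<le>
    p * bern (K_edges n) (merge_sum n) p + p * (real n / 2)"
proof -
  let ?E = "K_edges n"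
  let ?\<phi> = "\<lambda>S e. 1 / real (merged_size S e)"
  have le: "(\<Sum>e\<in>?E - S. ?\<phi> (insert e S) e) \<le> merge_sum n S + real n / 2" if S: "S \<subseteq> ?E" for S
  proof -
    have "(\<Sum>e\<in>?E - S. ?\<phi> (insert e S) e) = (\<Sum>e\<in>?E - S. ?\<phi> S e)"
      using S by (intro sum.cong refl) (simp add: merged_size_insert)
    also have "(\<Sum>e\<in>?E - S. ?\<phi> S e) = (\<Sum>e\<in>sep_edges n S \<union> {e \<in> ?E - S. joined S e}. ?\<phi> S e)"
      by (rule sum.cong) (use sep_edges_disjoint[OF S] in \<open>auto simp: sep_edges_def\<close>)
    also have "\<dots> = merge_sum n S + (\<Sum>e\<in>{e \<in> ?E - S. joined S e}. ?\<phi> S e)"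
      unfolding merge_sum_def by (rule sum.union_disjoint) (auto simp: sep_edges_def)
    finally show ?thesis using joined_weight_le[OF S] by simp
  qed
  have "(1 - p) * bern ?E (\<lambda>S. kap n S - sq_sum n S + 1 - 1 / real n) p \<le>
    (1 - p) * bern ?E (\<lambda>S. \<Sum>e\<in>S. ?\<phi> S e) p"
    using assms edge_weight_bounds(1) by (intro mult_left_mono bern_mono) auto
  also have "\<dots> = p * bern ?E (\<lambda>S. \<Sum>e\<in>?E - S. ?\<phi> (insert e S) e) p"
    by (rule bern_force) simp
  also have "\<dots> \<le> p * bern ?E (\<lambda>S. merge_sum n S + real n / 2) p"
    using assms le by (intro mult_left_mono bern_mono) auto
  finally show ?thesis by (simp add: bern_add bern_const distrib_left)
qed

text \<open>Both comparisons with the spanning forest are divided by \<open>1 - p\<close>. For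
  \<open>p \<le> 1 / 2\<close> the excess \<open>p * n / 2\<close> is at most
  \<open>(1 - p) * n * p\<close>, so the division leaves \<open>n * p\<close>; the constant
  \<open>1\<close> covers \<open>1 - 1 / n\<close>.\<close>

lemma defect_small:
  assumes "0 \<le> p" "p \<le> 1 / 2" "n \<ge> 1"
  shows "\<bar>defect n p\<bar> \<le> 1 + real n * p"
proof -
  let ?E = "K_edges n"
  define u W where "u = bern_quot ?E (merge_sum n) p"
    and "W = bern ?E (kap n) p - bern ?E (sq_sum n) p"
  have B: "bern ?E (merge_sum n) p = (1 - p) * u"
    using bern_quot_mult[of ?E "merge_sum n" p] merge_sum_K_edges[OF assms(3)] by (simp add: u_def)
  have d: "defect n p = p * u - W" by (simp add: defect_def u_def W_def)
  have "(1 - p) * (p * u) \<le> (1 - p) * (W + 1 - 1 / real n)"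
    using merge_upper[of p n] assms by (simp add: B bern_forest_weight W_def mult_ac)
  then have "p * u \<le> W + 1 - 1 / real n"
    using assms(2) by (subst (asm) mult_le_cancel_left_pos) auto
  then have up: "p * u - W \<le> 1" by (simp add: field_simps) (smt (verit) divide_nonneg_nonneg of_nat_0_le_iff)
  have "(1 - p) * (W + 1 - 1 / real n) \<le> (1 - p) * (p * u) + p * (real n / 2)"
    using merge_lower[of p n] assms by (simp add: B bern_forest_weight W_def mult_ac)
  also have "p * (real n / 2) \<le> (1 - p) * (real n * p)"
  proof -
    have "1 / 2 * (real n * p) \<le> (1 - p) * (real n * p)"
      using assms by (intro mult_right_mono) auto
    then show ?thesis by (simp add: mult_ac)
  qed
  finally have "(1 - p) * (W + 1 - 1 / real n) \<le> (1 - p) * (p * u + real n * p)"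
    by (simp add: distrib_left)
  then have "W + 1 - 1 / real n \<le> p * u + real n * p"
    using assms(2) by (subst (asm) mult_le_cancel_left_pos) auto
  moreover have "1 / real n \<le> 1" using assms(3) by simp
  ultimately have "- (real n * p) \<le> p * u - W" by linarith
  then show ?thesis unfolding d using up assms by (auto simp: abs_le_iff) (smt (verit) mult_nonneg_nonneg of_nat_0_le_iff)
qed

text \<open>Every term is controlled by \<open>kap\<close>: \<open>merge_sum\<close> is at most
  \<open>n / 2 * kap\<close>, and \<open>0 \<le> sq_sum \<le> 2 * kap\<close> puts
  \<open>sq_sum - kap\<close> between \<open>- kap\<close> and \<open>kap\<close>. Thus the defect
  inherits exponential decay.\<close>

lemma defect_large:
  assumes "0 \<le> p" "p \<le> 1" "n \<ge> 1"
  shows "\<bar>defect n p\<bar> \<le> real n * bern_quot (K_edges n) (kap n) p"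
proof -
  let ?E = "K_edges n"
  define g where "g = bern_quot ?E (kap n) p"
  have "0 \<le> bern_quot ?E (merge_sum n) p"
    using assms merge_sum_nonneg by (intro bern_quot_nonneg) auto
  then have u0: "0 \<le> p * bern_quot ?E (merge_sum n) p" using assms by simp
  have "bern_quot ?E (merge_sum n) p \<le> bern_quot ?E (\<lambda>S. real n / 2 * kap n S) p"
    using assms merge_sum_le by (intro bern_quot_mono) auto
  then have u1: "p * bern_quot ?E (merge_sum n) p \<le> p * (real n / 2 * g)"
    using assms unfolding bern_quot_cmult g_def by (intro mult_left_mono) auto
  have h: "bern ?E (kap n) p = (1 - p) * g"
    using bern_quot_mult[of ?E "kap n" p] kap_K_edges[OF assms(3)] by (simp add: g_def)
  have f0: "0 \<le> bern ?E (sq_sum n) p"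
    using bern_mono[of p ?E "\<lambda>S. 0" "sq_sum n"] assms sq_sum_bounds(1)[of _ n] by (simp add: bern_const)
  have f1: "bern ?E (sq_sum n) p \<le> 2 * bern ?E (kap n) p"
    using bern_mono[of p ?E "sq_sum n" "\<lambda>S. 2 * kap n S"] assms sq_sum_bounds(2)[of _ n] by (simp add: bern_cmult)
  have "g \<ge> 0" unfolding g_def using assms kap_nonneg[of _ n] by (intro bern_quot_nonneg) auto
  have "\<bar>defect n p\<bar> \<le> p * (real n / 2 * g) + (1 - p) * g"
    using u0 u1 f0 f1 h unfolding defect_def abs_le_iff by linarith
  also have "\<dots> = (p * (real n / 2) + (1 - p)) * g" by (simp add: algebra_simps)
  also have "\<dots> \<le> real n * g"
  proof (rule mult_right_mono[OF _ \<open>g \<ge> 0\<close>])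
    have "p * (real n / 2) \<le> p * real n" using assms by (intro mult_left_mono) auto
    moreover have "(1 - p) * 1 \<le> (1 - p) * real n" using assms by (intro mult_left_mono) auto
    ultimately show "p * (real n / 2) + (1 - p) \<le> real n" by (simp add: algebra_simps)
  qed
  finally show ?thesis by (simp add: g_def)
qed

text \<open>The integral of \<open>f + p * f'\<close>, the derivative of \<open>p * f\<close>,
  vanishes since \<open>f 1 = 0\<close>. Substituting \<open>f' = u - n * g\<close> from
  \<open>sq_sum_drift\<close> expresses the integral of \<open>n * p * g\<close> through those of
  \<open>f\<close> and \<open>p * u\<close>, and \<open>p * g = g - h\<close>.\<close>

lemma defect_integral:
  assumes "n \<ge> 1"
  defines "h \<equiv> bern (K_edges n) (kap n)" and "g \<equiv> bern_quot (K_edges n) (kap n)"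
  shows "integral {0..1} (defect n) = real n * (integral {0..1} g - integral {0..1} h) - integral {0..1} h"
proof -
  let ?E = "K_edges n"
  define f f' u where "f = bern ?E (sq_sum n)" and "f' = bern_deriv ?E (sq_sum n)"
    and "u = bern_quot ?E (merge_sum n)"
  have h: "h p = (1 - p) * g p" for p
    using bern_quot_mult[of ?E "kap n" p] kap_K_edges[OF assms(1)] by (simp add: g_def h_def)
  have f': "(1 - p) * f' p = (1 - p) * (u p - real n * g p)" for p
  proof -
    have "(1 - p) * f' p = bern ?E (\<lambda>S. \<Sum>e\<in>?E - S. sq_sum n (insert e S) - sq_sum n S) p"
      unfolding f'_def by (rule bern_deriv_eq) simp
    also have "\<dots> = bern ?E (\<lambda>S. merge_sum n S - real n * kap n S) p"
      unfolding bern_def by (intro sum.cong refl) (simp add: sq_sum_drift)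
    also have "\<dots> = bern ?E (merge_sum n) p - real n * h p"
      by (simp add: bern_diff bern_cmult h_def)
    finally show ?thesis
      using bern_quot_mult[of ?E "merge_sum n" p] merge_sum_K_edges[OF assms(1)] h[of p]
      by (simp add: u_def algebra_simps)
  qed
  have cont: "continuous_on {0..1} g" "continuous_on {0..1} h" "continuous_on {0..1} u" "continuous_on {0..1} f"
    unfolding g_def h_def u_def f_def by (rule bern_continuous bern_quot_continuous)+
  have "((\<lambda>p. f p + p * f' p) has_integral (1 * f 1 - 0 * f 0)) {0..1}"
  proof (rule fundamental_theorem_of_calculus)
    fix p :: real assume "p \<in> {0..1}"
    have "((\<lambda>p. p * f p) has_real_derivative f p + p * f' p) (at p within {0..1})"
      unfolding f_def f'_def
      by (rule has_field_derivative_at_within) (auto intro!: derivative_eq_intros bern_has_deriv)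
    then show "((\<lambda>p. p * f p) has_vector_derivative f p + p * f' p) (at p within {0..1})"
      by (rule has_real_derivative_iff_has_vector_derivative[THEN iffD1])
  qed simp
  moreover have "f 1 = 0" using bern_one[of ?E "sq_sum n"] sq_sum_K_edges[OF assms(1)] by (simp add: f_def)
  ultimately have "((\<lambda>p. f p + p * f' p) has_integral 0) {0..1}" by simp
  \<comment> \<open>\<open>f'\<close> is known only up to the factor \<open>1 - p\<close>; the point
    \<open>p = 1\<close>, where this cannot be cancelled, is negligible for the integral.\<close>
  then have "((\<lambda>p. f p + p * (u p - real n * g p)) has_integral 0) {0..1}"
  proof (rule has_integral_spike_finite[rotated 2])
    show "finite {1 :: real}" by simp
    fix p :: real assume "p \<in> {0..1} - {1}"
    then show "f p + p * (u p - real n * g p) = f p + p * f' p" using f'[of p] by simp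
  qed
  moreover have "((\<lambda>p. real n * g p - real n * h p - h p) has_integral
      (real n * integral {0..1} g - real n * integral {0..1} h - integral {0..1} h)) {0..1}"
    using cont by (intro has_integral_diff has_integral_mult_right integrable_integral integrable_continuous_real)
  ultimately have "((\<lambda>p. (f p + p * (u p - real n * g p)) + (real n * g p - real n * h p - h p)) has_integral
      (0 + (real n * integral {0..1} g - real n * integral {0..1} h - integral {0..1} h))) {0..1}"
    by (rule has_integral_add)
  moreover have "(f p + p * (u p - real n * g p)) + (real n * g p - real n * h p - h p) = defect n p" for p
    by (simp add: defect_def f_def[symmetric] u_def[symmetric] h_def[symmetric]) (simp add: h algebra_simps)
  ultimately show ?thesis by (simp add: integral_unique algebra_simps)
qed

text \<open>Up to \<open>T\<close> the bound for small \<open>p\<close> is integrated, beyond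
  \<open>T\<close> the decaying one; \<open>T\<close> stays free until the asymptotics are
  taken.\<close>

lemma defect_integral_bound:
  assumes "n \<ge> 2" "0 \<le> T" "T \<le> 1 / 2"
  shows "\<bar>integral {0..1} (defect n)\<bar> \<le> T + real n * T\<^sup>2 + (real n)\<^sup>2 * exp (- (real n / 2 - 1) * T)"
proof -
  have cont: "continuous_on A (defect n)" for A
    unfolding defect_def[abs_def] by (intro continuous_intros bern_continuous bern_quot_continuous)
  have "integral {0..1} (defect n) = integral {0..T} (defect n) + integral {T..1} (defect n)"
    using assms cont by (intro Henstock_Kurzweil_Integration.integral_combine[symmetric] integrable_continuous_real) auto
  moreover have "norm (integral {0..T} (defect n)) \<le> (1 + real n * T) * (T - 0)"
  proof (rule integral_bound)
    fix p assume p: "p \<in> {0..T}"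
    then have "\<bar>defect n p\<bar> \<le> 1 + real n * p" using assms by (intro defect_small) auto
    also have "\<dots> \<le> 1 + real n * T" using p by (simp add: mult_left_mono)
    finally show "norm (defect n p) \<le> 1 + real n * T" by simp
  qed (use assms cont in auto)
  moreover have "norm (integral {T..1} (defect n)) \<le> ((real n)\<^sup>2 * exp (- (real n / 2 - 1) * T)) * (1 - T)"
  proof (rule integral_bound)
    fix p assume p: "p \<in> {T..1}"
    then have "\<bar>defect n p\<bar> \<le> real n * bern_quot (K_edges n) (kap n) p"
      using assms by (intro defect_large) auto
    also have "\<dots> \<le> real n * (real n * exp (- (real n / 2 - 1) * p))"
      using p assms by (intro mult_left_mono bern_quot_kap_decay) auto
    also have "\<dots> \<le> real n * (real n * exp (- (real n / 2 - 1) * T))"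
    proof -
      have "- (real n / 2 - 1) * p \<le> - (real n / 2 - 1) * T" using p assms by (intro mult_left_mono_neg) auto
      then have "exp (- (real n / 2 - 1) * p) \<le> exp (- (real n / 2 - 1) * T)" by (simp only: exp_le_cancel_iff)
      then show ?thesis by (intro mult_left_mono) auto
    qed
    finally show "norm (defect n p) \<le> (real n)\<^sup>2 * exp (- (real n / 2 - 1) * T)"
      by (simp add: power2_eq_square)
  qed (use assms cont in auto)
  moreover have "((real n)\<^sup>2 * exp (- (real n / 2 - 1) * T)) * (1 - T) \<le> (real n)\<^sup>2 * exp (- (real n / 2 - 1) * T)"
    using assms by (intro mult_right_le_one_le) auto
  ultimately show ?thesis by (simp add: power2_eq_square algebra_simps)
qed

section \<open>Minimum spanning trees under independent weights\<close>

text \<open>Combinatorial data of the weights are encoded as a random subset of a finite index set.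
  With the discrete sigma-algebra as target, any function of such a subset is measurable by
  composition.\<close>

lemma measurable_finite_Collect:
  assumes "finite I" "\<And>i. i \<in> I \<Longrightarrow> Measurable.pred M (P i)"
  shows "(\<lambda>x. {i \<in> I. P i x}) \<in> measurable M (count_space UNIV)"
proof -
  have "(\<lambda>x. {i \<in> I. P i x}) \<in> measurable M (count_space (Pow I))"
  proof (subst measurable_count_space_eq2)
    have "(\<lambda>x. {i \<in> I. P i x}) -` {a} \<inter> space M \<in> sets M" if "a \<in> Pow I" for a
    proof -
      have "(\<lambda>x. {i \<in> I. P i x}) -` {a} \<inter> space M = {x \<in> space M. \<forall>i\<in>I. P i x = (i \<in> a)}"
        using that by auto
      also have "\<dots> \<in> sets M"
        using assms by (intro sets.sets_Collect_finite_All) (auto simp: pred_def)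
      finally show ?thesis .
    qed
    then show "(\<lambda>x. {i \<in> I. P i x}) \<in> space M \<rightarrow> Pow I \<and>
      (\<forall>a\<in>Pow I. (\<lambda>x. {i \<in> I. P i x}) -` {a} \<inter> space M \<in> sets M)" by auto
  qed (use assms in auto)
  then show ?thesis by (rule measurable_compose[of _ _ _ "\<lambda>x. x"]) simp
qed

section \<open>Graphs of the edges lighter than a threshold\<close>

definition below :: "nat \<Rightarrow> real \<Rightarrow> (nat set \<Rightarrow> real) \<Rightarrow> nat set set" where
  "below n s w = {e \<in> K_edges n. w e < s}"

lemma below_subset: "below n s w \<subseteq> K_edges n"
  by (auto simp: below_def)

text \<open>Kruskal's rule looks only at lighter edges, so it commutes with cutting off the weights
  at \<open>s\<close>.\<close>

lemma kruskal_below: "kruskal w (below n s w) = {e \<in> kruskal w (K_edges n). w e < s}"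
proof -
  have *: "{g \<in> below n s w. w g < w e} = {g \<in> K_edges n. w g < w e}" if "w e < s" for e
    using that by (auto simp: below_def)
  show ?thesis
    unfolding kruskal_def using * by (auto simp: below_def)
qed

text \<open>The tree edges lighter than \<open>s\<close> form a spanning forest of
  \<open>below n s w\<close>, which therefore has \<open>n - 1 - kap\<close> edges; the tree has
  \<open>n - 1\<close>.\<close>

lemma kap_below:
  assumes "n \<ge> 1" "inj_on w (K_edges n)"
  shows "kap n (below n s w) = real (card {e \<in> mst n w. s \<le> w e})"
proof -
  let ?T = "kruskal w (K_edges n)"
  have TK: "?T \<subseteq> K_edges n" by (rule kruskal_subset)
  have fin: "finite ?T" by (rule finite_edges[OF TK])
  have inj: "inj_on w (below n s w)" by (rule inj_on_subset[OF assms(2) below_subset])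
  have kr: "conn (kruskal w (below n s w)) = conn (below n s w)" "tight n (kruskal w (below n s w))"
    using kruskal_forest[OF below_subset inj] by auto
  have "kruskal w (below n s w) \<subseteq> K_edges n" by (rule subset_trans[OF kruskal_subset below_subset])
  then have "real (card {e \<in> ?T. w e < s}) = real n - 1 - kap n (below n s w)"
    using tight_card[OF _ kr(2)] kap_cong[OF kr(1)] kruskal_below[of w n s] by simp
  moreover have "card ?T = n - 1" using card_mst[OF assms(1), of w] mst_eq_kruskal[OF assms] by simp
  moreover have "card ?T = card {e \<in> ?T. w e < s} + card {e \<in> ?T. s \<le> w e}"
  proof -
    have "card ?T = card ({e \<in> ?T. w e < s} \<union> {e \<in> ?T. s \<le> w e})"
      by (rule arg_cong[of _ _ card]) auto
    also have "card ({e \<in> ?T. w e < s} \<union> {e \<in> ?T. s \<le> w e}) = card {e \<in> ?T. w e < s} + card {e \<in> ?T. s \<le> w e}"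
      using fin by (intro card_Un_disjoint) auto
    finally show ?thesis .
  qed
  ultimately show ?thesis using assms(1) mst_eq_kruskal[OF assms] by simp
qed

text \<open>Layer cake: a tree edge \<open>e\<close> is counted by \<open>kap_below\<close> exactly
  for the \<open>s\<close> in \<open>{0..w e}\<close>, an interval of length
  \<open>w e\<close>.\<close>

lemma nn_integral_kap_below:
  assumes "n \<ge> 1" "inj_on w (K_edges n)" "\<And>e. e \<in> K_edges n \<Longrightarrow> 0 \<le> w e"
  shows "(\<integral>\<^sup>+s. ennreal (kap n (below n s w)) * indicator {0..} s \<partial>lborel) = ennreal (mst_weight n w)"
proof -
  let ?T = "mst n w"
  have TK: "?T \<subseteq> K_edges n" by (rule mst_subset[OF assms(1)])
  have fin: "finite ?T" by (rule finite_edges[OF TK])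
  have "ennreal (kap n (below n s w)) * indicator {0..} s = (\<Sum>e\<in>?T. indicator {0..w e} s)" for s
  proof -
    have "real (card {e \<in> ?T. s \<le> w e}) = (\<Sum>e\<in>?T. if s \<le> w e then 1 else 0)"
      using sum.inter_filter[OF fin, of "\<lambda>_. 1 :: real" "\<lambda>e. s \<le> w e"] by simp
    then have "ennreal (kap n (below n s w)) = ennreal (\<Sum>e\<in>?T. if s \<le> w e then 1 else 0)"
      using kap_below[OF assms(1,2)] by simp
    also have "\<dots> = (\<Sum>e\<in>?T. ennreal (if s \<le> w e then 1 else 0))" by (rule sum_ennreal[symmetric]) auto
    finally have "ennreal (kap n (below n s w)) * indicator {0..} s =
      (\<Sum>e\<in>?T. ennreal (if s \<le> w e then 1 else 0) * indicator {0..} s)"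
      by (simp only: sum_distrib_right)
    also have "\<dots> = (\<Sum>e\<in>?T. indicator {0..w e} s)"
      by (intro sum.cong refl) (auto simp: indicator_def)
    finally show ?thesis .
  qed
  then have "(\<integral>\<^sup>+s. ennreal (kap n (below n s w)) * indicator {0..} s \<partial>lborel) =
    (\<integral>\<^sup>+s. (\<Sum>e\<in>?T. indicator {0..w e} s) \<partial>lborel)" by simp
  also have "\<dots> = (\<Sum>e\<in>?T. \<integral>\<^sup>+s. indicator {0..w e} s \<partial>lborel)"
    by (rule nn_integral_sum) simp
  also have "\<dots> = (\<Sum>e\<in>?T. ennreal (w e))"
    using TK assms(3) by (intro sum.cong) auto
  also have "\<dots> = ennreal (mst_weight n w)"
    using TK assms(3) by (auto simp: mst_weight_def tree_weight_def intro!: sum_ennreal)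
  finally show ?thesis .
qed

text \<open>What the two weight laws have in common: absence of atoms makes the weights almost
  surely distinct, and nonnegativity lets the layer cake integral start at \<open>0\<close>.\<close>

locale weight_dist = prob_space \<mu> for \<mu> :: "real measure" +
  assumes sets_mu [measurable_cong, simp]: "sets \<mu> = sets borel"
    and atomless: "emeasure \<mu> {x} = 0"
    and mu_nonneg: "AE x in \<mu>. 0 \<le> x"
begin

abbreviation W :: "nat \<Rightarrow> (nat set \<Rightarrow> real) measure" where
  "W n \<equiv> PiM (K_edges n) (\<lambda>_. \<mu>)"

lemma space_mu [simp]: "space \<mu> = UNIV"
  using sets_eq_imp_space_eq[OF sets_mu] by simp

lemma product_mu: "product_sigma_finite (\<lambda>_ :: nat set. \<mu>)"
  by standard

lemma prob_space_W: "prob_space (W n)"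
  by (intro prob_space_PiM prob_space_axioms)

lemma measurable_weight [measurable]: "e \<in> K_edges n \<Longrightarrow> (\<lambda>w. w e) \<in> borel_measurable (W n)"
  using measurable_component_singleton[of e "K_edges n" "\<lambda>_. \<mu>"] measurable_cong_sets[OF refl sets_mu] by blast

text \<open>Integrating out \<open>w e\<close> first, with \<open>w f\<close> fixed, leaves the
  measure of the single point \<open>w f\<close>.\<close>

lemma AE_distinct:
  assumes "e \<in> K_edges n" "f \<in> K_edges n" "e \<noteq> f"
  shows "AE w in W n. w e \<noteq> w f"
proof -
  interpret product_sigma_finite "\<lambda>_ :: nat set. \<mu>" by (rule product_mu)
  let ?I = "K_edges n - {e}"
  have ins: "insert e ?I = K_edges n" using assms by auto
  have meas: "(\<lambda>w. indicator {0 :: real} (w e - w f) :: ennreal) \<in> borel_measurable (W n)"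
    using assms by measurable
  have "(\<integral>\<^sup>+w. indicator {0 :: real} (w e - w f) \<partial>W n) =
    (\<integral>\<^sup>+w. (\<integral>\<^sup>+y. indicator {0 :: real} ((w(e := y)) e - (w(e := y)) f) \<partial>\<mu>) \<partial>PiM ?I (\<lambda>_. \<mu>))"
    using product_nn_integral_insert[of ?I e "\<lambda>w. indicator {0 :: real} (w e - w f)"] meas ins by simp
  also have "\<dots> = (\<integral>\<^sup>+w. (\<integral>\<^sup>+y. indicator {w f} y \<partial>\<mu>) \<partial>PiM ?I (\<lambda>_. \<mu>))"
    using assms(3) by (intro nn_integral_cong) (auto simp: indicator_def)
  also have "\<dots> = 0" by (simp add: atomless)
  finally have "AE w in W n. indicator {0 :: real} (w e - w f) = (0 :: ennreal)"
    using nn_integral_0_iff_AE[OF meas] by simp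
  then show ?thesis by eventually_elim (auto simp: indicator_def split: if_splits)
qed

lemma AE_inj: "AE w in W n. inj_on w (K_edges n)"
proof -
  have "AE w in W n. \<forall>e\<in>K_edges n. \<forall>f\<in>K_edges n. e \<noteq> f \<longrightarrow> w e \<noteq> w f"
    using AE_distinct by (intro AE_finite_allI finite_K_edges) auto
  then show ?thesis by eventually_elim (auto simp: inj_on_def)
qed

lemma AE_nonneg: "AE w in W n. \<forall>e\<in>K_edges n. 0 \<le> w e"
  by (intro AE_finite_allI finite_K_edges AE_PiM_component prob_space_axioms mu_nonneg) auto

lemma measurable_below: "(\<lambda>(s, w). below n s w) \<in> measurable (borel \<Otimes>\<^sub>M W n) (count_space UNIV)"
proof -
  have "(\<lambda>x. {e \<in> K_edges n. snd x e < fst x}) \<in> measurable (borel \<Otimes>\<^sub>M W n) (count_space UNIV)"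
    by (rule measurable_finite_Collect) auto
  then show ?thesis by (simp add: below_def split_def)
qed

lemma measurable_tree_weight: "T \<subseteq> K_edges n \<Longrightarrow> (\<lambda>w. tree_weight w T) \<in> borel_measurable (W n)"
  unfolding tree_weight_def by (intro borel_measurable_sum measurable_weight) auto

lemma measurable_is_mst: "Measurable.pred (W n) (\<lambda>w. is_mst n w T)"
proof (cases "spanning_tree n T")
  case True
  have sub: "T' \<subseteq> K_edges n" if "spanning_tree n T'" for T' using that by (simp add: spanning_tree_def)
  have "Measurable.pred (W n) (\<lambda>w. \<forall>T'\<in>{T'. spanning_tree n T'}. tree_weight w T \<le> tree_weight w T')"
  proof (rule pred_intros_finite(3)[OF finite_spanning_trees])
    fix T' assume "T' \<in> {T'. spanning_tree n T'}"
    then show "Measurable.pred (W n) (\<lambda>w. tree_weight w T \<le> tree_weight w T')"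
      using sub True unfolding pred_def by (intro borel_measurable_le measurable_tree_weight) auto
  qed
  then show ?thesis using True by (simp add: is_mst_def)
qed (simp add: is_mst_def)

text \<open>The set of all minimum spanning trees is a random subset of a finite set, and
  \<open>mst\<close> is a function of it alone.\<close>

lemma measurable_mst: "mst n \<in> measurable (W n) (count_space UNIV)"
proof -
  have "(\<lambda>w. {T \<in> Pow (K_edges n). is_mst n w T}) \<in> measurable (W n) (count_space UNIV)"
    by (rule measurable_finite_Collect) (auto intro: measurable_is_mst)
  then have "(\<lambda>w. SOME T. T \<in> {T \<in> Pow (K_edges n). is_mst n w T}) \<in> measurable (W n) (count_space UNIV)"
    by (rule measurable_compose) simp
  moreover have "(\<lambda>w. SOME T. T \<in> {T \<in> Pow (K_edges n). is_mst n w T}) = mst n"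
    by (auto simp: mst_def is_mst_def spanning_tree_def fun_eq_iff intro!: arg_cong[of _ _ Eps])
  ultimately show ?thesis by simp
qed

lemma measurable_mst_weight: "n \<ge> 1 \<Longrightarrow> mst_weight n \<in> borel_measurable (W n)"
proof -
  assume n: "n \<ge> 1"
  have "(\<lambda>w. \<Sum>e\<in>K_edges n. indicator {T. e \<in> T} (mst n w) * w e) \<in> borel_measurable (W n)"
    by (intro borel_measurable_sum borel_measurable_times measurable_weight measurable_compose[OF measurable_mst]) auto
  moreover have "mst_weight n w = (\<Sum>e\<in>K_edges n. indicator {T. e \<in> T} (mst n w) * w e)" for w
    unfolding mst_weight_def tree_weight_def using mst_subset[OF n, of w]
    by (intro sum.mono_neutral_cong_left) (auto simp: indicator_def)
  ultimately show ?thesis by (simp add: measurable_cong[of "W n" "mst_weight n"])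
qed

definition cdf_lt :: "real \<Rightarrow> real" where
  "cdf_lt s = measure \<mu> {..<s}"

lemma cdf_lt_bounds: "0 \<le> cdf_lt s" "cdf_lt s \<le> 1"
  by (simp_all add: cdf_lt_def)

lemma emeasure_below:
  assumes "S \<subseteq> K_edges n"
  shows "emeasure (W n) {w \<in> space (W n). below n s w = S} =
    ennreal (cdf_lt s ^ card S * (1 - cdf_lt s) ^ (card (K_edges n) - card S))"
proof -
  interpret product_sigma_finite "\<lambda>_ :: nat set. \<mu>" by (rule product_mu)
  let ?A = "\<lambda>e. if e \<in> S then {..<s} else {s..}"
  have fin: "finite S" by (rule finite_edges[OF assms])
  have "{w \<in> space (W n). below n s w = S} = PiE (K_edges n) ?A"
  proof (intro set_eqI iffI)
    fix w assume "w \<in> {w \<in> space (W n). below n s w = S}"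
    then have w: "w \<in> space (W n)" and eq: "\<And>e. e \<in> K_edges n \<Longrightarrow> w e < s \<longleftrightarrow> e \<in> S"
      by (auto simp: below_def)
    then show "w \<in> PiE (K_edges n) ?A"
      by (auto simp: space_PiM PiE_iff not_less simp flip: eq)
  next
    fix w assume w: "w \<in> PiE (K_edges n) ?A"
    then have "w e < s \<longleftrightarrow> e \<in> S" if "e \<in> K_edges n" for e
      using PiE_mem[OF w that] by (auto split: if_splits)
    then show "w \<in> {w \<in> space (W n). below n s w = S}"
      using w assms by (auto simp: space_PiM PiE_iff below_def)
  qed
  then have "emeasure (W n) {w \<in> space (W n). below n s w = S} = (\<Prod>e\<in>K_edges n. emeasure \<mu> (?A e))"
    by (simp add: emeasure_PiM)
  also have "\<dots> = (\<Prod>e\<in>K_edges n. ennreal (if e \<in> S then cdf_lt s else 1 - cdf_lt s))"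
  proof (rule prod.cong)
    fix e
    have "{s..} = space \<mu> - {..<s}" by auto
    then have "measure \<mu> {s..} = 1 - cdf_lt s"
      using prob_compl[of "{..<s}"] by (simp add: cdf_lt_def)
    then show "emeasure \<mu> (?A e) = ennreal (if e \<in> S then cdf_lt s else 1 - cdf_lt s)"
      by (simp add: emeasure_eq_measure cdf_lt_def)
  qed simp
  also have "\<dots> = ennreal (\<Prod>e\<in>K_edges n. if e \<in> S then cdf_lt s else 1 - cdf_lt s)"
    using cdf_lt_bounds by (intro prod_ennreal) auto
  also have "(\<Prod>e\<in>K_edges n. if e \<in> S then cdf_lt s else 1 - cdf_lt s) =
    (\<Prod>e\<in>S. cdf_lt s) * (\<Prod>e\<in>K_edges n - S. 1 - cdf_lt s)"
    using assms by (subst prod.subset_diff[OF assms]) (auto intro!: prod.cong simp: mult.commute)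
  finally show ?thesis using assms fin by (simp add: card_Diff_subset)
qed

text \<open>The edges lighter than \<open>s\<close> form a random graph in which each edge is
  present independently with probability \<open>cdf_lt s\<close>.\<close>

lemma nn_integral_below:
  assumes "\<And>S. S \<subseteq> K_edges n \<Longrightarrow> 0 \<le> g S"
  shows "(\<integral>\<^sup>+w. ennreal (g (below n s w)) \<partial>W n) = ennreal (bern (K_edges n) g (cdf_lt s))"
proof -
  let ?B = "\<lambda>S. {w \<in> space (W n). below n s w = S}"
  have meas: "?B S \<in> sets (W n)" for S
  proof -
    have "(\<lambda>w. below n s w) \<in> measurable (W n) (count_space UNIV)"
      unfolding below_def by (rule measurable_finite_Collect) auto
    then show ?thesis by simp
  qed
  have "(\<integral>\<^sup>+w. ennreal (g (below n s w)) \<partial>W n) = (\<integral>\<^sup>+w. (\<Sum>S\<in>Pow (K_edges n). ennreal (g S) * indicator (?B S) w) \<partial>W n)"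
  proof (rule nn_integral_cong)
    fix w assume w: "w \<in> space (W n)"
    have "(\<Sum>S\<in>Pow (K_edges n). ennreal (g S) * indicator (?B S) w) = (\<Sum>S\<in>{below n s w}. ennreal (g S) * indicator (?B S) w)"
      by (rule sum.mono_neutral_right) (auto simp: below_subset indicator_def)
    then show "ennreal (g (below n s w)) = (\<Sum>S\<in>Pow (K_edges n). ennreal (g S) * indicator (?B S) w)"
      using w by simp
  qed
  also have "\<dots> = (\<Sum>S\<in>Pow (K_edges n). \<integral>\<^sup>+w. ennreal (g S) * indicator (?B S) w \<partial>W n)"
    using meas by (intro nn_integral_sum) auto
  also have "\<dots> = (\<Sum>S\<in>Pow (K_edges n). ennreal (g S * (cdf_lt s ^ card S * (1 - cdf_lt s) ^ (card (K_edges n) - card S))))"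
  proof (rule sum.cong)
    fix S assume S: "S \<in> Pow (K_edges n)"
    then show "(\<integral>\<^sup>+w. ennreal (g S) * indicator (?B S) w \<partial>W n) =
        ennreal (g S * (cdf_lt s ^ card S * (1 - cdf_lt s) ^ (card (K_edges n) - card S)))"
      using meas[of S] emeasure_below[of S n s] assms[of S] cdf_lt_bounds[of s]
      by (simp add: nn_integral_cmult_indicator ennreal_mult)
  qed simp
  also have "\<dots> = ennreal (bern (K_edges n) g (cdf_lt s))"
    unfolding bern_def using assms cdf_lt_bounds[of s] by (intro sum_ennreal mult_nonneg_nonneg) auto
  finally show ?thesis .
qed

lemma nn_integral_mst_weight:
  assumes "n \<ge> 1"
  shows "(\<integral>\<^sup>+w. ennreal (mst_weight n w) \<partial>W n) =
    (\<integral>\<^sup>+s. ennreal (bern (K_edges n) (kap n) (cdf_lt s)) * indicator {0..} s \<partial>lborel)"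
proof -
  interpret W: prob_space "W n" by (rule prob_space_W)
  interpret pair_sigma_finite lborel "W n" by standard
  have meas: "(\<lambda>(s, w). ennreal (kap n (below n s w)) * indicator {0..} s) \<in> borel_measurable (lborel \<Otimes>\<^sub>M W n)"
  proof -
    have "(\<lambda>x. ennreal (kap n (case x of (s, w) \<Rightarrow> below n s w))) \<in> borel_measurable (borel \<Otimes>\<^sub>M W n)"
      by (rule measurable_compose[OF measurable_below]) simp
    then show ?thesis by (simp add: split_def) measurable
  qed
  have "(\<integral>\<^sup>+w. ennreal (mst_weight n w) \<partial>W n) =
    (\<integral>\<^sup>+w. (\<integral>\<^sup>+s. ennreal (kap n (below n s w)) * indicator {0..} s \<partial>lborel) \<partial>W n)"
    using AE_inj[of n] AE_nonneg[of n]
    by (intro nn_integral_cong_AE, eventually_elim) (simp add: nn_integral_kap_below[OF assms])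
  also have "\<dots> = (\<integral>\<^sup>+s. (\<integral>\<^sup>+w. ennreal (kap n (below n s w)) * indicator {0..} s \<partial>W n) \<partial>lborel)"
    using Fubini'[OF meas] by simp
  also have "\<dots> = (\<integral>\<^sup>+s. ennreal (bern (K_edges n) (kap n) (cdf_lt s)) * indicator {0..} s \<partial>lborel)"
  proof (rule nn_integral_cong)
    fix s :: real
    have "(\<lambda>w. ennreal (kap n (below n s w))) \<in> borel_measurable (W n)"
    proof -
      have "(\<lambda>w. below n s w) \<in> measurable (W n) (count_space UNIV)"
        unfolding below_def by (rule measurable_finite_Collect) auto
      then show ?thesis by (rule measurable_compose) simp
    qed
    then have "(\<integral>\<^sup>+w. ennreal (kap n (below n s w)) * indicator {0..} s \<partial>W n) =
       (\<integral>\<^sup>+w. ennreal (kap n (below n s w)) \<partial>W n) * indicator {0..} s"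
      by (rule nn_integral_multc)
    then show "(\<integral>\<^sup>+w. ennreal (kap n (below n s w)) * indicator {0..} s \<partial>W n) =
       ennreal (bern (K_edges n) (kap n) (cdf_lt s)) * indicator {0..} s"
      using nn_integral_below[of n "kap n" s] kap_nonneg assms by simp
  qed
  finally show ?thesis .
qed

lemma integral_mst_weight:
  assumes "n \<ge> 1"
    and "(\<integral>\<^sup>+s. ennreal (bern (K_edges n) (kap n) (cdf_lt s)) * indicator {0..} s \<partial>lborel) = ennreal I" "0 \<le> I"
  shows "(\<integral>w. mst_weight n w \<partial>W n) = I"
proof -
  have "AE w in W n. 0 \<le> mst_weight n w"
    using AE_nonneg[of n]
  proof eventually_elim
    case (elim w)
    then show ?case unfolding mst_weight_def tree_weight_def
      using mst_subset[OF assms(1), of w] by (intro sum_nonneg) auto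
  qed
  then have "(\<integral>w. mst_weight n w \<partial>W n) = enn2real (\<integral>\<^sup>+w. ennreal (mst_weight n w) \<partial>W n)"
    by (intro integral_eq_nn_integral measurable_mst_weight assms(1))
  then show ?thesis using nn_integral_mst_weight[OF assms(1)] assms(2,3) by simp
qed

end

section \<open>The uniform and the exponential law\<close>

interpretation unif: weight_dist "uniform_measure lborel {0..1}"
proof -
  interpret prob_space "uniform_measure lborel {0..1 :: real}"
    by (rule prob_space_uniform_measure) auto
  show "weight_dist (uniform_measure lborel {0..1})"
  proof
    have "emeasure lborel ({0..1} \<inter> {x}) \<le> emeasure lborel {x}" for x :: real
      by (rule emeasure_mono) auto
    then show "emeasure (uniform_measure lborel {0..1}) {x} = 0" for x :: real by simp
  qed (auto intro: AE_uniform_measureI)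
qed

interpretation exp: weight_dist "density lborel (\<lambda>t. ennreal (exponential_density 1 t))"
proof -
  interpret prob_space "density lborel (\<lambda>t. ennreal (exponential_density 1 t))"
    by (rule prob_space_exponential_density) simp
  show "weight_dist (density lborel (\<lambda>t. ennreal (exponential_density 1 t)))"
  proof
    show "emeasure (density lborel (\<lambda>t. ennreal (exponential_density 1 t))) {x} = 0" for x :: real
    proof -
      have "{x} \<in> null_sets lborel" by (simp add: null_sets_def)
      then show ?thesis by (simp add: emeasure_density nn_integral_null_set)
    qed
    show "AE x in density lborel (\<lambda>t. ennreal (exponential_density 1 t)). 0 \<le> x"
      by (subst AE_density) (auto simp: exponential_density_def)
  qed simp
qed

lemma unif_cdf_lt:
  assumes "0 \<le> s"
  shows "unif.cdf_lt s = min s 1"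
proof -
  have "{0..1} \<inter> {..<s} = (if s \<le> 1 then {0..<s} else {0..1})" using assms by auto
  then show ?thesis using assms by (simp add: unif.cdf_lt_def)
qed

lemma exp_cdf_lt:
  assumes "0 \<le> s"
  shows "exp.cdf_lt s = 1 - exp (- s)"
proof -
  let ?M = "density lborel (\<lambda>t. ennreal (exponential_density 1 t))"
  have "emeasure ?M {..s} = ennreal (1 - exp (- s))"
    using assms by (subst emeasure_erlang_density) (auto simp: erlang_CDF_def)
  then have "measure ?M {..s} = 1 - exp (- s)"
    using assms by (simp add: measure_def)
  moreover have "measure ?M ({..<s} \<union> {s}) = measure ?M {..<s} + measure ?M {s}"
    by (rule exp.finite_measure_Union) auto
  moreover have "measure ?M {s} = 0" using exp.atomless[of s] by (simp add: measure_def)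
  moreover have "{..<s} \<union> {s} = {..s}" by auto
  ultimately show ?thesis by (simp add: exp.cdf_lt_def)
qed

lemma bern_kap_nonneg:
  assumes "n \<ge> 1" "0 \<le> p" "p \<le> 1"
  shows "0 \<le> bern (K_edges n) (kap n) p"
  using bern_mono[of p "K_edges n" "\<lambda>_. 0" "kap n"] assms kap_nonneg[of _ n] by (simp add: bern_const)

lemma E_L_unif_eq:
  assumes "n \<ge> 1"
  shows "E_L_unif n = integral {0..1} (bern (K_edges n) (kap n))"
proof -
  let ?h = "bern (K_edges n) (kap n)"
  have int: "?h integrable_on {0..1}" by (intro integrable_continuous_real bern_continuous)
  have nn: "0 \<le> ?h p" if "p \<in> {0..1}" for p using bern_kap_nonneg assms that by auto
  have "(\<integral>\<^sup>+s. ennreal (?h (unif.cdf_lt s)) * indicator {0..} s \<partial>lborel) =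
    (\<integral>\<^sup>+s. ennreal (indicator {0..1} s * ?h s) \<partial>lborel)"
  proof (rule nn_integral_cong)
    fix s :: real
    \<comment> \<open>For \<open>s > 1\<close> all edges are present and the graph is connected, so
      the integrand vanishes beyond \<open>1\<close>.\<close>
    have "?h 1 = 0" using bern_one[of "K_edges n" "kap n"] kap_K_edges[OF assms] by simp
    then show "ennreal (?h (unif.cdf_lt s)) * indicator {0..} s = ennreal (indicator {0..1} s * ?h s)"
      by (cases "0 \<le> s") (auto simp: unif_cdf_lt min_def indicator_def)
  qed
  also have "\<dots> = ennreal (integral {0..1} ?h)"
    using nn_integral_has_integral_lebesgue[OF nn integrable_integral[OF int]] by simp
  finally show ?thesis
    unfolding E_L_unif_def unif_weights_def
    using nn int by (intro unif.integral_mst_weight assms integral_nonneg) auto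
qed

text \<open>The substitution \<open>p = 1 - exp (- s)\<close> has \<open>dp = (1 - p) ds\<close> and
  so divides \<open>bern\<close> by \<open>1 - p\<close>. It is carried out through an
  antiderivative \<open>G\<close> of the quotient, evaluated along
  \<open>1 - exp (- s)\<close>.\<close>

lemma nn_integral_exp_cdf:
  assumes "n \<ge> 1"
  shows "(\<integral>\<^sup>+s. ennreal (bern (K_edges n) (kap n) (exp.cdf_lt s)) * indicator {0..} s \<partial>lborel) =
    ennreal (integral {0..1} (bern_quot (K_edges n) (kap n)))"
proof -
  let ?h = "bern (K_edges n) (kap n)" and ?g = "bern_quot (K_edges n) (kap n)"
  have hg: "(1 - p) * ?g p = ?h p" for p
    using bern_quot_mult[of "K_edges n" "kap n" p] kap_K_edges[OF assms] by simp
  \<comment> \<open>Integrating from \<open>-1\<close> and working up to \<open>2\<close> makes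
    \<open>0\<close> and \<open>1\<close> interior points: the derivative is two-sided at
    \<open>s = 0\<close>, and \<open>G\<close> is continuous at the limit point
    \<open>1\<close>.\<close>
  define G where "G p = integral {-1..p} ?g" for p
  have G: "(G has_real_derivative ?g p) (at p)" if "-1 < p" "p < 2" for p
  proof -
    have "(G has_real_derivative ?g p) (at p within {-1..2})"
      unfolding G_def[abs_def] using that by (intro integral_has_real_derivative bern_quot_continuous) auto
    moreover have "at p within {-1..2} = at p"
      using that by (intro at_within_interior) (auto simp: interior_atLeastAtMost_real)
    ultimately show ?thesis by simp
  qed
  have "(?g has_integral (G 1 - G 0)) {0..1}"
    by (rule fundamental_theorem_of_calculus)
      (auto intro!: has_field_derivative_at_within[OF G] simp flip: has_real_derivative_iff_has_vector_derivative)
  then have I: "integral {0..1} ?g = G 1 - G 0" by (rule integral_unique)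
  have lim: "((\<lambda>t. G (1 - exp (- t))) \<longlongrightarrow> G 1) at_top"
  proof (rule isCont_tendsto_compose[of 1 G])
    show "isCont G 1" using G[of 1] by (auto intro: DERIV_isCont)
    show "((\<lambda>t :: real. 1 - exp (- t)) \<longlongrightarrow> 1) at_top"
      using tendsto_diff[OF tendsto_const filterlim_compose[OF exp_at_bot filterlim_uminus_at_bot_at_top], of 1]
      by simp
  qed
  have "(\<integral>\<^sup>+s. ennreal (?h (exp.cdf_lt s)) * indicator {0..} s \<partial>lborel) =
    (\<integral>\<^sup>+s. ennreal (?h (1 - exp (- s))) * indicator {0..} s \<partial>lborel)"
    by (intro nn_integral_cong) (auto simp: exp_cdf_lt indicator_def)
  also have "\<dots> = ennreal (G 1 - G (1 - exp (- 0)))"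
  proof (rule nn_integral_FTC_atLeast[OF _ _ _ lim])
    have "continuous_on UNIV (\<lambda>s :: real. ?h (1 - exp (- s)))"
      by (rule continuous_on_compose2[OF bern_continuous[of UNIV]]) (auto intro!: continuous_intros)
    then show "(\<lambda>s. ?h (1 - exp (- s))) \<in> borel_measurable borel"
      by (rule borel_measurable_continuous_onI)
    fix s :: real assume s: "0 \<le> s"
    then have "exp (- s) \<le> 1" "0 < exp (- s)" by simp_all
    then have p: "0 \<le> 1 - exp (- s)" "-1 < 1 - exp (- s)" "1 - exp (- s) < 2" "1 - exp (- s) \<le> 1" by linarith+
    have "((\<lambda>t. G (1 - exp (- t))) has_real_derivative ?g (1 - exp (- s)) * exp (- s)) (at s)"
    proof (rule DERIV_cong[OF DERIV_chain'[of "\<lambda>t. 1 - exp (- t)" "exp (- s)" s UNIV G]])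
      show "((\<lambda>t. 1 - exp (- t)) has_real_derivative exp (- s)) (at s)"
        by (auto intro!: derivative_eq_intros)
      show "(G has_real_derivative ?g (1 - exp (- s))) (at (1 - exp (- s)))" by (rule G[OF p(2,3)])
    qed simp
    then show "((\<lambda>t. G (1 - exp (- t))) has_real_derivative ?h (1 - exp (- s))) (at s)"
      using hg[of "1 - exp (- s)"] by (simp add: mult.commute)
    show "0 \<le> ?h (1 - exp (- s))" using bern_kap_nonneg[OF assms] p by simp
  qed
  finally show ?thesis using I by simp
qed

lemma E_L_integral_nonneg:
  assumes "n \<ge> 1"
  shows "0 \<le> integral {0..1} (bern_quot (K_edges n) (kap n))"
  using kap_nonneg[of _ n] assms
  by (intro integral_nonneg integrable_continuous_real bern_quot_continuous bern_quot_nonneg) auto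

lemma E_L_eq:
  assumes "n \<ge> 1"
  shows "E_L n = integral {0..1} (bern_quot (K_edges n) (kap n))"
  unfolding E_L_def exp_weights_def
  using assms by (intro exp.integral_mst_weight nn_integral_exp_cdf E_L_integral_nonneg)

lemma nn_integral_E_L:
  assumes "n \<ge> 1"
  shows "(\<integral>\<^sup>+w. ennreal (mst_weight n w) \<partial>exp.W n) = ennreal (E_L n)"
  using exp.nn_integral_mst_weight[OF assms] nn_integral_exp_cdf[OF assms] E_L_eq[OF assms] by simp

lemma E_L_unif_approx:
  assumes "n \<ge> 2" "0 \<le> T" "T \<le> 1 / 2"
  shows "\<bar>real n * (E_L n - E_L_unif n) - E_L_unif n\<bar> \<le>
    T + real n * T\<^sup>2 + (real n)\<^sup>2 * exp (- (real n / 2 - 1) * T)"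
  using defect_integral_bound[OF assms] defect_integral[of n] E_L_eq[of n] E_L_unif_eq[of n] assms(1) by simp

section \<open>The second moment of the degrees\<close>

lemma exp_tail:
  assumes "0 \<le> s"
  shows "emeasure (density lborel (\<lambda>t. ennreal (exponential_density 1 t))) {s..} = ennreal (exp (- s))"
proof -
  let ?M = "density lborel (\<lambda>t. ennreal (exponential_density 1 t))"
  have "{s..} = space ?M - {..<s}" by auto
  then have "measure ?M {s..} = 1 - measure ?M {..<s}"
    using exp.prob_compl[of "{..<s}"] by simp
  then have "measure ?M {s..} = exp (- s)"
    using exp_cdf_lt[OF assms] by (simp add: exp.cdf_lt_def)
  then show ?thesis by (simp add: exp.emeasure_eq_measure)
qed

text \<open>Integrating out the single exponential weight \<open>w f\<close>: its density at \<open>s\<close> is the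
  probability that \<open>w f \<ge> s\<close>.\<close>

lemma nn_integral_exp_coordinate:
  fixes H :: "real \<Rightarrow> (nat set \<Rightarrow> real) \<Rightarrow> ennreal"
  assumes f: "f \<in> K_edges n"
    and H: "(\<lambda>(s, w). H s w) \<in> borel_measurable (borel \<Otimes>\<^sub>M exp.W n)"
    and inv: "\<And>s w y. H s (w(f := y)) = H s w"
  shows "(\<integral>\<^sup>+w. H (w f) w \<partial>exp.W n) =
    (\<integral>\<^sup>+w. (\<integral>\<^sup>+s. (if 0 \<le> s \<and> s \<le> w f then H s w else 0) \<partial>lborel) \<partial>exp.W n)"
proof -
  let ?M = "density lborel (\<lambda>t. ennreal (exponential_density 1 t))"
  let ?I = "K_edges n - {f}"
  let ?P = "PiM ?I (\<lambda>_. ?M)"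
  interpret product_sigma_finite "\<lambda>_ :: nat set. ?M" by (rule exp.product_mu)
  have ins: "insert f ?I = K_edges n" using f by auto
  interpret P: prob_space ?P by (intro prob_space_PiM exp.prob_space_axioms)
  interpret W: prob_space "exp.W n" by (rule exp.prob_space_W)
  \<comment> \<open>By \<open>inv\<close> the coordinate \<open>f\<close> has no influence; fixing
    it as \<open>0\<close> gives a function on the product over the other edges.\<close>
  define H0 where "H0 s w = H s (w(f := 0))" for s w
  have upd: "(\<lambda>x. (snd x)(f := 0)) \<in> measurable (borel \<Otimes>\<^sub>M ?P) (exp.W n)"
    by (rule measurable_fun_upd[where J = ?I]) (use f in auto)
  have "(\<lambda>x. (fst x, (snd x)(f := 0))) \<in> measurable (borel \<Otimes>\<^sub>M ?P) (borel \<Otimes>\<^sub>M exp.W n)"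
    using upd by (intro measurable_Pair measurable_fst) auto
  from measurable_compose[OF this H]
  have H0: "(\<lambda>(s, w). H0 s w) \<in> borel_measurable (borel \<Otimes>\<^sub>M ?P)"
    by (simp add: H0_def split_def)
  define \<phi> where "\<phi> s = (\<integral>\<^sup>+w. H0 s w \<partial>?P)" for s
  have \<phi>[measurable]: "\<phi> \<in> borel_measurable borel"
    unfolding \<phi>_def[abs_def] by (rule P.borel_measurable_nn_integral[OF H0])
  have HH: "H s (w(f := y)) = H0 s w" for s w y by (simp add: H0_def inv)
  have wf[measurable]: "(\<lambda>w. w f) \<in> borel_measurable (exp.W n)" using exp.measurable_weight[OF f] .
  have m1: "(\<lambda>w. H (w f) w) \<in> borel_measurable (exp.W n)"
  proof -
    have "(\<lambda>w. (w f, w)) \<in> measurable (exp.W n) (borel \<Otimes>\<^sub>M exp.W n)" by measurable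
    from measurable_compose[OF this H] show ?thesis by simp
  qed
  have m2: "(\<lambda>w. \<integral>\<^sup>+s. (if 0 \<le> s \<and> s \<le> w f then H s w else 0) \<partial>lborel) \<in> borel_measurable (exp.W n)"
  proof (rule lborel.borel_measurable_nn_integral)
    have sw: "(\<lambda>x. (snd x, fst x)) \<in> measurable (exp.W n \<Otimes>\<^sub>M borel) (borel \<Otimes>\<^sub>M exp.W n)" by measurable
    have [measurable]: "(\<lambda>x. H (snd x) (fst x)) \<in> borel_measurable (exp.W n \<Otimes>\<^sub>M borel)"
      using measurable_compose[OF sw H] by simp
    have [measurable]: "(\<lambda>x. fst x f) \<in> borel_measurable (exp.W n \<Otimes>\<^sub>M borel)"
      by (rule measurable_compose[OF measurable_fst wf])
    have "(\<lambda>x. if 0 \<le> snd x \<and> snd x \<le> fst x f then H (snd x) (fst x) else 0) \<in> borel_measurable (exp.W n \<Otimes>\<^sub>M borel)"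
      by measurable
    then show "(\<lambda>(w, s). if 0 \<le> s \<and> s \<le> w f then H s w else 0) \<in> borel_measurable (exp.W n \<Otimes>\<^sub>M lborel)"
      by (simp add: split_def cong: measurable_cong_sets)
  qed
  have "(\<integral>\<^sup>+w. H (w f) w \<partial>exp.W n) = (\<integral>\<^sup>+y. (\<integral>\<^sup>+w. H y (w(f := y)) \<partial>?P) \<partial>?M)"
    using product_nn_integral_insert_rev[of ?I f "\<lambda>w. H (w f) w"] m1 ins by simp
  also have "\<dots> = (\<integral>\<^sup>+y. \<phi> y \<partial>?M)" by (simp add: HH \<phi>_def)
  also have "\<dots> = (\<integral>\<^sup>+s. ennreal (exponential_density 1 s) * \<phi> s \<partial>lborel)"
    by (rule nn_integral_density) auto
  also have "\<dots> = (\<integral>\<^sup>+s. (\<integral>\<^sup>+y. (if 0 \<le> s \<and> s \<le> y then \<phi> s else 0) \<partial>?M) \<partial>lborel)"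
  proof (rule nn_integral_cong)
    fix s :: real
    have "(\<integral>\<^sup>+y. (if 0 \<le> s \<and> s \<le> y then \<phi> s else 0) \<partial>?M) =
       (\<integral>\<^sup>+y. (if 0 \<le> s then \<phi> s else 0) * indicator {s..} y \<partial>?M)"
      by (intro nn_integral_cong) (auto simp: indicator_def)
    also have "\<dots> = (if 0 \<le> s then \<phi> s else 0) * emeasure ?M {s..}"
      by (rule nn_integral_cmult_indicator) simp
    finally show "ennreal (exponential_density 1 s) * \<phi> s = (\<integral>\<^sup>+y. (if 0 \<le> s \<and> s \<le> y then \<phi> s else 0) \<partial>?M)"
      using exp_tail[of s] by (auto simp: exponential_density_def mult.commute)
  qed
  also have "\<dots> = (\<integral>\<^sup>+y. (\<integral>\<^sup>+s. (if 0 \<le> s \<and> s \<le> y then \<phi> s else 0) \<partial>lborel) \<partial>?M)"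
  proof -
    interpret pair_sigma_finite lborel ?M by standard
    have "(\<lambda>x. if 0 \<le> fst x \<and> fst x \<le> snd x then \<phi> (fst x) else 0) \<in> borel_measurable (lborel \<Otimes>\<^sub>M ?M)"
      by measurable
    then have "(\<lambda>(s, y). if 0 \<le> s \<and> s \<le> y then \<phi> s else 0) \<in> borel_measurable (lborel \<Otimes>\<^sub>M ?M)"
      by (simp add: split_def)
    then show ?thesis by (rule Fubini'[symmetric])
  qed
  also have "\<dots> = (\<integral>\<^sup>+y. (\<integral>\<^sup>+w. (\<integral>\<^sup>+s. (if 0 \<le> s \<and> s \<le> y then H s (w(f := y)) else 0) \<partial>lborel) \<partial>?P) \<partial>?M)"
  proof (rule nn_integral_cong)
    fix y :: real
    interpret pair_sigma_finite lborel ?P by standard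
    have [measurable]: "(\<lambda>x. H0 (fst x) (snd x)) \<in> borel_measurable (lborel \<Otimes>\<^sub>M ?P)"
      using H0 by (simp add: split_def cong: measurable_cong_sets)
    have "(\<lambda>x. if 0 \<le> fst x \<and> fst x \<le> y then H0 (fst x) (snd x) else 0) \<in> borel_measurable (lborel \<Otimes>\<^sub>M ?P)"
      by measurable
    then have "(\<lambda>(s, w). if 0 \<le> s \<and> s \<le> y then H0 s w else 0) \<in> borel_measurable (lborel \<Otimes>\<^sub>M ?P)"
      by (simp add: split_def)
    then have "(\<integral>\<^sup>+w. (\<integral>\<^sup>+s. (if 0 \<le> s \<and> s \<le> y then H0 s w else 0) \<partial>lborel) \<partial>?P) =
      (\<integral>\<^sup>+s. (\<integral>\<^sup>+w. (if 0 \<le> s \<and> s \<le> y then H0 s w else 0) \<partial>?P) \<partial>lborel)"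
      by (rule Fubini')
    also have "\<dots> = (\<integral>\<^sup>+s. (if 0 \<le> s \<and> s \<le> y then \<phi> s else 0) \<partial>lborel)"
    proof (rule nn_integral_cong)
      fix s :: real
      show "(\<integral>\<^sup>+w. (if 0 \<le> s \<and> s \<le> y then H0 s w else 0) \<partial>?P) = (if 0 \<le> s \<and> s \<le> y then \<phi> s else 0)"
      proof (cases "0 \<le> s \<and> s \<le> y")
        case False
        then show ?thesis by (simp only: if_False nn_integral_const mult_zero_left)
      qed (simp add: \<phi>_def)
    qed
    finally show "(\<integral>\<^sup>+s. (if 0 \<le> s \<and> s \<le> y then \<phi> s else 0) \<partial>lborel) =
      (\<integral>\<^sup>+w. (\<integral>\<^sup>+s. (if 0 \<le> s \<and> s \<le> y then H s (w(f := y)) else 0) \<partial>lborel) \<partial>?P)"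
      by (simp add: HH cong: if_cong)
  qed
  also have "\<dots> = (\<integral>\<^sup>+w. (\<integral>\<^sup>+s. (if 0 \<le> s \<and> s \<le> w f then H s w else 0) \<partial>lborel) \<partial>exp.W n)"
    using product_nn_integral_insert_rev[of ?I f "\<lambda>w. \<integral>\<^sup>+s. (if 0 \<le> s \<and> s \<le> w f then H s w else 0) \<partial>lborel"] m2 ins
    by simp
  finally show ?thesis .
qed

lemma kruskal_cong:
  assumes "\<And>e. e \<in> G \<Longrightarrow> w e = w' e"
  shows "kruskal w G = kruskal w' G"
proof -
  have "{g \<in> G. w g < w e} = {g \<in> G. w' g < w' e}" if "e \<in> G" for e using assms that by auto
  then show ?thesis unfolding kruskal_def by auto
qed

text \<open>The lighter edges and their Kruskal forest depend on finitely many comparisons only.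
  Index \<open>(None, e)\<close> records \<open>w e < s\<close>, and \<open>(Some g, e)\<close>
  records \<open>w g < w e\<close>; the set of valid comparisons determines everything else.\<close>

lemma (in weight_dist) measurable_kruskal_fun:
  "(\<lambda>(s, w). \<Psi> (below n s w - D) (kruskal w (below n s w - D))) \<in> measurable (borel \<Otimes>\<^sub>M W n) (count_space UNIV)"
proof -
  define I where "I = insert None (Some ` K_edges n) \<times> K_edges n"
  define P where "P i x = (case i of (None, e) \<Rightarrow> snd x e < fst x | (Some g, e) \<Rightarrow> snd x g < snd x e)"
    for i :: "nat set option \<times> nat set" and x :: "real \<times> (nat set \<Rightarrow> real)"
  define A where "A C = {e \<in> K_edges n. (None, e) \<in> C} - D" for C :: "(nat set option \<times> nat set) set"
  define F where "F C = {e \<in> A C. \<not> joined {g \<in> A C. (Some g, e) \<in> C} e}" for C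
  have P: "Measurable.pred (borel \<Otimes>\<^sub>M W n) (P i)" if "i \<in> I" for i
  proof -
    have m: "(\<lambda>x. snd x e) \<in> borel_measurable (borel \<Otimes>\<^sub>M W n)" if "e \<in> K_edges n" for e
      by (rule measurable_compose[OF measurable_snd measurable_weight[OF that]])
    have fs: "fst \<in> borel_measurable (borel \<Otimes>\<^sub>M W n)" by (rule measurable_fst)
    have "P i = (\<lambda>x. (case fst i of None \<Rightarrow> snd x (snd i) < fst x | Some g \<Rightarrow> snd x g < snd x (snd i)))"
      by (auto simp: P_def split_def fun_eq_iff split: option.split)
    then show ?thesis
      using that m fs unfolding pred_def I_def by (auto split: option.split intro!: borel_measurable_less)
  qed
  have "(\<lambda>x. {i \<in> I. P i x}) \<in> measurable (borel \<Otimes>\<^sub>M W n) (count_space UNIV)"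
    by (rule measurable_finite_Collect) (use P in \<open>auto simp: I_def\<close>)
  then have "(\<lambda>x. \<Psi> (A {i \<in> I. P i x}) (F {i \<in> I. P i x})) \<in> measurable (borel \<Otimes>\<^sub>M W n) (count_space UNIV)"
    by (rule measurable_compose) simp
  moreover have A: "A {i \<in> I. P i x} = below n (fst x) (snd x) - D" for x
    by (auto simp: A_def P_def I_def below_def)
  moreover have "F {i \<in> I. P i x} = kruskal (snd x) (below n (fst x) (snd x) - D)" for x
  proof -
    have "{g \<in> A {i \<in> I. P i x}. (Some g, e) \<in> {i \<in> I. P i x}} = {g \<in> A {i \<in> I. P i x}. snd x g < snd x e}"
      if "e \<in> A {i \<in> I. P i x}" for e
      using that by (auto simp: A_def P_def I_def)
    then have "F {i \<in> I. P i x} = kruskal (snd x) (A {i \<in> I. P i x})"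
      unfolding F_def kruskal_def by auto
    then show ?thesis by (simp add: A)
  qed
  ultimately show ?thesis by (simp add: split_def)
qed

lemma below_minus: "s \<le> w f \<Longrightarrow> below n s w - {f} = below n s w"
  by (auto simp: below_def)

lemma sep_edges_below: "f \<in> sep_edges n (below n s w) \<Longrightarrow> s \<le> w f"
  using joined_edge[OF below_subset, of f n s w] by (force simp: sep_edges_def below_def)

text \<open>With \<open>s\<close> regarded as time, an absent edge appears at rate one, by lack of
  memory, and enters the tree exactly if its endpoints are then separated. So the tree edges, each
  evaluated at its arrival, have the same expected total as the separated pairs integrated over
  time. As \<open>\<Psi>\<close> vanishes on joined pairs, both sums can be extended to all
  edges.\<close>

lemma nn_integral_mst_sum:
  fixes \<Psi> :: "nat set \<Rightarrow> nat set set \<Rightarrow> nat set set \<Rightarrow> real"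
  assumes n: "n \<ge> 1" and nn: "\<And>f A F. 0 \<le> \<Psi> f A F" and z: "\<And>f A F. joined A f \<Longrightarrow> \<Psi> f A F = 0"
  shows "(\<integral>\<^sup>+w. ennreal (\<Sum>f\<in>mst n w. \<Psi> f (below n (w f) w) (kruskal w (below n (w f) w))) \<partial>exp.W n) =
    (\<integral>\<^sup>+w. (\<integral>\<^sup>+s. ennreal (\<Sum>f\<in>sep_edges n (below n s w). \<Psi> f (below n s w) (kruskal w (below n s w)))
        * indicator {0..} s \<partial>lborel) \<partial>exp.W n)"
proof -
  let ?K = "K_edges n"
  let ?R = "\<lambda>w s. ennreal (\<Sum>f\<in>sep_edges n (below n s w). \<Psi> f (below n s w) (kruskal w (below n s w))) * indicator {0..} s"
  let ?L = "\<lambda>w. \<Sum>f\<in>mst n w. \<Psi> f (below n (w f) w) (kruskal w (below n (w f) w))"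
  \<comment> \<open>Removing \<open>f\<close> frees \<open>H f s\<close> from the weight
    \<open>w f\<close>, which \<open>nn_integral_exp_coordinate\<close> demands; for
    \<open>s \<le> w f\<close> nothing is removed.\<close>
  define H where "H f s w = ennreal (\<Psi> f (below n s w - {f}) (kruskal w (below n s w - {f})))" for f s w
  let ?C = "\<lambda>f w s. if 0 \<le> s \<and> s \<le> w f then H f s w else 0"
  have H: "(\<lambda>(s, w). H f s w) \<in> borel_measurable (borel \<Otimes>\<^sub>M exp.W n)" for f
  proof -
    have "(\<lambda>x. ennreal (case x of (s, w) \<Rightarrow> \<Psi> f (below n s w - {f}) (kruskal w (below n s w - {f}))))
       \<in> borel_measurable (borel \<Otimes>\<^sub>M exp.W n)"
      by (rule measurable_compose[OF exp.measurable_kruskal_fun]) simp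
    then show ?thesis by (simp add: H_def split_def)
  qed
  have inv: "H f s (w(f := y)) = H f s w" for f s w y
  proof -
    have "below n s (w(f := y)) - {f} = below n s w - {f}" by (auto simp: below_def)
    moreover have "kruskal (w(f := y)) (below n s w - {f}) = kruskal w (below n s w - {f})"
      by (rule kruskal_cong) auto
    ultimately show ?thesis by (simp add: H_def)
  qed
  have m1: "(\<lambda>w. H f (w f) w) \<in> borel_measurable (exp.W n)" if "f \<in> ?K" for f
  proof -
    have "(\<lambda>w. (w f, w)) \<in> measurable (exp.W n) (borel \<Otimes>\<^sub>M exp.W n)"
      using exp.measurable_weight[OF that] by measurable
    from measurable_compose[OF this H] show ?thesis by simp
  qed
  have joint: "(\<lambda>(s, w). ?C f w s) \<in> borel_measurable (borel \<Otimes>\<^sub>M exp.W n)"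
    if f: "f \<in> ?K" for f
  proof -
    have [measurable]: "(\<lambda>x. snd x f) \<in> borel_measurable (borel \<Otimes>\<^sub>M exp.W n)"
      by (rule measurable_compose[OF measurable_snd exp.measurable_weight[OF f]])
    have [measurable]: "(\<lambda>x. H f (fst x) (snd x)) \<in> borel_measurable (borel \<Otimes>\<^sub>M exp.W n)"
      using H by (simp add: split_def)
    have "(\<lambda>x. if 0 \<le> fst x \<and> fst x \<le> snd x f then H f (fst x) (snd x) else 0) \<in> borel_measurable (borel \<Otimes>\<^sub>M exp.W n)"
      by measurable
    then show ?thesis by (simp add: split_def)
  qed
  have m2: "(\<lambda>s. ?C f w s) \<in> borel_measurable lborel"
    if "f \<in> ?K" "w \<in> space (exp.W n)" for f w
    using measurable_compose[OF measurable_Pair2'[OF that(2)] joint[OF that(1)]] by simp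
  have m3: "(\<lambda>w. \<integral>\<^sup>+s. ?C f w s \<partial>lborel) \<in> borel_measurable (exp.W n)"
    if "f \<in> ?K" for f
  proof (rule lborel.borel_measurable_nn_integral)
    have "(\<lambda>x. (snd x, fst x)) \<in> measurable (exp.W n \<Otimes>\<^sub>M lborel) (borel \<Otimes>\<^sub>M exp.W n)" by measurable
    from measurable_compose[OF this joint[OF that]]
    show "(\<lambda>(w, s). ?C f w s) \<in> borel_measurable (exp.W n \<Otimes>\<^sub>M lborel)"
      by (simp add: split_def cong: if_cong)
  qed
  have "(\<integral>\<^sup>+w. ennreal (?L w) \<partial>exp.W n) = (\<integral>\<^sup>+w. (\<Sum>f\<in>?K. H f (w f) w) \<partial>exp.W n)"
  proof (rule nn_integral_cong_AE)
    show "AE w in exp.W n. ennreal (?L w) = (\<Sum>f\<in>?K. H f (w f) w)"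
      using exp.AE_inj[of n]
    proof eventually_elim
      case (elim w)
      have "?L w =
        (\<Sum>f\<in>?K. \<Psi> f (below n (w f) w) (kruskal w (below n (w f) w)))"
        unfolding mst_eq_kruskal[OF n elim]
        by (rule sum.mono_neutral_left) (auto simp: kruskal_def below_def[symmetric] intro: z)
      then show ?case using nn by (simp add: H_def below_minus)
    qed
  qed
  also have "\<dots> = (\<Sum>f\<in>?K. \<integral>\<^sup>+w. H f (w f) w \<partial>exp.W n)"
    using m1 by (intro nn_integral_sum) auto
  also have "\<dots> = (\<Sum>f\<in>?K. \<integral>\<^sup>+w. (\<integral>\<^sup>+s. ?C f w s \<partial>lborel) \<partial>exp.W n)"
    by (intro sum.cong refl nn_integral_exp_coordinate H inv)
  also have "\<dots> = (\<integral>\<^sup>+w. (\<Sum>f\<in>?K. \<integral>\<^sup>+s. ?C f w s \<partial>lborel) \<partial>exp.W n)"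
    using m3 by (intro nn_integral_sum[symmetric]) auto
  also have "\<dots> = (\<integral>\<^sup>+w. (\<integral>\<^sup>+s. ?R w s \<partial>lborel) \<partial>exp.W n)"
  proof (rule nn_integral_cong)
    fix w assume w: "w \<in> space (exp.W n)"
    have "(\<Sum>f\<in>?K. \<integral>\<^sup>+s. ?C f w s \<partial>lborel) = (\<integral>\<^sup>+s. (\<Sum>f\<in>?K. ?C f w s) \<partial>lborel)"
      using m2 w by (intro nn_integral_sum[symmetric]) auto
    also have "\<dots> = (\<integral>\<^sup>+s. ?R w s \<partial>lborel)"
    proof (rule nn_integral_cong)
      fix s :: real
      let ?A = "below n s w"
      have "(\<Sum>f\<in>?K. ?C f w s) = (\<Sum>f\<in>sep_edges n ?A. ?C f w s)"
        by (rule sum.mono_neutral_right) (auto simp: sep_edges_def H_def below_minus z)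
      \<comment> \<open>A separated edge has weight at least \<open>s\<close>, so the condition
        \<open>s \<le> w f\<close> drops out.\<close>
      also have "\<dots> = (\<Sum>f\<in>sep_edges n ?A. ennreal (\<Psi> f ?A (kruskal w ?A)) * indicator {0..} s)"
        by (intro sum.cong refl) (auto dest: sep_edges_below simp: H_def below_minus indicator_def)
      also have "\<dots> = ennreal (\<Sum>f\<in>sep_edges n ?A. \<Psi> f ?A (kruskal w ?A)) * indicator {0..} s"
        using nn by (simp add: sum_distrib_right[symmetric])
      finally show "(\<Sum>f\<in>?K. ?C f w s) = ennreal (\<Sum>f\<in>sep_edges n ?A. \<Psi> f ?A (kruskal w ?A)) * indicator {0..} s" .
    qed
    finally show "(\<Sum>f\<in>?K. \<integral>\<^sup>+s. ?C f w s \<partial>lborel) = (\<integral>\<^sup>+s. ?R w s \<partial>lborel)" .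
  qed
  finally show ?thesis .
qed

text \<open>Squared degrees count ordered pairs of edges by their common endpoints. A pair with
  \<open>e = f\<close> gives \<open>2\<close>; of the two orders of distinct edges the one with
  \<open>w e < w f\<close> is kept and doubled, so that each edge is compared with the forest it is
  added to.\<close>

lemma degree_square_sum:
  fixes w :: "nat set \<Rightarrow> real"
  assumes T: "T \<subseteq> K_edges n" and inj: "inj_on w T"
  shows "(\<Sum>x<n. (real (card {e \<in> T. x \<in> e}))\<^sup>2) =
    2 * real (card T) + 2 * (\<Sum>f\<in>T. \<Sum>x\<in>f. real (card {e \<in> {e \<in> T. w e < w f}. x \<in> e}))"
proof -
  have fin: "finite T" using T by (auto intro: finite_edges)
  let ?S = "\<lambda>R. \<Sum>f\<in>T. \<Sum>x\<in>f. real (card {e \<in> {e \<in> T. R e f}. x \<in> e})"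
  have count: "?S R = (\<Sum>f\<in>T. \<Sum>e\<in>T. if R e f then real (card (e \<inter> f)) else 0)" for R
  proof (rule sum.cong)
    fix f assume "f \<in> T"
    then have finf: "finite f" using T finite_edge by blast
    have "(\<Sum>x\<in>f. real (card {e \<in> {e \<in> T. R e f}. x \<in> e})) =
      (\<Sum>x\<in>f. \<Sum>e\<in>{e \<in> {e \<in> T. R e f}. x \<in> e}. 1)" by simp
    also have "\<dots> = (\<Sum>e\<in>{e \<in> T. R e f}. \<Sum>x\<in>{x \<in> f. x \<in> e}. 1)"
      using fin finf by (intro sum.swap_restrict) auto
    also have "\<dots> = (\<Sum>e\<in>{e \<in> T. R e f}. real (card (e \<inter> f)))"
      by (intro sum.cong refl) (simp add: Int_def conj_commute)
    also have "\<dots> = (\<Sum>e\<in>T. if R e f then real (card (e \<inter> f)) else 0)"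
      by (rule sum.inter_filter[OF fin])
    finally show "(\<Sum>x\<in>f. real (card {e \<in> {e \<in> T. R e f}. x \<in> e})) = \<dots>" .
  qed simp
  have "(\<Sum>x<n. (real (card {e \<in> T. x \<in> e}))\<^sup>2) = (\<Sum>f\<in>T. \<Sum>x\<in>f. real (card {e \<in> T. x \<in> e}))"
    using sum_over_endpoints[OF T, of "\<lambda>x. real (card {e \<in> T. x \<in> e})"] by (simp add: power2_eq_square)
  also have "\<dots> = (\<Sum>f\<in>T. \<Sum>e\<in>T. real (card (e \<inter> f)))"
    using count[of "\<lambda>_ _. True"] by simp
  also have "\<dots> = (\<Sum>f\<in>T. \<Sum>e\<in>T. (if e = f then real (card (e \<inter> f)) else 0) +
      (if w e < w f then real (card (e \<inter> f)) else 0) + (if w f < w e then real (card (e \<inter> f)) else 0))"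
  proof (intro sum.cong refl)
    fix f e assume ef: "f \<in> T" "e \<in> T"
    show "real (card (e \<inter> f)) = (if e = f then real (card (e \<inter> f)) else 0) +
      (if w e < w f then real (card (e \<inter> f)) else 0) + (if w f < w e then real (card (e \<inter> f)) else 0)"
    proof (cases "e = f")
      case False
      then have "w e \<noteq> w f" using inj ef by (auto dest: inj_onD)
      then consider "w e < w f" | "w f < w e" by linarith
      then show ?thesis using False by cases simp_all
    qed simp
  qed
  also have "\<dots> = (\<Sum>f\<in>T. \<Sum>e\<in>T. if e = f then real (card (e \<inter> f)) else 0) +
      (\<Sum>f\<in>T. \<Sum>e\<in>T. if w e < w f then real (card (e \<inter> f)) else 0) +
      (\<Sum>f\<in>T. \<Sum>e\<in>T. if w f < w e then real (card (e \<inter> f)) else 0)"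
    by (simp add: sum.distrib)
  also have "(\<Sum>f\<in>T. \<Sum>e\<in>T. if w f < w e then real (card (e \<inter> f)) else 0) =
      (\<Sum>f\<in>T. \<Sum>e\<in>T. if w e < w f then real (card (e \<inter> f)) else 0)"
    by (subst sum.swap) (intro sum.cong refl, simp add: Int_commute)
  also have "(\<Sum>f\<in>T. \<Sum>e\<in>T. if e = f then real (card (e \<inter> f)) else 0) = (\<Sum>f\<in>T. 2)"
  proof (rule sum.cong)
    fix f assume "f \<in> T"
    then have "card f = 2" using T card_edge by blast
    then show "(\<Sum>e\<in>T. if e = f then real (card (e \<inter> f)) else 0) = 2"
      using \<open>f \<in> T\<close> fin by (simp add: sum.delta)
  qed simp
  finally show ?thesis unfolding count by simp
qed

definition degree_square :: "nat \<Rightarrow> nat set set \<Rightarrow> real" where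
  "degree_square n T = (\<Sum>x<n. (real (card {e \<in> T. x \<in> e}))\<^sup>2)"

text \<open>\<open>forest_degree_sum\<close> integrated over \<open>s\<close>. By
  \<open>nn_integral_mst_sum\<close>, the separated pairs (\<open>\<Psi>1\<close>) yield the
  \<open>n - 1\<close> tree edges, and the endpoint degrees (\<open>\<Psi>2\<close>) yield half the
  excess of the squared degrees over \<open>2 * (n - 1)\<close>; \<open>kap\<close> yields
  \<open>E_L n\<close>. The latter stays on the left, so that no subtraction of extended nonnegative
  reals occurs.\<close>

lemma nn_integral_degree_square:
  assumes n: "n \<ge> 1"
  shows "(\<integral>\<^sup>+w. ennreal ((degree_square n (mst n w) - 2 * (real n - 1)) / 2) \<partial>exp.W n) + ennreal (2 * real n * E_L n)
    = ennreal (4 * (real n - 1))"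
proof -
  let ?W = "exp.W n"
  define \<Psi>1 :: "nat set \<Rightarrow> nat set set \<Rightarrow> nat set set \<Rightarrow> real"
    where "\<Psi>1 f A F = (if joined A f then 0 else 1)" for f A F
  define \<Psi>2 :: "nat set \<Rightarrow> nat set set \<Rightarrow> nat set set \<Rightarrow> real"
    where "\<Psi>2 f A F = (if joined A f then 0 else \<Sum>x\<in>f. real (card {e \<in> F. x \<in> e}))" for f A F
  define Q where "Q \<Psi> A F = (\<Sum>f\<in>sep_edges n A. \<Psi> f A F)"
    for \<Psi> :: "nat set \<Rightarrow> nat set set \<Rightarrow> nat set set \<Rightarrow> real" and A F
  define J where "J G w = (\<integral>\<^sup>+s. ennreal (G (below n s w) (kruskal w (below n s w))) * indicator {0..} s \<partial>lborel)"
    for G :: "nat set set \<Rightarrow> nat set set \<Rightarrow> real" and w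
  have joint: "(\<lambda>(s, w). ennreal (G (below n s w) (kruskal w (below n s w))) * indicator {0..} s)
      \<in> borel_measurable (borel \<Otimes>\<^sub>M ?W)" for G :: "nat set set \<Rightarrow> nat set set \<Rightarrow> real"
  proof -
    have "(\<lambda>x. ennreal (case x of (s, w) \<Rightarrow> G (below n s w - {}) (kruskal w (below n s w - {}))))
       \<in> borel_measurable (borel \<Otimes>\<^sub>M ?W)"
      by (rule measurable_compose[OF exp.measurable_kruskal_fun]) simp
    then have [measurable]: "(\<lambda>x. ennreal (G (below n (fst x) (snd x)) (kruskal (snd x) (below n (fst x) (snd x)))))
       \<in> borel_measurable (borel \<Otimes>\<^sub>M ?W)" by (simp add: split_def)
    show ?thesis unfolding split_def by measurable
  qed
  have ms: "(\<lambda>s. ennreal (G (below n s w) (kruskal w (below n s w))) * indicator {0..} s) \<in> borel_measurable lborel"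
    if "w \<in> space ?W" for G :: "nat set set \<Rightarrow> nat set set \<Rightarrow> real" and w
    using measurable_compose[OF measurable_Pair2'[OF that] joint] by simp
  have mJ: "J G \<in> borel_measurable ?W" for G
    unfolding J_def[abs_def]
  proof (rule lborel.borel_measurable_nn_integral)
    have "(\<lambda>x. (snd x, fst x)) \<in> measurable (?W \<Otimes>\<^sub>M lborel) (borel \<Otimes>\<^sub>M ?W)" by measurable
    from measurable_compose[OF this joint]
    show "(\<lambda>(w, s). ennreal (G (below n s w) (kruskal w (below n s w))) * indicator {0..} s)
        \<in> borel_measurable (?W \<Otimes>\<^sub>M lborel)"
      by (simp add: split_def)
  qed
  have pointwise: "J (Q \<Psi>2) w + ennreal (2 * real n) * J (\<lambda>A F. kap n A) w = 4 * J (Q \<Psi>1) w"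
    if w: "w \<in> space ?W" and inj: "inj_on w (K_edges n)" for w
  proof -
    have "J (Q \<Psi>2) w + ennreal (2 * real n) * J (\<lambda>A F. kap n A) w =
      (\<integral>\<^sup>+s. ennreal (Q \<Psi>2 (below n s w) (kruskal w (below n s w))) * indicator {0..} s +
        ennreal (2 * real n) * (ennreal (kap n (below n s w)) * indicator {0..} s) \<partial>lborel)"
      unfolding J_def using ms[OF w, of "Q \<Psi>2"] ms[OF w, of "\<lambda>A F. kap n A"]
      by (subst nn_integral_add) (auto simp: nn_integral_cmult)
    also have "\<dots> = (\<integral>\<^sup>+s. 4 * (ennreal (Q \<Psi>1 (below n s w) (kruskal w (below n s w))) * indicator {0..} s) \<partial>lborel)"
    proof (rule nn_integral_cong)
      fix s :: real
      let ?A = "below n s w" and ?F = "kruskal w (below n s w)"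
      have F: "conn ?F = conn ?A" "tight n ?F"
        using kruskal_forest[OF below_subset inj_on_subset[OF inj below_subset]] by auto
      have FK: "?F \<subseteq> K_edges n" by (rule subset_trans[OF kruskal_subset below_subset])
      have sep: "sep_edges n ?F = sep_edges n ?A" by (simp add: sep_edges_def joined_def F(1))
      have Q2: "Q \<Psi>2 ?A ?F = (\<Sum>e\<in>sep_edges n ?F. \<Sum>x\<in>e. real (card {f \<in> ?F. x \<in> f}))"
        unfolding Q_def sep by (intro sum.cong refl) (auto simp: \<Psi>2_def sep_edges_def)
      have Q1: "Q \<Psi>1 ?A ?F = real (card (sep_edges n ?F))"
      proof -
        have "Q \<Psi>1 ?A ?F = (\<Sum>f\<in>sep_edges n ?A. 1)"
          unfolding Q_def by (intro sum.cong refl) (auto simp: \<Psi>1_def sep_edges_def)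
        then show ?thesis by (simp add: sep)
      qed
      have eq: "Q \<Psi>2 ?A ?F + 2 * real n * kap n ?A = 4 * Q \<Psi>1 ?A ?F"
        using forest_degree_sum[OF FK F(2)] kap_cong[OF F(1)] by (simp add: Q1 Q2)
      have "0 \<le> Q \<Psi>2 ?A ?F" unfolding Q2 by (intro sum_nonneg) auto
      moreover have "0 \<le> kap n ?A" by (rule kap_nonneg[OF below_subset n])
      ultimately have "ennreal (Q \<Psi>2 ?A ?F) + ennreal (2 * real n) * ennreal (kap n ?A) =
        ennreal (4 * Q \<Psi>1 ?A ?F)"
        unfolding eq[symmetric] by (simp add: ennreal_plus ennreal_mult)
      also have "\<dots> = 4 * ennreal (Q \<Psi>1 ?A ?F)" by (simp add: Q1 ennreal_mult)
      finally show "ennreal (Q \<Psi>2 ?A ?F) * indicator {0..} s +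
          ennreal (2 * real n) * (ennreal (kap n ?A) * indicator {0..} s) =
         4 * (ennreal (Q \<Psi>1 ?A ?F) * indicator {0..} s)"
        by (auto simp: indicator_def)
    qed
    also have "\<dots> = 4 * J (Q \<Psi>1) w"
      unfolding J_def by (rule nn_integral_cmult[OF ms[OF w]])
    finally show ?thesis .
  qed
  have key: "(\<integral>\<^sup>+w. J (Q \<Psi>2) w \<partial>?W) + ennreal (2 * real n) * (\<integral>\<^sup>+w. J (\<lambda>A F. kap n A) w \<partial>?W) =
    4 * (\<integral>\<^sup>+w. J (Q \<Psi>1) w \<partial>?W)"
  proof -
    have "(\<integral>\<^sup>+w. J (Q \<Psi>2) w \<partial>?W) + ennreal (2 * real n) * (\<integral>\<^sup>+w. J (\<lambda>A F. kap n A) w \<partial>?W) =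
      (\<integral>\<^sup>+w. J (Q \<Psi>2) w + ennreal (2 * real n) * J (\<lambda>A F. kap n A) w \<partial>?W)"
      using mJ by (subst nn_integral_add) (auto simp: nn_integral_cmult)
    also have "\<dots> = (\<integral>\<^sup>+w. 4 * J (Q \<Psi>1) w \<partial>?W)"
      using exp.AE_inj[of n] AE_space
      by (intro nn_integral_cong_AE, eventually_elim) (rule pointwise)
    also have "\<dots> = 4 * (\<integral>\<^sup>+w. J (Q \<Psi>1) w \<partial>?W)"
      by (rule nn_integral_cmult[OF mJ])
    finally show ?thesis .
  qed
  have I3: "(\<integral>\<^sup>+w. J (\<lambda>A F. kap n A) w \<partial>?W) = ennreal (E_L n)"
  proof -
    have "(\<integral>\<^sup>+w. J (\<lambda>A F. kap n A) w \<partial>?W) = (\<integral>\<^sup>+w. ennreal (mst_weight n w) \<partial>?W)"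
      using exp.AE_inj[of n] exp.AE_nonneg[of n]
      by (intro nn_integral_cong_AE, eventually_elim) (simp add: J_def nn_integral_kap_below[OF n])
    then show ?thesis by (simp add: nn_integral_E_L[OF n])
  qed
  have zero: "\<Psi>1 f A F = 0" "\<Psi>2 f A F = 0" if "joined A f" for f A F
    using that by (simp_all add: \<Psi>1_def \<Psi>2_def)
  have nonneg: "0 \<le> \<Psi>1 f A F" "0 \<le> \<Psi>2 f A F" for f A F
    by (simp_all add: \<Psi>1_def \<Psi>2_def sum_nonneg)
  have I1: "(\<integral>\<^sup>+w. J (Q \<Psi>1) w \<partial>?W) = ennreal (real n - 1)"
  proof -
    have "(\<integral>\<^sup>+w. J (Q \<Psi>1) w \<partial>?W) =
      (\<integral>\<^sup>+w. ennreal (\<Sum>f\<in>mst n w. \<Psi>1 f (below n (w f) w) (kruskal w (below n (w f) w))) \<partial>?W)"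
      unfolding J_def Q_def by (rule nn_integral_mst_sum[OF n nonneg(1) zero(1), symmetric])
    also have "\<dots> = (\<integral>\<^sup>+w. ennreal (real n - 1) \<partial>?W)"
    proof (rule nn_integral_cong_AE)
      show "AE w in ?W. ennreal (\<Sum>f\<in>mst n w. \<Psi>1 f (below n (w f) w) (kruskal w (below n (w f) w))) = ennreal (real n - 1)"
        using exp.AE_inj[of n]
      proof eventually_elim
        case (elim w)
        have "(\<Sum>f\<in>mst n w. \<Psi>1 f (below n (w f) w) (kruskal w (below n (w f) w))) = (\<Sum>f\<in>mst n w. 1)"
          unfolding mst_eq_kruskal[OF n elim]
          by (intro sum.cong refl) (auto simp: \<Psi>1_def kruskal_def below_def)
        then show ?case using card_mst[OF n, of w] n by simp
      qed
    qed
    also have "\<dots> = ennreal (real n - 1)"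
      using prob_space.emeasure_space_1[OF exp.prob_space_W] by simp
    finally show ?thesis .
  qed
  have I2: "(\<integral>\<^sup>+w. J (Q \<Psi>2) w \<partial>?W) = (\<integral>\<^sup>+w. ennreal ((degree_square n (mst n w) - 2 * (real n - 1)) / 2) \<partial>?W)"
  proof -
    have "(\<integral>\<^sup>+w. J (Q \<Psi>2) w \<partial>?W) =
      (\<integral>\<^sup>+w. ennreal (\<Sum>f\<in>mst n w. \<Psi>2 f (below n (w f) w) (kruskal w (below n (w f) w))) \<partial>?W)"
      unfolding J_def Q_def by (rule nn_integral_mst_sum[OF n nonneg(2) zero(2), symmetric])
    also have "\<dots> = (\<integral>\<^sup>+w. ennreal ((degree_square n (mst n w) - 2 * (real n - 1)) / 2) \<partial>?W)"
    proof (rule nn_integral_cong_AE)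
      show "AE w in ?W. ennreal (\<Sum>f\<in>mst n w. \<Psi>2 f (below n (w f) w) (kruskal w (below n (w f) w))) =
          ennreal ((degree_square n (mst n w) - 2 * (real n - 1)) / 2)"
        using exp.AE_inj[of n]
      proof eventually_elim
        case (elim w)
        note mst = mst_eq_kruskal[OF n elim]
        have "(\<Sum>f\<in>mst n w. \<Psi>2 f (below n (w f) w) (kruskal w (below n (w f) w))) =
          (\<Sum>f\<in>mst n w. \<Sum>x\<in>f. real (card {e \<in> {e \<in> mst n w. w e < w f}. x \<in> e}))"
        proof (rule sum.cong)
          fix f assume "f \<in> mst n w"
          then have "\<not> joined (below n (w f) w) f" by (simp add: mst kruskal_def below_def)
          then show "\<Psi>2 f (below n (w f) w) (kruskal w (below n (w f) w)) =
            (\<Sum>x\<in>f. real (card {e \<in> {e \<in> mst n w. w e < w f}. x \<in> e}))"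
            by (simp add: \<Psi>2_def kruskal_below mst)
        qed simp
        moreover have "real (card (mst n w)) = real n - 1" using card_mst[OF n, of w] n by simp
        ultimately show ?case
          using degree_square_sum[OF mst_subset[OF n] inj_on_subset[OF elim mst_subset[OF n]], of w]
          by (simp add: degree_square_def)
      qed
    qed
    finally show ?thesis .
  qed
  have "ennreal (4 * (real n - 1)) = 4 * ennreal (real n - 1)"
    using n by (subst ennreal_mult) auto
  moreover have "ennreal (2 * real n * E_L n) = ennreal (2 * real n) * ennreal (E_L n)"
    using E_L_eq[OF n] E_L_integral_nonneg[OF n] by (intro ennreal_mult) auto
  ultimately show ?thesis using key unfolding I1 I2 I3 by (simp only:)
qed

text \<open>Only finitely many trees occur, so every function of the tree is bounded.\<close>

lemma integrable_mst_fun: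
  fixes q :: "nat set set \<Rightarrow> real"
  assumes "n \<ge> 1"
  shows "integrable (exp.W n) (\<lambda>w. q (mst n w))"
proof -
  interpret prob_space "exp.W n" by (rule exp.prob_space_W)
  have m: "(\<lambda>w. q (mst n w)) \<in> borel_measurable (exp.W n)"
    by (rule measurable_compose[OF exp.measurable_mst]) simp
  have "norm (q (mst n w)) \<le> Max ((\<lambda>T. \<bar>q T\<bar>) ` Pow (K_edges n))" for w
    using mst_subset[OF assms, of w] by (auto intro!: Max_ge)
  then show ?thesis using m by (intro integrable_const_bound) auto
qed

text \<open>Half the excess over \<open>2 * (n - 1)\<close> has mean
  \<open>4 * (n - 1) - 2 * n * E_L n\<close>; doubling it and adding \<open>2 * (n - 1)\<close>
  explains the factor 10.\<close>

lemma sum_E_deg_sq: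
  assumes n: "n \<ge> 1"
  shows "(\<Sum>x<n. E_deg_sq n x) = 10 * (real n - 1) - 4 * real n * E_L n"
proof -
  interpret prob_space "exp.W n" by (rule exp.prob_space_W)
  define D where "D w = (degree_square n (mst n w) - 2 * (real n - 1)) / 2" for w
  have mD: "D \<in> borel_measurable (exp.W n)"
    unfolding D_def[abs_def] by (rule measurable_compose[OF exp.measurable_mst]) simp
  have "AE w in exp.W n. 0 \<le> D w"
    using exp.AE_inj[of n]
  proof eventually_elim
    case (elim w)
    have "real (card (mst n w)) = real n - 1" using card_mst[OF n, of w] n by simp
    then have "D w = (\<Sum>f\<in>mst n w. \<Sum>x\<in>f. real (card {e \<in> {e \<in> mst n w. w e < w f}. x \<in> e}))"
      using degree_square_sum[OF mst_subset[OF n] inj_on_subset[OF elim mst_subset[OF n]], of w]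
      by (simp add: D_def degree_square_def)
    then show ?case by (simp add: sum_nonneg)
  qed
  then have ID: "(\<integral>w. D w \<partial>exp.W n) = enn2real (\<integral>\<^sup>+w. ennreal (D w) \<partial>exp.W n)"
    by (intro integral_eq_nn_integral mD)
  have "E_L n \<ge> 0" using E_L_eq[OF n] E_L_integral_nonneg[OF n] by simp
  have eq: "(\<integral>\<^sup>+w. ennreal (D w) \<partial>exp.W n) + ennreal (2 * real n * E_L n) = ennreal (4 * (real n - 1))"
    unfolding D_def by (rule nn_integral_degree_square[OF n])
  \<comment> \<open>The integral is finite because a sum containing it is; from here on real
    arithmetic applies.\<close>
  obtain r where r: "0 \<le> r" "(\<integral>\<^sup>+w. ennreal (D w) \<partial>exp.W n) = ennreal r"
    using eq by (cases "\<integral>\<^sup>+w. ennreal (D w) \<partial>exp.W n") auto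
  then have "r + 2 * real n * E_L n = 4 * (real n - 1)"
    using eq \<open>E_L n \<ge> 0\<close> n by (simp flip: ennreal_plus add: ennreal_inj)
  moreover have "(\<integral>w. D w \<partial>exp.W n) = r" using ID r by simp
  moreover have "(\<integral>w. D w \<partial>exp.W n) = ((\<integral>w. degree_square n (mst n w) \<partial>exp.W n) - 2 * (real n - 1)) / 2"
    unfolding D_def using integrable_mst_fun[OF n, of "degree_square n"] prob_space by simp
  moreover have "(\<integral>w. degree_square n (mst n w) \<partial>exp.W n) = (\<Sum>x<n. E_deg_sq n x)"
    unfolding degree_square_def E_deg_sq_def exp_weights_def mst_degree_def
    using integrable_mst_fun[OF n, of "\<lambda>T. (real (card {e \<in> T. _ \<in> e}))\<^sup>2"] by (intro Bochner_Integration.integral_sum) auto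
  ultimately show ?thesis by (simp add: field_simps)
qed

section \<open>Symmetry and edge probabilities\<close>

lemma conn_image_mono:
  assumes "(a, b) \<in> conn S"
  shows "(\<pi> a, \<pi> b) \<in> conn ((`) \<pi> ` S)"
  using assms unfolding conn_def
proof (induction rule: rtrancl_induct)
  case (step y z)
  then have "\<pi> ` {y, z} \<in> (`) \<pi> ` S" by (intro imageI) simp
  then have "(\<pi> y, \<pi> z) \<in> {(a, b). {a, b} \<in> (`) \<pi> ` S}" by simp
  then show ?case using step(3) by (rule rtrancl_into_rtrancl[rotated])
qed simp

lemma conn_image:
  assumes "inj \<pi>"
  shows "(\<pi> a, \<pi> b) \<in> conn ((`) \<pi> ` S) \<longleftrightarrow> (a, b) \<in> conn S"
proof
  assume "(\<pi> a, \<pi> b) \<in> conn ((`) \<pi> ` S)"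
  then have "(inv \<pi> (\<pi> a), inv \<pi> (\<pi> b)) \<in> conn ((`) (inv \<pi>) ` (`) \<pi> ` S)" by (rule conn_image_mono)
  moreover have "(`) (inv \<pi>) ` (`) \<pi> ` S = S"
    using assms by (auto simp: image_image inv_f_f)
  ultimately show "(a, b) \<in> conn S" using assms by (simp add: inv_f_f)
qed (rule conn_image_mono)

lemma joined_image:
  assumes "inj \<pi>"
  shows "joined ((`) \<pi> ` S) (\<pi> ` e) \<longleftrightarrow> joined S e"
proof -
  have "\<pi> ` e \<times> \<pi> ` e \<subseteq> conn ((`) \<pi> ` S) \<longleftrightarrow> (\<forall>a\<in>e. \<forall>b\<in>e. (\<pi> a, \<pi> b) \<in> conn ((`) \<pi> ` S))"
    by blast
  then show ?thesis unfolding joined_def conn_image[OF assms] by blast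
qed

lemma image_K_edges:
  assumes "\<pi> permutes {..<n}"
  shows "(`) \<pi> ` K_edges n = K_edges n"
proof -
  have sub: "\<pi> ` e \<in> K_edges n" if "\<pi> permutes {..<n}" "e \<in> K_edges n" for \<pi> e
  proof -
    have "card (\<pi> ` e) = card e" using permutes_inj[OF that(1)] by (simp add: card_image inj_on_def)
    moreover have "\<pi> ` e \<subseteq> {..<n}" using that permutes_image[OF that(1)] by (auto simp: K_edges_def)
    ultimately show ?thesis using that(2) by (simp add: K_edges_def)
  qed
  show ?thesis
  proof
    show "K_edges n \<subseteq> (`) \<pi> ` K_edges n"
    proof
      fix e assume "e \<in> K_edges n"
      then have "inv \<pi> ` e \<in> K_edges n" using sub[OF permutes_inv[OF assms]] by blast
      moreover have "e = \<pi> ` inv \<pi> ` e" using permutes_surj[OF assms] by (simp add: image_f_inv_f)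
      ultimately show "e \<in> (`) \<pi> ` K_edges n" by blast
    qed
  qed (use sub[OF assms] in auto)
qed

lemma kruskal_image:
  assumes "\<pi> permutes {..<n}" "e \<in> K_edges n"
    and w': "\<And>e. e \<in> K_edges n \<Longrightarrow> w' e = w (\<pi> ` e)"
  shows "e \<in> kruskal w' (K_edges n) \<longleftrightarrow> \<pi> ` e \<in> kruskal w (K_edges n)"
proof -
  let ?K = "K_edges n"
  have "{g \<in> ?K. w g < w (\<pi> ` e)} = (`) \<pi> ` {g \<in> ?K. w' g < w' e}"
  proof (intro set_eqI iffI)
    fix g assume "g \<in> {g \<in> ?K. w g < w (\<pi> ` e)}"
    moreover from this obtain g' where "g' \<in> ?K" "g = \<pi> ` g'"
      using image_K_edges[OF assms(1)] by blast
    ultimately show "g \<in> (`) \<pi> ` {g \<in> ?K. w' g < w' e}" using w' assms(2) by auto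
  next
    fix g assume "g \<in> (`) \<pi> ` {g \<in> ?K. w' g < w' e}"
    then show "g \<in> {g \<in> ?K. w g < w (\<pi> ` e)}"
      using w' assms(2) image_K_edges[OF assms(1)] by auto
  qed
  then have "joined {g \<in> ?K. w g < w (\<pi> ` e)} (\<pi> ` e) \<longleftrightarrow> joined {g \<in> ?K. w' g < w' e} e"
    using joined_image[OF permutes_inj[OF assms(1)]] by simp
  moreover have "\<pi> ` e \<in> ?K" using image_K_edges[OF assms(1)] assms(2) by blast
  ultimately show ?thesis using assms(2) by (simp add: kruskal_def)
qed

lemma sets_prob_in_mst: "{w \<in> space (exp.W n). S \<subseteq> mst n w} \<in> sets (exp.W n)"
  using measurable_sets[OF exp.measurable_mst, of "{T. S \<subseteq> T}" n]
  by (simp add: vimage_def Int_def conj_commute)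

text \<open>Relabelling the vertices permutes the coordinates of the product measure and preserves
  it. The tree is known to follow the relabelling only for distinct weights, as the choice in
  \<open>mst\<close> need not respect symmetry among several minimal trees; hence the events are
  compared almost everywhere.\<close>

lemma prob_in_mst_image:
  assumes n: "n \<ge> 1" and \<pi>: "\<pi> permutes {..<n}" and S: "S \<subseteq> K_edges n"
  shows "prob_in_mst n ((`) \<pi> ` S) = prob_in_mst n S"
proof -
  let ?K = "K_edges n" and ?W = "exp.W n"
  interpret prob_space ?W by (rule exp.prob_space_W)
  define \<tau> where "\<tau> w = (\<lambda>e\<in>?K. w (\<pi> ` e))" for w :: "nat set \<Rightarrow> real"
  have inj: "inj_on ((`) \<pi>) ?K"
    using permutes_inj[OF \<pi>] by (auto simp: inj_on_def inj_image_eq_iff)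
  have maps: "(`) \<pi> \<in> ?K \<rightarrow> ?K" using image_K_edges[OF \<pi>] by blast
  have distr: "distr ?W ?W \<tau> = ?W"
    using distr_PiM_reindex[OF exp.prob_space_axioms inj maps] unfolding \<tau>_def[abs_def] by simp
  have m\<tau>: "\<tau> \<in> measurable ?W ?W"
    unfolding \<tau>_def[abs_def] using maps by (intro measurable_restrict measurable_component_singleton) auto
  have "prob_in_mst n S = measure (distr ?W ?W \<tau>) {w \<in> space ?W. S \<subseteq> mst n w}"
    unfolding distr by (simp add: prob_in_mst_def exp_weights_def)
  also have "\<dots> = measure ?W (\<tau> -` {w \<in> space ?W. S \<subseteq> mst n w} \<inter> space ?W)"
    by (rule measure_distr[OF m\<tau> sets_prob_in_mst])
  also have "\<dots> = measure ?W {w \<in> space ?W. (`) \<pi> ` S \<subseteq> mst n w}"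
  proof (rule finite_measure_eq_AE)
    show "AE w in ?W. w \<in> \<tau> -` {w \<in> space ?W. S \<subseteq> mst n w} \<inter> space ?W \<longleftrightarrow> w \<in> {w \<in> space ?W. (`) \<pi> ` S \<subseteq> mst n w}"
      using exp.AE_inj[of n] AE_space
    proof eventually_elim
      case (elim w)
      have t: "\<tau> w e = w (\<pi> ` e)" if "e \<in> ?K" for e using that by (simp add: \<tau>_def)
      have "inj_on (\<tau> w) ?K"
      proof (rule inj_onI)
        fix e f assume ef: "e \<in> ?K" "f \<in> ?K" "\<tau> w e = \<tau> w f"
        then have "\<pi> ` e = \<pi> ` f" using inj_onD[OF elim(1), of "\<pi> ` e" "\<pi> ` f"] maps t by auto
        then show "e = f" using inj_onD[OF inj] ef by blast
      qed
      then have "mst n (\<tau> w) = kruskal (\<tau> w) ?K" by (rule mst_eq_kruskal[OF n])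
      moreover have "mst n w = kruskal w ?K" by (rule mst_eq_kruskal[OF n elim(1)])
      ultimately have "S \<subseteq> mst n (\<tau> w) \<longleftrightarrow> (`) \<pi> ` S \<subseteq> mst n w"
        using kruskal_image[where w = w and w' = "\<tau> w", OF \<pi> _ t] S by (auto simp: subset_iff)
      then show ?case using measurable_space[OF m\<tau> elim(2)] elim(2) by simp
    qed
  qed (use measurable_sets[OF m\<tau> sets_prob_in_mst] sets_prob_in_mst in auto)
  finally show ?thesis by (simp add: prob_in_mst_def exp_weights_def)
qed

text \<open>The complements of \<open>A\<close> and of its image under \<open>g\<close> have equal
  size, so a bijection between them completes \<open>g\<close> to a permutation.\<close>

lemma ex_permutes_extension:
  assumes "finite V" "A \<subseteq> V" "g ` A \<subseteq> V" "inj_on g A"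
  shows "\<exists>\<pi>. \<pi> permutes V \<and> (\<forall>a\<in>A. \<pi> a = g a)"
proof -
  have fA: "finite A" using assms(1,2) finite_subset by blast
  have "card (V - A) = card (V - g ` A)"
    using assms fA by (simp add: card_Diff_subset card_image)
  then obtain h where h: "bij_betw h (V - A) (V - g ` A)"
    using assms(1) finite_same_card_bij[of "V - A" "V - g ` A"] by auto
  define \<pi> where "\<pi> x = (if x \<in> A then g x else if x \<in> V then h x else x)" for x
  have "bij_betw \<pi> A (g ` A)" using assms(4) by (auto simp: bij_betw_def \<pi>_def inj_on_def)
  moreover have "bij_betw \<pi> (V - A) (V - g ` A)"
    using h by (rule bij_betw_cong[THEN iffD1, rotated]) (auto simp: \<pi>_def)
  ultimately have "bij_betw \<pi> (A \<union> (V - A)) (g ` A \<union> (V - g ` A))"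
    by (rule bij_betw_combine) auto
  moreover have "A \<union> (V - A) = V" "g ` A \<union> (V - g ` A) = V" using assms by auto
  ultimately have "\<pi> permutes V" using assms(2) by (intro bij_imp_permutes) (auto simp: \<pi>_def)
  then show ?thesis by (auto simp: \<pi>_def)
qed

lemma prob_in_mst_transfer:
  assumes n: "n \<ge> 1" and S: "S \<subseteq> K_edges n" and g: "inj_on g A" "A \<subseteq> {..<n}" "g ` A \<subseteq> {..<n}" "\<Union>S \<subseteq> A"
  shows "prob_in_mst n ((`) g ` S) = prob_in_mst n S"
proof -
  obtain \<pi> where \<pi>: "\<pi> permutes {..<n}" "\<And>a. a \<in> A \<Longrightarrow> \<pi> a = g a"
    using ex_permutes_extension[OF finite_lessThan g(2,3,1)] by blast
  have "(`) \<pi> ` S = (`) g ` S"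
    using \<pi>(2) g(4) by (intro image_cong refl) (auto intro!: image_cong)
  then show ?thesis using prob_in_mst_image[OF n \<pi>(1) S] by simp
qed

lemma prob_edge_eq:
  assumes "e \<in> K_edges n" "f \<in> K_edges n"
  shows "prob_in_mst n {e} = prob_in_mst n {f}"
proof -
  obtain x y where e: "x < n" "y < n" "x \<noteq> y" "e = {x, y}" using assms(1) by (auto simp: K_edges_iff)
  obtain x' y' where f: "x' < n" "y' < n" "x' \<noteq> y'" "f = {x', y'}" using assms(2) by (auto simp: K_edges_iff)
  define g where "g = id(x := x', y := y')"
  have g: "g x = x'" "g y = y'" using e by (simp_all add: g_def)
  have "prob_in_mst n ((`) g ` {e}) = prob_in_mst n {e}"
    by (rule prob_in_mst_transfer[where A = "{x, y}"]) (use e f g assms in \<open>auto simp: inj_on_def\<close>)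
  then show ?thesis using e f g by simp
qed

lemma adjacent_edgesE:
  assumes "e \<in> K_edges n" "f \<in> K_edges n" "e \<noteq> f" "e \<inter> f \<noteq> {}"
  obtains x y z where "x < n" "y < n" "z < n" "x \<noteq> y" "x \<noteq> z" "y \<noteq> z" "e = {x, y}" "f = {x, z}"
proof -
  obtain x where x: "x \<in> e" "x \<in> f" using assms(4) by auto
  obtain y where y: "e = {x, y}" "x \<noteq> y" using assms(1) x by (auto simp: K_edges_iff)
  obtain z where z: "f = {x, z}" "x \<noteq> z" using assms(2) x by (auto simp: K_edges_iff)
  have "x < n" "y < n" "z < n" using assms(1,2) y z by (auto simp: pair_in_K_edges)
  then show ?thesis using that y z assms(3) by auto
qed

lemma prob_adjacent_eq:
  assumes "e \<in> K_edges n" "f \<in> K_edges n" "e \<noteq> f" "e \<inter> f \<noteq> {}"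
    and "e' \<in> K_edges n" "f' \<in> K_edges n" "e' \<noteq> f'" "e' \<inter> f' \<noteq> {}"
  shows "prob_in_mst n {e, f} = prob_in_mst n {e', f'}"
proof -
  obtain x y z where e: "x < n" "y < n" "z < n" "x \<noteq> y" "x \<noteq> z" "y \<noteq> z" "e = {x, y}" "f = {x, z}"
    by (rule adjacent_edgesE[OF assms(1-4)])
  obtain x' y' z' where f: "x' < n" "y' < n" "z' < n" "x' \<noteq> y'" "x' \<noteq> z'" "y' \<noteq> z'" "e' = {x', y'}" "f' = {x', z'}"
    by (rule adjacent_edgesE[OF assms(5-8)])
  define g where "g = id(x := x', y := y', z := z')"
  have g: "g x = x'" "g y = y'" "g z = z'" using e by (simp_all add: g_def)
  have "prob_in_mst n ((`) g ` {e, f}) = prob_in_mst n {e, f}"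
  proof (rule prob_in_mst_transfer[where A = "{x, y, z}"])
    show "inj_on g {x, y, z}" unfolding inj_on_def by (simp add: g f(4-6) f(4-6)[symmetric])
    show "g ` {x, y, z} \<subseteq> {..<n}" using g f by simp
    show "1 \<le> n" "{x, y, z} \<subseteq> {..<n}" using e by simp_all
    show "{e, f} \<subseteq> K_edges n" using assms by simp
    show "\<Union>{e, f} \<subseteq> {x, y, z}" unfolding e(7,8) by simp
  qed
  then show ?thesis using e f g by simp
qed

lemma prob_disjoint_eq:
  assumes "e \<in> K_edges n" "f \<in> K_edges n" "e \<inter> f = {}"
    and "e' \<in> K_edges n" "f' \<in> K_edges n" "e' \<inter> f' = {}"
  shows "prob_in_mst n {e, f} = prob_in_mst n {e', f'}"
proof -
  obtain x y where e: "x < n" "y < n" "x \<noteq> y" "e = {x, y}" using assms(1) by (auto simp: K_edges_iff)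
  obtain z t where f: "z < n" "t < n" "z \<noteq> t" "f = {z, t}" using assms(2) by (auto simp: K_edges_iff)
  obtain x' y' where e': "x' < n" "y' < n" "x' \<noteq> y'" "e' = {x', y'}" using assms(4) by (auto simp: K_edges_iff)
  obtain z' t' where f': "z' < n" "t' < n" "z' \<noteq> t'" "f' = {z', t'}" using assms(5) by (auto simp: K_edges_iff)
  have d: "x \<noteq> z" "x \<noteq> t" "y \<noteq> z" "y \<noteq> t" "x' \<noteq> z'" "x' \<noteq> t'" "y' \<noteq> z'" "y' \<noteq> t'"
    using assms(3,6) e f e' f' by auto
  define g where "g = id(x := x', y := y', z := z', t := t')"
  have g: "g x = x'" "g y = y'" "g z = z'" "g t = t'" using e f d by (simp_all add: g_def)
  have "prob_in_mst n ((`) g ` {e, f}) = prob_in_mst n {e, f}"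
  proof (rule prob_in_mst_transfer[where A = "{x, y, z, t}"])
    show "inj_on g {x, y, z, t}" unfolding inj_on_def by (simp add: g d d[symmetric] e'(3) e'(3)[symmetric] f'(3) f'(3)[symmetric])
    show "g ` {x, y, z, t} \<subseteq> {..<n}" using g e' f' by simp
    show "1 \<le> n" "{x, y, z, t} \<subseteq> {..<n}" using e f by simp_all
    show "{e, f} \<subseteq> K_edges n" using assms by simp
    show "\<Union>{e, f} \<subseteq> {x, y, z, t}" unfolding e(4) f(4) by simp
  qed
  then show ?thesis using e f e' f' g by simp
qed

section \<open>First and second moments of edge counts in the tree\<close>

lemma integral_subset_mst: "(\<integral>w. (if S \<subseteq> mst n w then 1 else 0 :: real) \<partial>exp.W n) = prob_in_mst n S"
proof -
  have "(\<integral>w. (if S \<subseteq> mst n w then 1 else 0 :: real) \<partial>exp.W n) =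
    (\<integral>w. indicator {w \<in> space (exp.W n). S \<subseteq> mst n w} w \<partial>exp.W n)"
    by (intro Bochner_Integration.integral_cong) (auto simp: indicator_def)
  moreover have "{w \<in> space (exp.W n). S \<subseteq> mst n w} \<inter> space (exp.W n) = {w \<in> space (exp.W n). S \<subseteq> mst n w}"
    by auto
  ultimately show ?thesis by (simp add: prob_in_mst_def exp_weights_def)
qed

lemma card_inter_mst:
  assumes "B \<subseteq> K_edges n"
  shows "real (card {e \<in> B. e \<in> mst n w}) = (\<Sum>e\<in>B. if {e} \<subseteq> mst n w then 1 else 0)"
  using sum.inter_filter[of B "\<lambda>_. 1 :: real" "\<lambda>e. e \<in> mst n w"] finite_subset[OF assms] by simp

lemma integral_card_mst:
  assumes n: "n \<ge> 1" and B: "B \<subseteq> K_edges n"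
  shows "(\<integral>w. real (card {e \<in> B. e \<in> mst n w}) \<partial>exp.W n) = (\<Sum>e\<in>B. prob_in_mst n {e})"
    and "(\<integral>w. (real (card {e \<in> B. e \<in> mst n w}))\<^sup>2 \<partial>exp.W n) = (\<Sum>e\<in>B. \<Sum>f\<in>B. prob_in_mst n {e, f})"
proof -
  have int: "integrable (exp.W n) (\<lambda>w. (if S \<subseteq> mst n w then 1 else 0) :: real)" for S
    by (rule integrable_mst_fun[OF n])
  show "(\<integral>w. real (card {e \<in> B. e \<in> mst n w}) \<partial>exp.W n) = (\<Sum>e\<in>B. prob_in_mst n {e})"
    unfolding card_inter_mst[OF B] integral_subset_mst[symmetric]
    by (rule Bochner_Integration.integral_sum[OF int])
  \<comment> \<open>The square expands into ordered pairs; for \<open>e = f\<close> the set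
    \<open>{e, f}\<close> is a singleton, so the diagonal carries the probabilities of single
    edges.\<close>
  have "(real (card {e \<in> B. e \<in> mst n w}))\<^sup>2 = (\<Sum>e\<in>B. \<Sum>f\<in>B. if {e, f} \<subseteq> mst n w then 1 else 0)" for w
    unfolding card_inter_mst[OF B] power2_eq_square sum_product
    by (intro sum.cong refl) auto
  then have "(\<integral>w. (real (card {e \<in> B. e \<in> mst n w}))\<^sup>2 \<partial>exp.W n) =
    (\<integral>w. (\<Sum>e\<in>B. \<Sum>f\<in>B. if {e, f} \<subseteq> mst n w then 1 else 0) \<partial>exp.W n)" by simp
  also have "\<dots> = (\<Sum>e\<in>B. \<integral>w. (\<Sum>f\<in>B. if {e, f} \<subseteq> mst n w then 1 else 0) \<partial>exp.W n)"
    by (intro Bochner_Integration.integral_sum Bochner_Integration.integrable_sum int)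
  also have "\<dots> = (\<Sum>e\<in>B. \<Sum>f\<in>B. prob_in_mst n {e, f})"
    unfolding integral_subset_mst[symmetric]
    by (intro sum.cong refl Bochner_Integration.integral_sum int)
  finally show "(\<integral>w. (real (card {e \<in> B. e \<in> mst n w}))\<^sup>2 \<partial>exp.W n) = (\<Sum>e\<in>B. \<Sum>f\<in>B. prob_in_mst n {e, f})" .
qed

lemma card_pairs:
  assumes "finite V"
  shows "real (card {e. e \<subseteq> V \<and> card e = 2}) = real (card V) * (real (card V) - 1) / 2"
proof -
  have "card {e. e \<subseteq> V \<and> card e = 2} = card V choose 2" by (rule n_subsets[OF assms])
  then show ?thesis
    by (cases "card V") (auto simp: choose_two real_of_nat_div algebra_simps)
qed

lemma card_K_edges: "real (card (K_edges n)) = real n * (real n - 1) / 2"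
  using card_pairs[of "{..<n}"] by (simp add: K_edges_def)

text \<open>All edges are equally likely, and the tree uses \<open>n - 1\<close> of the
  \<open>n * (n - 1) / 2\<close> edges.\<close>

lemma prob_edge:
  assumes "n \<ge> 2" "e \<in> K_edges n"
  shows "prob_in_mst n {e} = 2 / real n"
proof -
  have n: "n \<ge> 1" using assms by simp
  interpret prob_space "exp.W n" by (rule exp.prob_space_W)
  have "{e \<in> K_edges n. e \<in> mst n w} = mst n w" for w using mst_subset[OF n, of w] by auto
  then have "(\<Sum>f\<in>K_edges n. prob_in_mst n {f}) = (\<integral>w. real (card (mst n w)) \<partial>exp.W n)"
    using integral_card_mst(1)[OF n subset_refl] by simp
  also have "\<dots> = real n - 1" using card_mst[OF n] n prob_space by simp
  also have "(\<Sum>f\<in>K_edges n. prob_in_mst n {f}) = (\<Sum>f\<in>K_edges n. prob_in_mst n {e})"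
    by (intro sum.cong refl prob_edge_eq assms(2))
  finally have "real (card (K_edges n)) * prob_in_mst n {e} = real n - 1" by simp
  then have "(real n - 1) * (real n * prob_in_mst n {e} - 2) = 0"
    unfolding card_K_edges by (simp add: field_simps)
  then have "real n * prob_in_mst n {e} = 2" using assms(1) by simp
  then show ?thesis using assms(1) by (simp add: field_simps)
qed

text \<open>The degree is a sum of \<open>n - 1\<close> edge indicators; its square has
  \<open>n - 1\<close> diagonal terms of mean \<open>2 / n\<close> and
  \<open>(n - 1) * (n - 2)\<close> terms for ordered pairs of distinct edges meeting at
  \<open>x\<close>.\<close>

lemma E_deg_sq_prob:
  assumes "n \<ge> 3" "x < n" "a \<in> K_edges n" "a' \<in> K_edges n" "a \<noteq> a'" "a \<inter> a' \<noteq> {}"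
  shows "E_deg_sq n x = (real n - 1) * (2 / real n) + (real n - 1) * (real n - 2) * prob_in_mst n {a, a'}"
proof -
  have n: "n \<ge> 1" using assms by simp
  define B where "B = {e \<in> K_edges n. x \<in> e}"
  have B: "B \<subseteq> K_edges n" "finite B" by (auto simp: B_def)
  have cB: "card B = n - 1" unfolding B_def by (rule card_edges_at_vertex[OF assms(2)])
  have "{e \<in> B. e \<in> mst n w} = {e \<in> mst n w. x \<in> e}" for w
    using mst_subset[OF n, of w] by (auto simp: B_def)
  then have "E_deg_sq n x = (\<Sum>e\<in>B. \<Sum>f\<in>B. prob_in_mst n {e, f})"
    using integral_card_mst(2)[OF n B(1)] by (simp add: E_deg_sq_def exp_weights_def mst_degree_def)
  also have "\<dots> = (\<Sum>e\<in>B. 2 / real n + (real n - 2) * prob_in_mst n {a, a'})"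
  proof (rule sum.cong)
    fix e assume e: "e \<in> B"
    have "(\<Sum>f\<in>B. prob_in_mst n {e, f}) = prob_in_mst n {e} + (\<Sum>f\<in>B - {e}. prob_in_mst n {e, f})"
      using B(2) e by (simp add: sum.remove)
    also have "(\<Sum>f\<in>B - {e}. prob_in_mst n {e, f}) = (\<Sum>f\<in>B - {e}. prob_in_mst n {a, a'})"
      using e assms by (intro sum.cong refl prob_adjacent_eq) (auto simp: B_def)
    also have "\<dots> = (real n - 2) * prob_in_mst n {a, a'}"
      using B(2) e cB assms(1) by (simp add: of_nat_diff)
    finally show "(\<Sum>f\<in>B. prob_in_mst n {e, f}) = 2 / real n + (real n - 2) * prob_in_mst n {a, a'}"
      using prob_edge[of n e] e assms(1) by (simp add: B_def)
  qed simp
  finally show ?thesis using cB n by (simp add: distrib_left of_nat_diff)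
qed

text \<open>The right-hand side of \<open>E_deg_sq_prob\<close> does not involve the vertex, so each
  second moment equals the average supplied by \<open>sum_E_deg_sq\<close>; \<open>{0, 1}\<close>
  and \<open>{0, 2}\<close> serve as a sample adjacent pair.\<close>

lemma E_deg_sq_eq:
  assumes "n \<ge> 3" "x < n"
  shows "E_deg_sq n x = 10 - 10 / real n - 4 * E_L n"
proof -
  have e: "{0, 1} \<in> K_edges n" "{0, 2} \<in> K_edges n" "{0, 1 :: nat} \<noteq> {0, 2}" "{0, 1 :: nat} \<inter> {0, 2} \<noteq> {}"
    using assms(1) by (auto simp: pair_in_K_edges doubleton_eq_iff)
  have "E_deg_sq n y = E_deg_sq n x" if "y < n" for y
    using E_deg_sq_prob[OF assms(1) that e] E_deg_sq_prob[OF assms e] by simp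
  then have "(\<Sum>y<n. E_deg_sq n y) = (\<Sum>y<n. E_deg_sq n x)" by (intro sum.cong refl) simp
  then have "real n * E_deg_sq n x = 10 * (real n - 1) - 4 * real n * E_L n"
    using sum_E_deg_sq[of n] assms by simp
  then show ?thesis using assms(1) by (simp add: field_simps)
qed

lemma prob_adjacent:
  assumes "n \<ge> 3" "a \<in> K_edges n" "a' \<in> K_edges n" "a \<noteq> a'" "a \<inter> a' \<noteq> {}"
  shows "(real n - 1) * (real n - 2) * prob_in_mst n {a, a'} = 8 * (real n - 1) / real n - 4 * E_L n"
  using E_deg_sq_prob[OF assms(1) _ assms(2-5), of 0] E_deg_sq_eq[OF assms(1), of 0] assms(1)
  by (simp add: field_simps)

text \<open>The number of tree edges is constant, so its second moment is the square of
  \<open>n - 1\<close>. Expanded over ordered pairs of edges, it leaves \<open>p2\<close> as the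
  only unknown beside \<open>p1\<close>: an edge meets \<open>2 * (n - 2)\<close> others and is
  disjoint from \<open>(n - 2) * (n - 3) / 2\<close>.\<close>

lemma prob_disjoint:
  assumes "n \<ge> 4" "b \<in> K_edges n" "b' \<in> K_edges n" "b \<inter> b' = {}"
  shows "real n * (real n - 1) * (real n - 2) * (real n - 3) * prob_in_mst n {b, b'} =
    4 * (real n - 1) * (real n - 10) + 16 * real n * E_L n"
proof -
  have n: "n \<ge> 1" "n \<ge> 2" "n \<ge> 3" using assms by auto
  interpret prob_space "exp.W n" by (rule exp.prob_space_W)
  let ?K = "K_edges n"
  define N where "N = real n"
  define p1 p2 where "p1 = prob_in_mst n {{0, 1}, {0, 2}}" and "p2 = prob_in_mst n {b, b'}"
  have e: "{0, 1} \<in> K_edges n" "{0, 2} \<in> K_edges n" "{0, 1 :: nat} \<noteq> {0, 2}" "{0, 1 :: nat} \<inter> {0, 2} \<noteq> {}"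
    using n by (auto simp: pair_in_K_edges doubleton_eq_iff)
  have p1: "(N - 1) * (N - 2) * p1 = 8 * (N - 1) / N - 4 * E_L n"
    unfolding p1_def N_def by (rule prob_adjacent[OF n(3) e])
  have row: "(\<Sum>f\<in>?K. prob_in_mst n {e, f}) = 2 / N + 2 * (N - 2) * p1 + (N - 2) * (N - 3) / 2 * p2"
    if e': "e \<in> ?K" for e
  proof -
    let ?D = "{f \<in> ?K. e \<inter> f = {}}" and ?A = "{f \<in> ?K. e \<noteq> f \<and> e \<inter> f \<noteq> {}}"
    have ne: "e \<noteq> {}" "card e = 2" "e \<subseteq> {..<n}" "finite e"
      using card_edge[OF e'] finite_edge[OF e'] e' by (auto simp: K_edges_def)
    have split: "?K = insert e (?A \<union> ?D)" using e' by blast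
    have "?D = {f. f \<subseteq> {..<n} - e \<and> card f = 2}" by (auto simp: K_edges_def)
    moreover have "real (card ({..<n} - e)) = N - 2"
      using ne n by (simp add: card_Diff_subset N_def of_nat_diff)
    ultimately have cD: "real (card ?D) = (N - 2) * (N - 3) / 2"
      using card_pairs[of "{..<n} - e"] by simp
    have "card ?K = card (insert e (?A \<union> ?D))" using split by (rule arg_cong)
    also have "\<dots> = 1 + card (?A \<union> ?D)" using ne by (subst card_insert_disjoint) auto
    also have "card (?A \<union> ?D) = card ?A + card ?D" by (rule card_Un_disjoint) auto
    finally have "real (card ?K) = 1 + real (card ?A) + real (card ?D)" by simp
    \<comment> \<open>The edges adjacent to \<open>e\<close> are counted as the remainder of all
      \<open>n * (n - 1) / 2\<close> edges.\<close>
    then have cA: "real (card ?A) = 2 * (N - 2)"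
      unfolding cD card_K_edges N_def[symmetric] by (simp add: field_simps)
    have "(\<Sum>f\<in>?K. prob_in_mst n {e, f}) = (\<Sum>f\<in>insert e (?A \<union> ?D). prob_in_mst n {e, f})"
      using split by (rule sum.cong) simp
    also have "\<dots> = prob_in_mst n {e, e} + (\<Sum>f\<in>?A \<union> ?D. prob_in_mst n {e, f})"
      using ne by (subst sum.insert) auto
    also have "(\<Sum>f\<in>?A \<union> ?D. prob_in_mst n {e, f}) = (\<Sum>f\<in>?A. prob_in_mst n {e, f}) + (\<Sum>f\<in>?D. prob_in_mst n {e, f})"
      by (rule sum.union_disjoint) auto
    also have "(\<Sum>f\<in>?A. prob_in_mst n {e, f}) = (\<Sum>f\<in>?A. p1)"
      unfolding p1_def using e e' by (intro sum.cong refl prob_adjacent_eq) auto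
    also have "(\<Sum>f\<in>?D. prob_in_mst n {e, f}) = (\<Sum>f\<in>?D. p2)"
      unfolding p2_def using e' assms by (intro sum.cong refl prob_disjoint_eq) auto
    finally show ?thesis using prob_edge[OF n(2) e'] cA cD by (simp add: N_def)
  qed
  have "{e \<in> ?K. e \<in> mst n w} = mst n w" for w using mst_subset[OF n(1), of w] by auto
  then have "(\<Sum>e\<in>?K. \<Sum>f\<in>?K. prob_in_mst n {e, f}) = (\<integral>w. (real (card (mst n w)))\<^sup>2 \<partial>exp.W n)"
    using integral_card_mst(2)[OF n(1) subset_refl] by simp
  also have "\<dots> = (N - 1)\<^sup>2" using card_mst[OF n(1)] n(1) prob_space by (simp add: N_def of_nat_diff)
  finally have "N * (N - 1) / 2 * (2 / N + 2 * (N - 2) * p1 + (N - 2) * (N - 3) / 2 * p2) = (N - 1)\<^sup>2"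
    by (simp add: row card_K_edges N_def)
  moreover have "N * (N - 1) / 2 * (2 / N + 2 * (N - 2) * p1 + (N - 2) * (N - 3) / 2 * p2) =
    (N - 1) + N * ((N - 1) * (N - 2) * p1) + N * (N - 1) * (N - 2) * (N - 3) * p2 / 4"
    using n by (simp add: field_simps N_def)
  moreover have "N * ((N - 1) * (N - 2) * p1) = 8 * (N - 1) - 4 * N * E_L n"
    unfolding p1 using n by (simp add: field_simps N_def)
  ultimately have "(N - 1)\<^sup>2 = (N - 1) + (8 * (N - 1) - 4 * N * E_L n) + N * (N - 1) * (N - 2) * (N - 3) * p2 / 4"
    by metis
  moreover have "Y = 4 * (A - B - X)" if "A = B + X + Y / 4" for A B X Y :: real using that by simp
  ultimately have "N * (N - 1) * (N - 2) * (N - 3) * p2 = 4 * ((N - 1)\<^sup>2 - (N - 1) - (8 * (N - 1) - 4 * N * E_L n))"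
    by blast
  also have "\<dots> = 4 * (N - 1) * (N - 10) + 16 * N * E_L n"
    by (simp add: power2_eq_square algebra_simps)
  finally show ?thesis by (simp add: N_def p2_def)
qed

section \<open>Asymptotic expansions\<close>

lemma smallo_const_mult: "f \<in> o[F](g) \<Longrightarrow> (\<lambda>x. c * f x :: real) \<in> o[F](g)"
  by (cases "c = 0") simp_all

lemma bigo_const_mult: "f \<in> O[F](g) \<Longrightarrow> (\<lambda>x. c * f x :: real) \<in> O[F](g)"
  by (cases "c = 0") simp_all

text \<open>With \<open>R = n * (L - U) - U\<close> one has \<open>L = U + U / n + R / n\<close>.
  Here \<open>U / n\<close> contributes \<open>z / n\<close> and otherwise only negligible terms, so
  it suffices that \<open>R\<close> is o(n^(-1/3)).\<close>

lemma exp_expansion_from_unif: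
  fixes U L :: "nat \<Rightarrow> real" and z c1 c2 :: real
  assumes U: "(\<lambda>n. U n - (z + c1 / real n + c2 / real n powr (4/3))) \<in> o(\<lambda>n. 1 / real n powr (4/3))"
    and approx: "\<And>n T. n \<ge> 2 \<Longrightarrow> 0 \<le> T \<Longrightarrow> T \<le> 1 / 2 \<Longrightarrow> \<bar>real n * (L n - U n) - U n\<bar> \<le>
      T + real n * T\<^sup>2 + (real n)\<^sup>2 * exp (- (real n / 2 - 1) * T)"
  shows "(\<lambda>n. L n - (z + (c1 + z) / real n + c2 / real n powr (4/3))) \<in> o(\<lambda>n. 1 / real n powr (4/3))"
proof -
  let ?g = "\<lambda>n. 1 / real n powr (1/3)" and ?h = "\<lambda>n. 1 / real n powr (4/3)"
  \<comment> \<open>The constant 8 makes the exponential term of order n^(-2), since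
    \<open>(n / 2 - 1) * T\<close> is about \<open>4 * ln n\<close>; the other terms are of order
    (ln n)^2 / n. Both are far below n^(-1/3).\<close>
  define T where "T n = 8 * ln (real n) / real n" for n :: nat
  define V where "V n = U n - (z + c1 / real n + c2 / real n powr (4/3))" for n
  define R where "R n = real n * (L n - U n) - U n" for n
  have V: "V \<in> o(?h)" using U by (simp add: V_def[abs_def])
  have small: "R \<in> o(?g)"
  proof (rule landau_o.big_small_trans)
    have "\<forall>\<^sub>F n in sequentially. T n \<le> 1 / 2" unfolding T_def by real_asymp
    then have "\<forall>\<^sub>F n in sequentially. norm (R n) \<le>
        norm (T n + real n * (T n)\<^sup>2 + (real n)\<^sup>2 * exp (- (real n / 2 - 1) * T n))"
      using eventually_ge_at_top[of 2]
    proof eventually_elim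
      case (elim n)
      have "0 \<le> T n" using elim by (simp add: T_def)
      then show ?case using approx[of n "T n"] elim by (simp add: R_def)
    qed
    then show "R \<in> O(\<lambda>n. T n + real n * (T n)\<^sup>2 + (real n)\<^sup>2 * exp (- (real n / 2 - 1) * T n))"
      by (rule landau_o.big_mono)
    show "(\<lambda>n. T n + real n * (T n)\<^sup>2 + (real n)\<^sup>2 * exp (- (real n / 2 - 1) * T n)) \<in> o(?g)"
      unfolding T_def by real_asymp
  qed
  have "(\<lambda>n. V n + (c1 * (1 / real n) + c2 * (1 / real n powr (4/3)))) \<in> o(?g)"
  proof (intro sum_in_smallo)
    show "V \<in> o(?g)" by (rule landau_o.small_trans[OF V]) real_asymp
    show "(\<lambda>n. c1 * (1 / real n)) \<in> o(?g)" by (rule smallo_const_mult) real_asymp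
    show "(\<lambda>n. c2 * (1 / real n powr (4/3))) \<in> o(?g)" by (rule smallo_const_mult) real_asymp
  qed
  from sum_in_smallo(1)[OF this small]
  have "(\<lambda>n. (V n + (c1 * (1 / real n) + c2 * (1 / real n powr (4/3))) + R n) * (1 / real n)) \<in> o(\<lambda>n. ?g n * (1 / real n))"
    by (rule landau_o.small_big_mult) (rule landau_o.big_refl)
  also have "(\<lambda>n. ?g n * (1 / real n)) \<in> O(?h)" by real_asymp
  finally have "(\<lambda>n. V n + (V n + (c1 * (1 / real n) + c2 * (1 / real n powr (4/3))) + R n) * (1 / real n)) \<in> o(?h)"
    by (rule sum_in_smallo(1)[OF V])
  moreover have "\<forall>\<^sub>F n in sequentially. V n + (V n + (c1 * (1 / real n) + c2 * (1 / real n powr (4/3))) + R n) * (1 / real n)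
     = L n - (z + (c1 + z) / real n + c2 / real n powr (4/3))"
    using eventually_gt_at_top[of 0]
  proof eventually_elim
    case (elim n)
    have "(V n + (c1 * (1 / real n) + c2 * (1 / real n powr (4/3))) + R n) * (1 / real n) =
      (real n * (L n - U n) - z) * (1 / real n)"
      by (simp add: V_def R_def)
    also have "\<dots> = L n - U n - z / real n" using elim by (simp add: field_simps)
    finally show ?case by (simp add: V_def add_divide_distrib)
  qed
  ultimately show ?thesis by (rule landau_o.small.in_cong[THEN iffD1, rotated])
qed

lemma smallo_remainder_tendsto:
  fixes f g :: "nat \<Rightarrow> real"
  assumes "(\<lambda>n. f n - g n) \<in> o(\<lambda>n. 1 / real n powr (4/3))" "g \<longlonglongrightarrow> l"
  shows "f \<longlonglongrightarrow> l"
proof -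
  have "(\<lambda>n. f n - g n) \<in> o(\<lambda>n. 1 :: real)" by (rule landau_o.small_trans[OF assms(1)]) real_asymp
  from smalloD_tendsto[OF this] have "(\<lambda>n. f n - g n) \<longlonglongrightarrow> 0" by simp
  then have "(\<lambda>n. (f n - g n) + g n) \<longlonglongrightarrow> 0 + l" using assms(2) by (rule tendsto_add)
  then show ?thesis by simp
qed

text \<open>The quotient is \<open>2 * n / (n - 2) - q * L\<close> with \<open>q\<close> equal to 1
  + 3/n up to O(n^(-2)). The first part gives \<open>2 + 4 / n\<close>, and \<open>q * z\<close> the
  additional \<open>3 * z / n\<close>; the products of \<open>q - 1\<close> with the smaller terms
  of \<open>L\<close> are negligible.\<close>

lemma adjacent_expansion:
  fixes L :: "nat \<Rightarrow> real" and z d c :: real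
  assumes L: "(\<lambda>n. L n - (z + d / real n + c / real n powr (4/3))) \<in> o(\<lambda>n. 1 / real n powr (4/3))"
  shows "(\<lambda>n. (2 * real n * (real n - 1) - (real n)\<^sup>2 * L n) / ((real n - 1) * (real n - 2))
      - (2 - z + (4 - d - 3 * z) / real n - c / real n powr (4/3))) \<in> o(\<lambda>n. 1 / real n powr (4/3))"
proof -
  let ?h = "\<lambda>n. 1 / real n powr (4/3)"
  define q where "q n = (real n)\<^sup>2 / ((real n - 1) * (real n - 2))" for n :: nat
  define V where "V n = L n - (z + d / real n + c / real n powr (4/3))" for n
  have V: "V \<in> o(?h)" using L by (simp add: V_def[abs_def])
  have q: "q \<in> O(\<lambda>n. 1)" unfolding q_def[abs_def] by real_asymp
  have "(\<lambda>n. V n * q n) \<in> o(\<lambda>n. ?h n * 1)" using V q by (rule landau_o.small_big_mult)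
  then have 1: "(\<lambda>n. V n * q n) \<in> o(?h)" by simp
  have 2: "(\<lambda>n. 2 * real n * (real n - 1) / ((real n - 1) * (real n - 2)) - 2 - 4 / real n) \<in> o(?h)"
    by real_asymp
  have 3: "(\<lambda>n. z * (q n - 1 - 3 / real n)) \<in> o(?h)"
    by (rule smallo_const_mult) (unfold q_def, real_asymp)
  have 4: "(\<lambda>n. d * ((q n - 1) / real n)) \<in> o(?h)"
    by (rule smallo_const_mult) (unfold q_def, real_asymp)
  have 5: "(\<lambda>n. c * ((q n - 1) / real n powr (4/3))) \<in> o(?h)"
    by (rule smallo_const_mult) (unfold q_def, real_asymp)
  have "(\<lambda>n. (2 * real n * (real n - 1) / ((real n - 1) * (real n - 2)) - 2 - 4 / real n)
     - z * (q n - 1 - 3 / real n) - d * ((q n - 1) / real n) - c * ((q n - 1) / real n powr (4/3)) - V n * q n) \<in> o(?h)"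
    by (intro sum_in_smallo 1 2 3 4 5)
  moreover have "(2 * real n * (real n - 1) / ((real n - 1) * (real n - 2)) - 2 - 4 / real n)
     - z * (q n - 1 - 3 / real n) - d * ((q n - 1) / real n) - c * ((q n - 1) / real n powr (4/3)) - V n * q n =
     (2 * real n * (real n - 1) - (real n)\<^sup>2 * L n) / ((real n - 1) * (real n - 2))
      - (2 - z + (4 - d - 3 * z) / real n - c / real n powr (4/3))" for n
  proof -
    have "(2 * real n * (real n - 1) - (real n)\<^sup>2 * L n) / ((real n - 1) * (real n - 2)) =
      2 * real n * (real n - 1) / ((real n - 1) * (real n - 2)) - q n * L n"
      by (simp add: q_def diff_divide_distrib)
    moreover have "q n * L n = q n * V n + q n * z + q n * d / real n + q n * c / real n powr (4/3)"
      by (simp add: V_def algebra_simps)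
    ultimately show ?thesis
      by (simp add: algebra_simps add_divide_distrib diff_divide_distrib)
  qed
  ultimately show ?thesis by (simp only:)
qed

text \<open>\<open>L\<close> enters with the factor \<open>4 * r\<close>, where \<open>r\<close> is
  1/n up to O(n^(-2)). So only its limit \<open>z\<close> matters, and its corrections of order 1/n
  fall into the error. The remaining rational function is 1 - 5/n up to O(n^(-2)).\<close>

lemma disjoint_expansion:
  fixes L :: "nat \<Rightarrow> real" and z d c :: real
  assumes L: "(\<lambda>n. L n - (z + d / real n + c / real n powr (4/3))) \<in> o(\<lambda>n. 1 / real n powr (4/3))"
  shows "(\<lambda>n. real n * ((real n - 1) * (real n - 10) + 4 * real n * L n) / ((real n - 1) * (real n - 2) * (real n - 3))
      - (1 + (4 * z - 5) / real n)) \<in> O(\<lambda>n. 1 / (real n)\<^sup>2)"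
proof -
  let ?h = "\<lambda>n. 1 / (real n)\<^sup>2"
  define r where "r n = (real n)\<^sup>2 / ((real n - 1) * (real n - 2) * (real n - 3))" for n :: nat
  define V where "V n = L n - (z + d / real n + c / real n powr (4/3))" for n
  have V: "V \<in> o(\<lambda>n. 1 / real n powr (4/3))" using L by (simp add: V_def[abs_def])
  have r: "r \<in> O(\<lambda>n. 1 / real n)" unfolding r_def[abs_def] by real_asymp
  have "(\<lambda>n. V n + d * (1 / real n) + c * (1 / real n powr (4/3))) \<in> O(\<lambda>n. 1 / real n)"
  proof (intro sum_in_bigo)
    have "V \<in> o(\<lambda>n. 1 / real n)" by (rule landau_o.small_trans[OF V]) real_asymp
    then show "V \<in> O(\<lambda>n. 1 / real n)" by (rule landau_o.small_imp_big)
    show "(\<lambda>n. d * (1 / real n)) \<in> O(\<lambda>n. 1 / real n)" by (rule bigo_const_mult) real_asymp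
    show "(\<lambda>n. c * (1 / real n powr (4/3))) \<in> O(\<lambda>n. 1 / real n)" by (rule bigo_const_mult) real_asymp
  qed
  then have "(\<lambda>n. (V n + d * (1 / real n) + c * (1 / real n powr (4/3))) * r n) \<in> O(\<lambda>n. 1 / real n * (1 / real n))"
    using r by (rule landau_o.big_mult)
  then have 1: "(\<lambda>n. (V n + d * (1 / real n) + c * (1 / real n powr (4/3))) * r n) \<in> O(?h)"
    by (simp add: power2_eq_square)
  have 2: "(\<lambda>n. z * (r n - 1 / real n)) \<in> O(?h)"
    by (rule bigo_const_mult) (unfold r_def, real_asymp)
  have 3: "(\<lambda>n. real n * ((real n - 1) * (real n - 10)) / ((real n - 1) * (real n - 2) * (real n - 3)) - 1 + 5 / real n) \<in> O(?h)"
    by real_asymp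
  have "(\<lambda>n. (real n * ((real n - 1) * (real n - 10)) / ((real n - 1) * (real n - 2) * (real n - 3)) - 1 + 5 / real n)
     + 4 * (z * (r n - 1 / real n)) + 4 * ((V n + d * (1 / real n) + c * (1 / real n powr (4/3))) * r n)) \<in> O(?h)"
    by (intro sum_in_bigo 3 bigo_const_mult 1 2)
  moreover have "(real n * ((real n - 1) * (real n - 10)) / ((real n - 1) * (real n - 2) * (real n - 3)) - 1 + 5 / real n)
     + 4 * (z * (r n - 1 / real n)) + 4 * ((V n + d * (1 / real n) + c * (1 / real n powr (4/3))) * r n) =
     real n * ((real n - 1) * (real n - 10) + 4 * real n * L n) / ((real n - 1) * (real n - 2) * (real n - 3))
      - (1 + (4 * z - 5) / real n)" for n
  proof -
    have e1: "real n * ((real n - 1) * (real n - 10) + 4 * real n * L n) / ((real n - 1) * (real n - 2) * (real n - 3)) =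
      real n * ((real n - 1) * (real n - 10)) / ((real n - 1) * (real n - 2) * (real n - 3)) + 4 * (r n * L n)"
      by (simp add: r_def add_divide_distrib distrib_left power2_eq_square mult_ac)
    have e2: "(V n + d * (1 / real n) + c * (1 / real n powr (4/3))) * r n = r n * L n - z * r n"
      by (simp add: V_def algebra_simps)
    show ?thesis
      unfolding e1 e2 by (simp add: algebra_simps add_divide_distrib diff_divide_distrib)
  qed
  ultimately show ?thesis by (simp only:)
qed

lemma powr_term_tendsto: "(\<lambda>n. c / real n powr (4/3)) \<longlonglongrightarrow> 0"
proof -
  have "(\<lambda>n. 1 / real n powr (4/3)) \<longlonglongrightarrow> 0" by real_asymp
  from tendsto_mult_right_zero[OF this, of c] show ?thesis by simp
qed

lemma two_term_tendsto: "(\<lambda>n. l + k / real n - c / real n powr (4/3)) \<longlonglongrightarrow> l"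
  using tendsto_diff[OF tendsto_add[OF tendsto_const lim_const_over_n] powr_term_tendsto, of l k c] by simp

text \<open>After multiplication by \<open>n\<close>, the \<open>powr\<close> term and the error are
  O(n^(-1/3)), and only \<open>- k\<close> survives.\<close>

lemma smallo_remainder_rate:
  fixes f :: "nat \<Rightarrow> real"
  assumes "(\<lambda>n. f n - (l - k / real n - c / real n powr (4/3))) \<in> o(\<lambda>n. 1 / real n powr (4/3))"
  shows "(\<lambda>n. real n * (f n - l)) \<longlonglongrightarrow> - k"
proof -
  define V where "V n = f n - (l - k / real n - c / real n powr (4/3))" for n
  have "(\<lambda>n. real n * V n) \<in> o(\<lambda>n. real n * (1 / real n powr (4/3)))"
    using assms by (intro landau_o.big_small_mult) (simp_all add: V_def[abs_def])
  also have "(\<lambda>n. real n * (1 / real n powr (4/3))) \<in> O(\<lambda>n. 1 :: real)" by real_asymp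
  finally have "(\<lambda>n. real n * V n) \<in> o(\<lambda>n. 1 :: real)" .
  from smalloD_tendsto[OF this] have 1: "(\<lambda>n. real n * V n) \<longlonglongrightarrow> 0" by simp
  have "(\<lambda>n. real n / real n powr (4/3)) \<longlonglongrightarrow> 0" by real_asymp
  from tendsto_mult_right_zero[OF this, of c] have 2: "(\<lambda>n. c * (real n / real n powr (4/3))) \<longlonglongrightarrow> 0" .
  have "(\<lambda>n. real n * V n - c * (real n / real n powr (4/3)) - k) \<longlonglongrightarrow> 0 - 0 - k"
    by (intro tendsto_diff 1 2 tendsto_const)
  moreover have "\<forall>\<^sub>F n in sequentially. real n * V n - c * (real n / real n powr (4/3)) - k = real n * (f n - l)"
    using eventually_gt_at_top[of 0] by eventually_elim (simp add: V_def algebra_simps)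
  ultimately show ?thesis by (simp cong: filterlim_cong add: tendsto_cong)
qed

lemma bigo_remainder_tendsto:
  fixes f :: "nat \<Rightarrow> real"
  assumes "(\<lambda>n. f n - (l + k / real n)) \<in> O(\<lambda>n. 1 / (real n)\<^sup>2)"
  shows "f \<longlonglongrightarrow> l"
proof -
  have "(\<lambda>n. 1 / (real n)\<^sup>2) \<in> o(\<lambda>n. 1 :: real)" by real_asymp
  from landau_o.big_small_trans[OF assms this] have "(\<lambda>n. f n - (l + k / real n)) \<in> o(\<lambda>n. 1 :: real)" .
  from smalloD_tendsto[OF this] have "(\<lambda>n. f n - (l + k / real n)) \<longlonglongrightarrow> 0" by simp
  from tendsto_add[OF this tendsto_add[OF tendsto_const[of l] lim_const_over_n[of k]]] show ?thesis by simp
qed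

lemma bigtheta_inverse_rate:
  fixes g :: "nat \<Rightarrow> real"
  assumes "(\<lambda>n. real n * g n) \<longlonglongrightarrow> l" "l \<noteq> 0"
  shows "g \<in> \<Theta>(\<lambda>n. 1 / real n)"
proof (rule bigthetaI_tendsto_norm)
  show "\<bar>l\<bar> \<noteq> 0" using assms(2) by simp
  show "(\<lambda>n. norm (g n / (1 / real n))) \<longlonglongrightarrow> \<bar>l\<bar>"
    using tendsto_norm[OF assms(1)] by (simp add: mult.commute)
qed

lemma summable_inverse_cube: "summable (\<lambda>k. 1 / real k powr 3)"
proof -
  have "summable (\<lambda>k. real k powr (- 3))" by (subst summable_real_powr_iff) simp
  then show ?thesis by (simp add: powr_minus divide_inverse)
qed

text \<open>The vertex and the edges are arbitrary sequences indexed by \<open>n\<close>, which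
  covers every choice of them. Convergence of exact order 1/n needs a nonzero limit of the rescaled
  difference; this rests on the numerical value of \<open>c1\<close>, which enters as an antecedent
  because \<open>c1\<close> is a variable fixed by the expansion.\<close>

theorem corollary6p3:
  fixes c1 c2 :: real
    and x :: "nat \<Rightarrow> nat"
    and e a a' b b' :: "nat \<Rightarrow> nat set"
  assumes unif_expansion:
      "(\<lambda>n. E_L_unif n - (zeta 3 + c1 / real n + c2 / real n powr (4/3)))
         \<in> o(\<lambda>n. 1 / real n powr (4/3))"
    and vertex: "\<And>n. n \<ge> 1 \<Longrightarrow> x n < n"
    and edge: "\<And>n. n \<ge> 2 \<Longrightarrow> e n \<in> K_edges n"
    and adjacent_edges: "\<And>n. n \<ge> 3 \<Longrightarrow>
      a n \<in> K_edges n \<and> a' n \<in> K_edges n \<and> a n \<noteq> a' n \<and> a n \<inter> a' n \<noteq> {}"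
    and disjoint_edges: "\<And>n. n \<ge> 4 \<Longrightarrow>
      b n \<in> K_edges n \<and> b' n \<in> K_edges n \<and> b n \<inter> b' n = {}"
  shows
    "(\<forall>n\<ge>2. prob_in_mst n {e n} = 2 / real n) \<and>
     (\<lambda>n. E_L n - (zeta 3 + (c1 + zeta 3) / real n + c2 / real n powr (4/3)))
       \<in> o(\<lambda>n. 1 / real n powr (4/3)) \<and>
     (\<lambda>n. E_deg_sq n (x n)
            - (10 - 4 * zeta 3 - (10 + 4 * (c1 + zeta 3)) / real n - 4 * c2 / real n powr (4/3)))
       \<in> o(\<lambda>n. 1 / real n powr (4/3)) \<and>
     (\<lambda>n. prob_in_mst n {a n, a' n} / (prob_in_mst n {e n})\<^sup>2
            - (2 - zeta 3 + (4 - c1 - 4 * zeta 3) / real n - c2 / real n powr (4/3)))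
       \<in> o(\<lambda>n. 1 / real n powr (4/3)) \<and>
     (\<lambda>n. prob_in_mst n {b n, b' n} / (prob_in_mst n {e n})\<^sup>2
            - (1 + (4 * zeta 3 - 5) / real n))
       \<in> O(\<lambda>n. 1 / (real n)\<^sup>2) \<and>
     (\<lambda>n. E_deg_sq n (x n)) \<longlonglongrightarrow> 10 - 4 * zeta 3 \<and>
     (\<lambda>n. real n * (E_deg_sq n (x n) - (10 - 4 * zeta 3)))
       \<longlonglongrightarrow> - (10 + 4 * (c1 + zeta 3)) \<and>
     (0.0384956 \<le> c1 \<and> c1 \<le> 0.0384957 \<longrightarrow>
       (\<lambda>n. E_deg_sq n (x n) - (10 - 4 * zeta 3)) \<in> \<Theta>(\<lambda>n. 1 / real n)) \<and>
     (\<lambda>n. prob_in_mst n {a n, a' n} / (prob_in_mst n {e n})\<^sup>2) \<longlonglongrightarrow> 2 - zeta 3 \<and>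
     (\<lambda>n. prob_in_mst n {b n, b' n} / (prob_in_mst n {e n})\<^sup>2) \<longlonglongrightarrow> 1"
proof -
  let ?h = "\<lambda>n. 1 / real n powr (4/3)"
  define z where "z = zeta 3"
  have p0: "prob_in_mst n {e n} = 2 / real n" if "n \<ge> 2" for n
    using prob_edge[OF that edge[OF that]] .
  have L: "(\<lambda>n. E_L n - (z + (c1 + z) / real n + c2 / real n powr (4/3))) \<in> o(?h)"
    by (rule exp_expansion_from_unif[OF _ E_L_unif_approx]) (use unif_expansion in \<open>simp_all add: z_def\<close>)
  have D: "(\<lambda>n. E_deg_sq n (x n) - (10 - 4 * z - (10 + 4 * (c1 + z)) / real n - 4 * c2 / real n powr (4/3))) \<in> o(?h)"
  proof (rule landau_o.small.in_cong[THEN iffD1])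
    show "(\<lambda>n. - 4 * (E_L n - (z + (c1 + z) / real n + c2 / real n powr (4/3)))) \<in> o(?h)"
      by (rule smallo_const_mult[OF L])
    show "\<forall>\<^sub>F n in sequentially. - 4 * (E_L n - (z + (c1 + z) / real n + c2 / real n powr (4/3))) =
      E_deg_sq n (x n) - (10 - 4 * z - (10 + 4 * (c1 + z)) / real n - 4 * c2 / real n powr (4/3))"
      using eventually_ge_at_top[of 3]
    proof eventually_elim
      case (elim n)
      then have "E_deg_sq n (x n) = 10 - 10 / real n - 4 * E_L n"
        using E_deg_sq_eq[OF elim] vertex[of n] by simp
      then show ?case by (simp add: add_divide_distrib)
    qed
  qed
  have A: "(\<lambda>n. prob_in_mst n {a n, a' n} / (prob_in_mst n {e n})\<^sup>2
            - (2 - z + (4 - c1 - 4 * z) / real n - c2 / real n powr (4/3))) \<in> o(?h)"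
  proof (rule landau_o.small.in_cong[THEN iffD1])
    \<comment> \<open>Here \<open>d\<close> is \<open>c1 + z\<close>, the coefficient for
      exponential weights, so that \<open>4 - d - 3 * z\<close> becomes
      \<open>4 - c1 - 4 * z\<close>.\<close>
    show "(\<lambda>n. (2 * real n * (real n - 1) - (real n)\<^sup>2 * E_L n) / ((real n - 1) * (real n - 2))
      - (2 - z + (4 - (c1 + z) - 3 * z) / real n - c2 / real n powr (4/3))) \<in> o(?h)"
      by (rule adjacent_expansion[OF L])
    show "\<forall>\<^sub>F n in sequentially. (2 * real n * (real n - 1) - (real n)\<^sup>2 * E_L n) / ((real n - 1) * (real n - 2))
        - (2 - z + (4 - (c1 + z) - 3 * z) / real n - c2 / real n powr (4/3)) =
      prob_in_mst n {a n, a' n} / (prob_in_mst n {e n})\<^sup>2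
            - (2 - z + (4 - c1 - 4 * z) / real n - c2 / real n powr (4/3))"
      using eventually_ge_at_top[of 3]
    proof eventually_elim
      case (elim n)
      define N p where "N = real n" and "p = prob_in_mst n {a n, a' n}"
      have N: "N \<ge> 3" using elim by (simp add: N_def)
      have p: "(N - 1) * (N - 2) * p = 8 * (N - 1) / N - 4 * E_L n"
        unfolding N_def p_def using adjacent_edges[OF elim] by (intro prob_adjacent elim) auto
      \<comment> \<open>Since \<open>p0\<close> is \<open>2 / N\<close>, division by its square is
        multiplication by \<open>N\<^sup>2 / 4\<close>.\<close>
      have "(N - 1) * (N - 2) * (p * N\<^sup>2 / 4) = ((N - 1) * (N - 2) * p) * N\<^sup>2 / 4" by simp
      also have "\<dots> = 2 * N * (N - 1) - N\<^sup>2 * E_L n"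
        unfolding p using N by (simp add: field_simps power2_eq_square)
      finally have "(N - 1) * (N - 2) * (p * N\<^sup>2 / 4) = 2 * N * (N - 1) - N\<^sup>2 * E_L n" .
      then have "p * N\<^sup>2 / 4 = (2 * N * (N - 1) - N\<^sup>2 * E_L n) / ((N - 1) * (N - 2))"
        using N by (simp add: eq_divide_eq mult.commute)
      moreover have "p / (prob_in_mst n {e n})\<^sup>2 = p * N\<^sup>2 / 4"
        using p0[of n] elim by (simp add: N_def power_divide)
      moreover have "4 - (c1 + z) - 3 * z = 4 - c1 - 4 * z" by simp
      ultimately show ?case unfolding N_def p_def by (simp only:)
    qed
  qed
  have B: "(\<lambda>n. prob_in_mst n {b n, b' n} / (prob_in_mst n {e n})\<^sup>2 - (1 + (4 * z - 5) / real n))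
       \<in> O(\<lambda>n. 1 / (real n)\<^sup>2)"
  proof (rule landau_o.big.in_cong[THEN iffD1])
    show "(\<lambda>n. real n * ((real n - 1) * (real n - 10) + 4 * real n * E_L n) / ((real n - 1) * (real n - 2) * (real n - 3))
      - (1 + (4 * z - 5) / real n)) \<in> O(\<lambda>n. 1 / (real n)\<^sup>2)"
      by (rule disjoint_expansion[OF L])
    show "\<forall>\<^sub>F n in sequentially. real n * ((real n - 1) * (real n - 10) + 4 * real n * E_L n) / ((real n - 1) * (real n - 2) * (real n - 3))
        - (1 + (4 * z - 5) / real n) =
      prob_in_mst n {b n, b' n} / (prob_in_mst n {e n})\<^sup>2 - (1 + (4 * z - 5) / real n)"
      using eventually_ge_at_top[of 4]
    proof eventually_elim
      case (elim n)
      define N p where "N = real n" and "p = prob_in_mst n {b n, b' n}"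
      have N: "N \<ge> 4" using elim by (simp add: N_def)
      have "N * ((N - 1) * (N - 2) * (N - 3) * p) = 4 * ((N - 1) * (N - 10) + 4 * N * E_L n)"
        using prob_disjoint[OF elim, of "b n" "b' n"] disjoint_edges[OF elim]
        by (simp add: N_def p_def algebra_simps)
      then have "N * (N * ((N - 1) * (N - 2) * (N - 3) * p)) = N * (4 * ((N - 1) * (N - 10) + 4 * N * E_L n))"
        by simp
      then have "p * N\<^sup>2 / 4 * ((N - 1) * (N - 2) * (N - 3)) = N * ((N - 1) * (N - 10) + 4 * N * E_L n)"
        by (simp add: power2_eq_square mult_ac)
      moreover have "(N - 1) * (N - 2) * (N - 3) \<noteq> 0" using N by simp
      ultimately have "p * N\<^sup>2 / 4 = N * ((N - 1) * (N - 10) + 4 * N * E_L n) / ((N - 1) * (N - 2) * (N - 3))"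
        by (metis nonzero_eq_divide_eq)
      moreover have "p / (prob_in_mst n {e n})\<^sup>2 = p * N\<^sup>2 / 4"
        using p0[of n] elim by (simp add: N_def power_divide)
      moreover have "4 - (c1 + z) - 3 * z = 4 - c1 - 4 * z" by simp
      ultimately show ?case unfolding N_def p_def by (simp only:)
    qed
  qed
  have D_lim: "(\<lambda>n. E_deg_sq n (x n)) \<longlonglongrightarrow> 10 - 4 * z"
    using two_term_tendsto[of "10 - 4 * z" "- (10 + 4 * (c1 + z))" "4 * c2"]
    by (intro smallo_remainder_tendsto[OF D]) (simp only: minus_divide_left[symmetric] add_uminus_conv_diff)
  have D_rate: "(\<lambda>n. real n * (E_deg_sq n (x n) - (10 - 4 * z))) \<longlonglongrightarrow> - (10 + 4 * (c1 + z))"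
    by (rule smallo_remainder_rate[OF D])
  have A_lim: "(\<lambda>n. prob_in_mst n {a n, a' n} / (prob_in_mst n {e n})\<^sup>2) \<longlonglongrightarrow> 2 - z"
    by (rule smallo_remainder_tendsto[OF A]) (rule two_term_tendsto)
  have B_lim: "(\<lambda>n. prob_in_mst n {b n, b' n} / (prob_in_mst n {e n})\<^sup>2) \<longlonglongrightarrow> 1"
    by (rule bigo_remainder_tendsto[OF B])
  have z: "z \<ge> 0"
  proof -
    have "summable (\<lambda>k. 1 / real k powr 3)" by (rule summable_inverse_cube)
    then have "summable (\<lambda>k. 1 / real (Suc k) powr 3)" by (subst summable_Suc_iff)
    then show ?thesis unfolding z_def zeta_def by (rule suminf_nonneg) simp
  qed
  \<comment> \<open>With \<open>z \<ge> 0\<close> the bound on \<open>c1\<close> makes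
    \<open>10 + 4 * (c1 + z)\<close> positive, so the limit in \<open>D_rate\<close> is
    nonzero.\<close>
  have theta: "(\<lambda>n. E_deg_sq n (x n) - (10 - 4 * z)) \<in> \<Theta>(\<lambda>n. 1 / real n)" if "0.0384956 \<le> c1"
    by (rule bigtheta_inverse_rate[OF D_rate]) (use z that in simp)
  show ?thesis
    using p0 L D A B D_lim D_rate A_lim B_lim theta unfolding z_def by blast
qed

end
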